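(* Let $\mathscr{T}$ be a T-mesh, let $c$ be the number of its cross-cuts, $t$ the number of its T $l$-edges, $n_v$ the number of its interior vertices, and let its completely non-diagonalizable component (CNDC) consist of $s$ T $l$-edges carrying $n_{\textit{CNDC}}$ vertices. Then $$\dim S_{d}(\mathscr{T}) \ge L_K(\mathscr{T}),\qquad L_K(\mathscr{T}) := (d+1)^2 + (c-t)(d+1) + n_v + \big(s(d+1) - n_{\textit{CNDC}}\big)_+ ,$$ where $(\cdot)_+=\max(\cdot,0)$.
   Context: Let $d\ge 1$ be an integer. A T-mesh $\mathscr T$ is a partition of a simply connected planar domain $\Phi$ into finitely many axis-aligned rectangles (cells), with T-junctions allowed. Vertices are the grid points of the mesh; a T-junction is an interior vertex of valence 3. An edge is a segment joining two adjacent vertices along a horizontal or vertical grid line; edges are boundary or interior. An $l$-edge is a maximal straight segment composed of collinear contiguous edges whose endpoints are T-junctions or boundary vertices. An interior $l$-edge is a cross-cut if both endpoints lie on the domain boundary, a T $l$-edge if both endpoints are T-junctions, and a ray otherwise. The T-connected component $T(\mathscr T)$ is the set of all T $l$-edges (with the vertices on them). For a T $l$-edge $l$, $n(l)$ is the number of vertices on $l$, endpoints included. $S_d(\mathscr T)$ is the space of functions $s$ on $\Phi$ that are $d-1$ times continuously differentiable in $x$ and $d-1$ times continuously differentiable in $y$ (class $C^{d-1,d-1}(\Phi)$) and whose restriction to every cell is a polynomial of bi-degree at most $(d,d)$. Standing assumptions: $T(\mathscr T)$ is connected (assumed without loss of generality), and no T $l$-edge is vanishable, i.e. $n(l)\ge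 d+2$ for every T $l$-edge $l$. CNDC. A sub-component of $T(\mathscr T)$ is a set of T $l$-edges with the vertices on them. A reasonable order is an ordering $l_1\succ l_2\succ\cdots$ such that for each $i$ the number of vertices remaining on $l_i$ after deleting its intersections with the preceding edges $l_j$, $j<i$, is at least $d+1$. $\mathscr T$ is diagonalizable if $T(\mathscr T)$ has a reasonable order. Let $\mathscr T$ be non-diagonalizable. A partition $\{T_1,T_2\}$ of the T $l$-edges, with $T_2=T(\mathscr T)\setminus T_1$ (vertices lying on edges of $T_1$ are deleted from the edges of $T_2$), is regular if $T_1$ has no reasonable order and $T_2$ has one ($T_2$ may be empty). A regular partition is complete if there is no other regular partition $\{T_1',T_2'\}$ with $T_1'$ a proper subset of $T_1$. The complete partition is unique; $T_1=\{l_1,\dots,l_s\}$ is called the CNDC. $n_{\textit{CNDC}}$ is the number of vertices lying on edges of $T_1$. *)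

theory Defs
  imports "HOL-Analysis.Analysis" "HOL-Library.Function_Algebras"
begin

type_synonym mesh = "(real \<times> real) set set"

text \<open>A mesh is given by its set of closed cells; the domain it partitions is their union.
  A domain is non-empty and has connected interior, so two parts of it may not be joined only
  at a corner point.\<close>

definition mesh_domain :: "mesh \<Rightarrow> (real \<times> real) set" where
  "mesh_domain M = \<Union>M"

definition t_mesh :: "mesh \<Rightarrow> bool" where
  "t_mesh M \<longleftrightarrow>
     M division_of mesh_domain M \<and> (\<forall>K\<in>M. interior K \<noteq> {}) \<and>
     mesh_domain M \<noteq> {} \<and> simply_connected (mesh_domain M) \<and>
     connected (interior (mesh_domain M))"

definition vertices :: "mesh \<Rightarrow> (real \<times> real) set" where
  "vertices M = {v. \<exists>a b. cbox a b \<in> M \<and> fst v \<in> {fst a, fst b} \<and> snd v \<in> {snd a, snd b}}"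

definition interior_vertices :: "mesh \<Rightarrow> (real \<times> real) set" where
  "interior_vertices M = vertices M \<inter> interior (mesh_domain M)"

definition boundary_vertices :: "mesh \<Rightarrow> (real \<times> real) set" where
  "boundary_vertices M = vertices M \<inter> frontier (mesh_domain M)"

definition axis_aligned :: "real \<times> real \<Rightarrow> real \<times> real \<Rightarrow> bool" where
  "axis_aligned a b \<longleftrightarrow> fst a = fst b \<or> snd a = snd b"

definition edges :: "mesh \<Rightarrow> (real \<times> real) set set" where
  "edges M = {closed_segment v w | v w.
     v \<noteq> w \<and> axis_aligned v w \<and> closed_segment v w \<subseteq> (\<Union>K\<in>M. frontier K) \<and>
     vertices M \<inter> closed_segment v w = {v, w}}"

definition interior_edges :: "mesh \<Rightarrow> (real \<times> real) set set" where
  "interior_edges M = {e \<in> edges M. \<not> e \<subseteq> frontier (mesh_domain M)}"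

definition valence :: "mesh \<Rightarrow> real \<times> real \<Rightarrow> nat" where
  "valence M v = card {e \<in> edges M. v \<in> e}"

definition T_junctions :: "mesh \<Rightarrow> (real \<times> real) set" where
  "T_junctions M = {v \<in> interior_vertices M. valence M v = 3}"

text \<open>\<open>has_endpoints l S\<close>: \<open>l\<close> is a non-degenerate axis-aligned segment and both its endpoints lie
  in \<open>S\<close>.\<close>

definition has_endpoints :: "(real \<times> real) set \<Rightarrow> (real \<times> real) set \<Rightarrow> bool" where
  "has_endpoints l S \<longleftrightarrow>
     (\<exists>a b. a \<noteq> b \<and> axis_aligned a b \<and> l = closed_segment a b \<and> a \<in> S \<and> b \<in> S)"

definition edge_segments :: "mesh \<Rightarrow> (real \<times> real) set set" where
  "edge_segments M = {l. has_endpoints l (T_junctions M \<union> boundary_vertices M) \<and>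
     (\<exists>E \<subseteq> interior_edges M. l = \<Union>E)}"

definition interior_l_edges :: "mesh \<Rightarrow> (real \<times> real) set set" where
  "interior_l_edges M = {l \<in> edge_segments M. \<forall>l'\<in>edge_segments M. l \<subseteq> l' \<longrightarrow> l' = l}"

definition cross_cuts :: "mesh \<Rightarrow> (real \<times> real) set set" where
  "cross_cuts M = {l \<in> interior_l_edges M. has_endpoints l (boundary_vertices M)}"

definition T_l_edges :: "mesh \<Rightarrow> (real \<times> real) set set" where
  "T_l_edges M = {l \<in> interior_l_edges M. has_endpoints l (T_junctions M)}"

definition vertices_on :: "mesh \<Rightarrow> (real \<times> real) set \<Rightarrow> (real \<times> real) set" where
  "vertices_on M l = vertices M \<inter> l"

text \<open>The argument \<open>X\<close> is a set of vertices deleted beforehand: it is empty for a sub-component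
  taken with all its vertices, and consists of the vertices on \<open>T\<^sub>1\<close> for the second part of a
  partition.\<close>

definition reasonable_order ::
  "nat \<Rightarrow> mesh \<Rightarrow> (real \<times> real) set \<Rightarrow> (real \<times> real) set list \<Rightarrow> bool" where
  "reasonable_order d M X ls \<longleftrightarrow> distinct ls \<and>
     (\<forall>i < length ls. card (vertices_on M (ls ! i) - X - (\<Union>j<i. ls ! j)) \<ge> d + 1)"

definition has_reasonable_order ::
  "nat \<Rightarrow> mesh \<Rightarrow> (real \<times> real) set \<Rightarrow> (real \<times> real) set set \<Rightarrow> bool" where
  "has_reasonable_order d M X T \<longleftrightarrow> (\<exists>ls. set ls = T \<and> reasonable_order d M X ls)"

definition diagonalizable :: "nat \<Rightarrow> mesh \<Rightarrow> bool" where
  "diagonalizable d M \<longleftrightarrow> has_reasonable_order d M {} (T_l_edges M)"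

text \<open>A partition is represented by its first part \<open>T\<^sub>1\<close>.\<close>

definition regular_partition :: "nat \<Rightarrow> mesh \<Rightarrow> (real \<times> real) set set \<Rightarrow> bool" where
  "regular_partition d M T1 \<longleftrightarrow> T1 \<subseteq> T_l_edges M \<and>
     \<not> has_reasonable_order d M {} T1 \<and>
     has_reasonable_order d M (vertices_on M (\<Union>T1)) (T_l_edges M - T1)"

definition complete_partition :: "nat \<Rightarrow> mesh \<Rightarrow> (real \<times> real) set set \<Rightarrow> bool" where
  "complete_partition d M T1 \<longleftrightarrow> regular_partition d M T1 \<and>
     \<not> (\<exists>T1'. regular_partition d M T1' \<and> T1' \<subset> T1)"

text \<open>Regular partitions are only considered for non-diagonalizable meshes; the completely
  non-diagonalizable component (CNDC) of a
  diagonalizable mesh is empty by convention.\<close>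

definition is_CNDC :: "nat \<Rightarrow> mesh \<Rightarrow> (real \<times> real) set set \<Rightarrow> bool" where
  "is_CNDC d M T1 \<longleftrightarrow>
     (if diagonalizable d M then T1 = {} else complete_partition d M T1)"

text \<open>\<open>m\<close>-fold continuous differentiability in one variable on a set \<open>S\<close>: the witnesses \<open>D i\<close> are the
  successive partial derivatives, taken within the slice of \<open>S\<close> through the point (so one-sided
  at the boundary) and continuous as functions of both variables.\<close>

definition C_diff_x :: "nat \<Rightarrow> (real \<times> real) set \<Rightarrow> (real \<times> real \<Rightarrow> real) \<Rightarrow> bool" where
  "C_diff_x m S f \<longleftrightarrow> (\<exists>D :: nat \<Rightarrow> real \<times> real \<Rightarrow> real. D 0 = f \<and>
     (\<forall>i\<le>m. continuous_on S (D i)) \<and>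
     (\<forall>i<m. \<forall>x y. (x, y) \<in> S \<longrightarrow>
        ((\<lambda>u. D i (u, y)) has_real_derivative D (Suc i) (x, y)) (at x within {u. (u, y) \<in> S})))"

definition C_diff_y :: "nat \<Rightarrow> (real \<times> real) set \<Rightarrow> (real \<times> real \<Rightarrow> real) \<Rightarrow> bool" where
  "C_diff_y m S f \<longleftrightarrow> (\<exists>D :: nat \<Rightarrow> real \<times> real \<Rightarrow> real. D 0 = f \<and>
     (\<forall>i\<le>m. continuous_on S (D i)) \<and>
     (\<forall>i<m. \<forall>x y. (x, y) \<in> S \<longrightarrow>
        ((\<lambda>v. D i (x, v)) has_real_derivative D (Suc i) (x, y)) (at y within {v. (x, v) \<in> S})))"

definition bipoly_on :: "nat \<Rightarrow> (real \<times> real) set \<Rightarrow> (real \<times> real \<Rightarrow> real) \<Rightarrow> bool" where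
  "bipoly_on d K f \<longleftrightarrow> (\<exists>c :: nat \<Rightarrow> nat \<Rightarrow> real. \<forall>x y. (x, y) \<in> K \<longrightarrow>
     f (x, y) = (\<Sum>i\<le>d. \<Sum>j\<le>d. c i j * x ^ i * y ^ j))"

text \<open>Functions on the domain are represented by their extensions by zero.\<close>

definition spline_space :: "nat \<Rightarrow> mesh \<Rightarrow> (real \<times> real \<Rightarrow> real) set" where
  "spline_space d M = {f. (\<forall>z. z \<notin> mesh_domain M \<longrightarrow> f z = 0) \<and>
     C_diff_x (d - 1) (mesh_domain M) f \<and> C_diff_y (d - 1) (mesh_domain M) f \<and>
     (\<forall>K\<in>M. bipoly_on d K f)}"

definition fun_scale :: "real \<Rightarrow> ('a \<Rightarrow> real) \<Rightarrow> 'a \<Rightarrow> real" where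
  "fun_scale r f = (\<lambda>z. r * f z)"

lemma vector_space_fun_scale: "vector_space (fun_scale :: real \<Rightarrow> ('a \<Rightarrow> real) \<Rightarrow> 'a \<Rightarrow> real)"
  by unfold_locales (auto simp: fun_scale_def fun_eq_iff algebra_simps)

definition spline_dim :: "nat \<Rightarrow> mesh \<Rightarrow> nat" where
  "spline_dim d M = vector_space.dim fun_scale (spline_space d M)"

definition L_K :: "nat \<Rightarrow> mesh \<Rightarrow> (real \<times> real) set set \<Rightarrow> int" where
  "L_K d M T1 =
     (int d + 1)\<^sup>2
     + (int (card (cross_cuts M)) - int (card (T_l_edges M))) * (int d + 1)
     + int (card (interior_vertices M))
     + max 0 (int (card T1) * (int d + 1) - int (card (vertices_on M (\<Union>T1))))"

end

theory Submission
  imports Defs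
begin

text \<open>Let \<open>v\<close> be an interior vertex. On a rectangular domain the truncated power
  \<open>(x - v\<^sub>1)\<^sub>+\<^sup>d (y - v\<^sub>2)\<^sub>+\<^sup>d\<close> is a piecewise polynomial whose smoothness drops only
  along the rays going right and up from \<open>v\<close>. On a simply connected domain \<open>\<Omega>\<close> the truncation is
  replaced by a function \<open>\<kappa>\<close> on \<open>\<Omega>\<close> that is locally constant off the two rays, cut off
  where they first hit the boundary, and jumps by 1 across them. To get \<open>\<kappa>\<close>, continue the two
  rays to points \<open>w\<^sub>1, w\<^sub>2\<close> outside \<open>\<Omega>\<close>; a global logarithm of \<open>(z - w\<^sub>1) / (z - w\<^sub>2)\<close> on
  \<open>\<Omega>\<close> and the sum of principal logarithms along the path differ by \<open>2 \<pi> \<i> \<kappa>\<close>.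

  Together with the polynomials and the analogous functions with jump \<open>(y - l\<^sub>2)\<^sup>d x\<^sup>j\<close> across an
  \<open>l\<close>-edge that begins (at its left or lower end) on the boundary, these functions are linearly
  independent. A linear combination is a spline as soon as its jump vanishes beyond the right or
  upper end of every \<open>l\<close>-edge that ends at a T-junction, which is \<open>d + 1\<close> linear equations per such
  edge. The rays among the \<open>l\<close>-edges contribute equally to the number of functions and of equations or to
  neither, so the difference is \<open>(d + 1)\<^sup>2 + (c - t) (d + 1) + n\<^sub>v\<close>. For a set \<open>T\<^sub>1\<close> of T \<open>l\<close>-edges
  the \<open>card T\<^sub>1 * (d + 1)\<close> equations involve only the vertices on \<open>T\<^sub>1\<close>, hence may be replaced by
  the vanishing of the coefficients of these vertices; this gives the last term.\<close>

section \<open>Coordinates and segments\<close>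

text \<open>On a non-convex domain the ray from \<open>v\<close> can leave the domain and enter it
  again. A truncated power of the plane would be non-smooth on the re-entered part too, and no
  condition at the \<open>l\<close>-edge of \<open>v\<close> accounts for that; hence the cut has to
  stop at the boundary. The price is that \<kappa> is known only to be bounded at \<open>v\<close>
  and where the rays stop. This suffices, because the polynomial factor vanishes to order
  \<open>d\<close> on the lines of the rays: partial derivatives of order below \<open>d\<close> are
  squeezed to 0 wherever \<kappa> may be discontinuous. All equations concern jumps. The jump across
  a line is the \<open>d\<close>-th power of the coordinate difference to the line times a
  polynomial of degree at most \<open>d\<close> along it, which explains the number
  \<open>d + 1\<close>. A T \<open>l\<close>-edge begins at an interior vertex, so no edge function
  begins on it, and its jump is built from its vertices alone. As equations may depend on each
  other, each system of equations gives only a lower bound, and the positive part selects the better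
  one.\<close>

text \<open>A Boolean \<open>h\<close> selects a direction, \<open>True\<close> being horizontal: \<open>crd h\<close> is the coordinate
  along it and \<open>crd (\<not> h)\<close> the one across it, so every argument is given once for both directions.\<close>

definition crd :: "bool \<Rightarrow> real \<times> real \<Rightarrow> real" where
  "crd h z = (if h then fst z else snd z)"

definition pt :: "bool \<Rightarrow> real \<Rightarrow> real \<Rightarrow> real \<times> real" where
  "pt h t s = (if h then (t, s) else (s, t))"

lemma crd_pt [simp]: "crd h (pt h t s) = t" "crd (\<not> h) (pt h t s) = s"
  "crd h (pt (\<not> h) t s) = s"
  by (auto simp: crd_def pt_def)

lemma pt_crd [simp]: "pt h (crd h z) (crd (\<not> h) z) = z"
  by (auto simp: crd_def pt_def)

lemma crd_simps [simp]: "crd True z = fst z" "crd False z = snd z"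
  by (auto simp: crd_def)

lemma pt_inject [simp]: "pt h t s = pt h t' s' \<longleftrightarrow> t = t' \<and> s = s'"
  by (auto simp: pt_def)

lemma point_eq_iff: "z = w \<longleftrightarrow> crd h z = crd h w \<and> crd (\<not> h) z = crd (\<not> h) w"
  by (cases h) (auto simp: prod_eq_iff)

lemma all_bool_iff: "(\<forall>k. P k) \<longleftrightarrow> P h \<and> P (\<not> h)"
  by (cases h) (auto simp: all_bool_eq)

lemma pt_eq_iff: "z = pt h t s \<longleftrightarrow> crd h z = t \<and> crd (\<not> h) z = s"
  by (metis crd_pt(1,2) pt_crd)

lemma abs_crd_le_dist: "\<bar>crd h z - crd h w\<bar> \<le> dist z w"
  using dist_fst_le[of z w] dist_snd_le[of z w] by (auto simp: crd_def dist_real_def)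

lemma dist_le_crd: "dist z w \<le> \<bar>crd h z - crd h w\<bar> + \<bar>crd (\<not> h) z - crd (\<not> h) w\<bar>"
proof -
  have "dist z w \<le> dist (fst z) (fst w) + dist (snd z) (snd w)"
    by (cases z; cases w) (simp add: dist_Pair_Pair real_le_lsqrt sqrt_sum_squares_le_sum)
  then show ?thesis by (cases h) (auto simp: dist_real_def)
qed

lemma dist_pt: "dist (pt h t s) (pt h t' s) = \<bar>t - t'\<bar>"
  by (auto simp: pt_def dist_Pair_Pair dist_real_def)

lemma continuous_on_crd [continuous_intros]:
  "continuous_on S f \<Longrightarrow> continuous_on S (\<lambda>z. crd h (f z))"
  by (cases h) (auto intro: continuous_intros)

lemma continuous_on_pt [continuous_intros]:
  "continuous_on S f \<Longrightarrow> continuous_on S g \<Longrightarrow> continuous_on S (\<lambda>z. pt h (f z) (g z))"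
  by (cases h) (auto simp: pt_def intro: continuous_intros)

definition seg :: "bool \<Rightarrow> real \<Rightarrow> real \<Rightarrow> real \<Rightarrow> (real \<times> real) set" where
  "seg h s a b = {z. crd (\<not> h) z = s \<and> a \<le> crd h z \<and> crd h z \<le> b}"

lemma closed_segment_pt: "a \<le> b \<Longrightarrow> closed_segment (pt h a s) (pt h b s) = seg h s a b"
proof (rule set_eqI)
  fix z assume "a \<le> b"
  have "z \<in> closed_segment (pt h a s) (pt h b s) \<longleftrightarrow>
      (\<exists>u. 0 \<le> u \<and> u \<le> 1 \<and> crd h z = (1 - u) * a + u * b \<and> crd (\<not> h) z = s)"
    unfolding closed_segment_def
    by (cases h) (auto simp: prod_eq_iff pt_def algebra_simps)
  also have "\<dots> \<longleftrightarrow> crd (\<not> h) z = s \<and> crd h z \<in> closed_segment a b"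
    by (auto simp: closed_segment_def)
  finally show "z \<in> closed_segment (pt h a s) (pt h b s) \<longleftrightarrow> z \<in> seg h s a b"
    using \<open>a \<le> b\<close> by (auto simp: seg_def closed_segment_eq_real_ivl)
qed

lemma compact_seg: "compact (seg h s a b)"
proof (cases "a \<le> b")
  case True
  then show ?thesis using compact_segment[of "pt h a s" "pt h b s"] by (simp add: closed_segment_pt)
next
  case False
  then have "seg h s a b = {}" by (auto simp: seg_def)
  then show ?thesis by simp
qed

section \<open>Cutting a simply connected set along a path\<close>

definition to_complex :: "real \<times> real \<Rightarrow> complex" where
  "to_complex z = Complex (fst z) (snd z)"

lemma to_complex_simps [simp]: "Re (to_complex z) = fst z" "Im (to_complex z) = snd z"
  by (auto simp: to_complex_def)

lemma to_complex_eq_iff [simp]: "to_complex z = to_complex w \<longleftrightarrow> z = w"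
  by (auto simp: complex_eq_iff prod_eq_iff)

lemma continuous_on_to_complex [continuous_intros]:
  "continuous_on S f \<Longrightarrow> continuous_on S (\<lambda>z. to_complex (f z))"
  unfolding to_complex_def Complex_eq by (intro continuous_intros)

text \<open>The Moebius map sending \<open>a\<close> to 0 and \<open>b\<close> to infinity. It takes
  non-positive real values on the segment from \<open>a\<close> to \<open>b\<close> only, so the
  principal logarithm of it is cut along that segment.\<close>

definition mratio :: "real \<times> real \<Rightarrow> real \<times> real \<Rightarrow> real \<times> real \<Rightarrow> complex" where
  "mratio a b z = (to_complex z - to_complex a) / (to_complex z - to_complex b)"

lemma mratio_notin_nonpos_Reals:
  assumes "z \<notin> closed_segment a b"
  shows "mratio a b z \<notin> \<real>\<^sub>\<le>\<^sub>0"
proof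
  assume "mratio a b z \<in> \<real>\<^sub>\<le>\<^sub>0"
  then obtain k where k: "k \<le> 0" "mratio a b z = of_real k"
    by (auto elim!: nonpos_Reals_cases)
  have "z \<noteq> b" using assms by auto
  then have "to_complex z - to_complex a = of_real k * (to_complex z - to_complex b)"
    using k by (simp add: mratio_def field_simps)
  then have eq: "fst z - fst a = k * (fst z - fst b)" "snd z - snd a = k * (snd z - snd b)"
    by (auto simp: complex_eq_iff)
  \<comment> \<open>Solving \<open>z - a = k (z - b)\<close> for \<open>z\<close> gives a convex
    combination of \<open>a\<close> and \<open>b\<close> with this weight at
    \<open>b\<close>.\<close>
  define u where "u = - k / (1 - k)"
  have u: "0 \<le> u" "u \<le> 1" using k by (auto simp: u_def field_simps)
  have "z = (1 - u) *\<^sub>R a + u *\<^sub>R b"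
  proof -
    have k1: "1 - k \<noteq> 0" "1 - u = 1 / (1 - k)" using k by (auto simp: u_def field_simps)
    have "fst z = (fst a - k * fst b) / (1 - k)" "snd z = (snd a - k * snd b) / (1 - k)"
      using eq k1(1) by (simp_all add: field_simps)
    then show ?thesis
      unfolding prod_eq_iff using k1 by (simp add: u_def diff_divide_distrib)
  qed
  with u assms show False by (auto simp: closed_segment_def)
qed

lemma continuous_Ln_mratio:
  assumes "z \<notin> closed_segment a b"
  shows "isCont (\<lambda>z. Ln (mratio a b z)) z"
proof -
  have "open (- closed_segment a b)" by (simp add: open_Compl)
  moreover have "continuous_on (- closed_segment a b) (\<lambda>z. Ln (mratio a b z))"
  proof (intro continuous_intros ballI)
    show "continuous_on (- closed_segment a b) (mratio a b)"
      unfolding mratio_def[abs_def] by (intro continuous_intros) auto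
  qed (use mratio_notin_nonpos_Reals in auto)
  ultimately show ?thesis using assms
    by (simp add: continuous_on_eq_continuous_at)
qed

text \<open>On one side of a segment the branch \<open>Ln (mratio a b z)\<close> tends to imaginary part \<open>pi\<close>, on
  the other to \<open>- pi\<close>; half a turn in between gives \<open>Ln (- mratio a b z)\<close>, continuous across.\<close>

lemma Im_Ln_mratio:
  assumes "mratio a b z \<noteq> 0"
  shows "Im (mratio a b z) > 0 \<Longrightarrow> Im (Ln (mratio a b z)) = Im (Ln (- mratio a b z)) + pi"
    and "Im (mratio a b z) < 0 \<Longrightarrow> Im (Ln (mratio a b z)) = Im (Ln (- mratio a b z)) - pi"
  using Ln_minus[OF assms] by auto

text \<open>The numerator is twice the signed area of the triangle with corners \<open>a\<close>,
  \<open>b\<close>, \<open>z\<close>; its sign tells on which side of the line \<open>z\<close>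
  lies.\<close>

lemma Im_mratio:
  "Im (mratio a b z) =
     ((snd z - snd a) * (fst z - fst b) - (fst z - fst a) * (snd z - snd b)) / (dist z b)\<^sup>2"
  by (simp add: mratio_def Im_divide dist_prod_def dist_real_def power2_eq_square)

text \<open>The constant is the integer nearest to \<open>f z\<close>. The predicate
  \<open>P\<close> leaves out points without integral value, possibly \<open>z\<close>
  itself.\<close>

lemma locally_constant_of_Ints:
  fixes f :: "'a::metric_space \<Rightarrow> real"
  assumes "continuous (at z within S) f" "\<And>w. w \<in> S \<Longrightarrow> P w \<Longrightarrow> f w \<in> \<int>"
  shows "\<exists>r>0. \<exists>c. \<forall>w\<in>S \<inter> ball z r. P w \<longrightarrow> f w = c"
proof -
  have "\<exists>r>0. \<forall>w\<in>S. dist w z < r \<longrightarrow> dist (f w) (f z) < 1/2"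
    using assms(1)[unfolded continuous_within_eps_delta, THEN spec, of "1/2"] by (rule mp) simp
  then obtain r where r0: "r > 0" and r1: "\<forall>w\<in>S. dist w z < r \<longrightarrow> dist (f w) (f z) < 1/2"
    by blast
  note r = r0 r1[rule_format]
  have "f w = of_int (round (f z))" if "w \<in> S \<inter> ball z r" "P w" for w
  proof -
    have "f w \<in> \<int>" using assms(2) that by blast
    then obtain n where n: "f w = of_int n" by (rule Ints_cases)
    have "\<bar>f z - of_int n\<bar> < 1/2" using r(2)[of w] that n
      by (simp add: dist_real_def dist_commute[of w z] abs_minus_commute[of "f z"])
    then show ?thesis using n round_unique'[of "f z" n] by simp
  qed
  then show ?thesis using r by blast
qed

definition leg :: "bool \<Rightarrow> real \<times> real \<Rightarrow> real \<Rightarrow> (real \<times> real) set" where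
  "leg h p e = seg h (crd (\<not> h) p) (crd h p) e"

text \<open>The ratios along the path \<open>w True\<close>, \<open>q True\<close>,
  \<open>p\<close>, \<open>q False\<close>, \<open>w False\<close> multiply to \<open>F\<close>,
  which has no zero on \<open>S\<close> and hence a continuous logarithm \<open>g\<close>. The outer
  segments touch \<open>S\<close> at most in their inner ends, so within \<open>S\<close> only the
  legs act as branch cuts. For the ends of the legs nothing but boundedness is claimed.\<close>

lemma cut_function:
  fixes p :: "real \<times> real" and e :: "bool \<Rightarrow> real" and S :: "(real \<times> real) set"
  assumes S: "compact S" "simply_connected S" "locally path_connected S"
    and le: "\<And>h. crd h p \<le> e h"
    and w: "\<And>h. w h \<notin> S" "\<And>h. closed_segment (pt h (e h) (crd (\<not> h) p)) (w h) \<inter> S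
               \<subseteq> {pt h (e h) (crd (\<not> h) p)}"
  obtains \<kappa> :: "real \<times> real \<Rightarrow> real"
  where "\<exists>B. \<forall>z\<in>S. \<bar>\<kappa> z\<bar> \<le> B"
    and "\<And>z. z \<in> S \<Longrightarrow> (\<And>h. z \<notin> leg h p (e h)) \<Longrightarrow> \<exists>r>0. \<exists>c. \<forall>z'\<in>S \<inter> ball z r. \<kappa> z' = c"
    and "\<And>h z. z \<in> S \<Longrightarrow> crd (\<not> h) z = crd (\<not> h) p \<Longrightarrow> crd h p < crd h z \<Longrightarrow> crd h z < e h \<Longrightarrow>
           \<exists>r>0. \<exists>c. \<forall>z'\<in>S \<inter> ball z r.
             (crd (\<not> h) z' > crd (\<not> h) z \<longrightarrow> \<kappa> z' = c + 1) \<and> (crd (\<not> h) z' < crd (\<not> h) z \<longrightarrow> \<kappa> z' = c)"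
proof -
  define q where "q h = pt h (e h) (crd (\<not> h) p)" for h
  have crd_q: "crd h (q h) = e h" "crd (\<not> h) (q h) = crd (\<not> h) p" for h
    by (auto simp: q_def)
  have leg_eq: "leg h p (e h) = closed_segment p (q h)" for h
    using closed_segment_pt[OF le[of h], of h "crd (\<not> h) p"] by (simp add: leg_def q_def)
  have qw: "z \<notin> closed_segment (q h) (w h)" if "z \<in> S" "z \<noteq> q h" for z h
    using w(2)[of h] that by (auto simp: q_def)
  define F where "F = mratio (w True) (w False)"
  have "continuous_on S F"
    unfolding F_def mratio_def[abs_def] using w(1) by (intro continuous_intros) auto
  moreover have "F z \<noteq> 0" if "z \<in> S" for z
    using that w(1) by (auto simp: F_def mratio_def)
  ultimately obtain g where g: "continuous_on S g" "\<And>z. z \<in> S \<Longrightarrow> F z = exp (g z)"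
    using continuous_logarithm_on_simply_connected[OF _ S(2,3)] by metis
  \<comment> \<open>The path runs along the horizontal leg towards \<open>p\<close> and along the
    vertical leg away from it. With these orientations both jumps have the sign of the indicator
    function of the upper right quadrant at \<open>p\<close>.\<close>
  define mid where "mid h = (if h then mratio (q True) p else mratio p (q False))" for h
  define out where "out h = (if h then mratio (w True) (q True) else mratio (q False) (w False))" for h
  define b where "b z = Ln (out True z) + Ln (mid True z) + (Ln (out False z) + Ln (mid False z))" for z
  define \<kappa> where "\<kappa> z = (Im (b z) - Im (g z)) / (2 * pi)" for z
  have out_nz: "out h z \<noteq> 0" if "z \<in> S" "z \<noteq> q h" for h z
    using w(1)[of h] that by (auto simp: out_def mratio_def)
  have mid_nz: "mid h z \<noteq> 0" if "z \<noteq> p" "z \<noteq> q h" for h z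
    using that by (auto simp: mid_def mratio_def)
  \<comment> \<open>The product telescopes to \<open>F\<close>. At the corners a ratio is 0 and
    \<open>exp\<close> does not undo its \<open>Ln\<close>, so they are excluded.\<close>
  have b_exp: "exp (b z) = F z" if "z \<in> S" "z \<noteq> p" "z \<noteq> q True" "z \<noteq> q False" for z
  proof -
    have "exp (b z) = out True z * mid True z * (out False z * mid False z)"
      unfolding b_def exp_add using out_nz mid_nz that by simp
    also have "\<dots> = F z"
      using that w(1) by (auto simp: out_def mid_def F_def mratio_def)
    finally show ?thesis .
  qed
  have Ints: "\<kappa> z \<in> \<int>" if "z \<in> S" "z \<noteq> p" "z \<noteq> q True" "z \<noteq> q False" for z
  proof -
    have "exp (b z) = exp (g z)" using b_exp g that by simp
    then obtain n :: int where "b z = g z + (of_int (2 * n) * pi) * \<i>"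
      unfolding exp_eq by auto
    then have "\<kappa> z = of_int n" by (simp add: \<kappa>_def)
    then show ?thesis by simp
  qed
  have g_cont: "continuous (at z within S) (\<lambda>z. Im (g z))" if "z \<in> S" for z
    using g(1) that by (auto simp: continuous_on_eq_continuous_within intro: continuous_Im)
  have Im_cont: "continuous (at z within S) (\<lambda>z. Im (f z))" if "isCont f z" for f z
    using continuous_at_imp_continuous_within[OF that] by (rule continuous_Im)
  have out_cont: "continuous (at z within S) (\<lambda>z. Im (Ln (out h z)))" if "z \<in> S" "z \<noteq> q h" for z h
  proof (rule Im_cont, cases h)
    case True
    then show "isCont (\<lambda>z. Ln (out h z)) z"
      using continuous_Ln_mratio[of z "w h" "q h"] qw[OF that] by (simp add: out_def closed_segment_commute)
  next
    case False
    then show "isCont (\<lambda>z. Ln (out h z)) z"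
      using continuous_Ln_mratio[of z "q h" "w h"] qw[OF that] by (simp add: out_def)
  qed
  have mid_cont: "continuous (at z within S) (\<lambda>z. Im (Ln (mid h z)))" if "z \<notin> closed_segment p (q h)" for z h
  proof (rule Im_cont, cases h)
    case True
    then show "isCont (\<lambda>z. Ln (mid h z)) z"
      using continuous_Ln_mratio[of z "q h" p] that by (simp add: mid_def closed_segment_commute)
  next
    case False
    then show "isCont (\<lambda>z. Ln (mid h z)) z"
      using continuous_Ln_mratio[of z p "q h"] that by (simp add: mid_def)
  qed
  have Im_b: "Im (b z) = Im (Ln (out True z)) + Im (Ln (mid True z)) + (Im (Ln (out False z)) + Im (Ln (mid False z)))" for z
    by (simp add: b_def)
  show thesis
  proof
    show "\<exists>B. \<forall>z\<in>S. \<bar>\<kappa> z\<bar> \<le> B"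
    proof -
      have "bounded (g ` S)" using compact_continuous_image[OF g(1) S(1)] compact_imp_bounded by blast
      then obtain B where B: "\<And>z. z \<in> S \<Longrightarrow> norm (g z) \<le> B" by (auto simp: bounded_iff)
      \<comment> \<open>\<open>Ln 0\<close> occurs at the corners; adding its value makes one bound
        serve everywhere.\<close>
      define C where "C = pi + \<bar>Im (Ln 0)\<bar>"
      have Lnb: "\<bar>Im (Ln u)\<bar> \<le> C" for u
        using Im_Ln_le_pi[of u] mpi_less_Im_Ln[of u] by (cases "u = 0") (auto simp: C_def)
      have "\<bar>\<kappa> z\<bar> \<le> (4 * C + B) / (2 * pi)" if "z \<in> S" for z
      proof -
        have "\<bar>Im (g z)\<bar> \<le> B" using B[OF that] abs_Im_le_cmod[of "g z"] by linarith
        then have "\<bar>Im (b z) - Im (g z)\<bar> \<le> 4 * C + B"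
          unfolding Im_b using Lnb[of "out True z"] Lnb[of "out False z"] Lnb[of "mid True z"] Lnb[of "mid False z"]
          by linarith
        then show ?thesis by (simp add: \<kappa>_def divide_right_mono)
      qed
      then show ?thesis by blast
    qed
  next
    fix z assume z: "z \<in> S" "\<And>h. z \<notin> leg h p (e h)"
    then have zn: "z \<notin> closed_segment p (q h)" "z \<noteq> q h" "z \<noteq> p" for h
      using ends_in_segment(1)[of p "q h"] ends_in_segment(2)[of "q h" p] leg_eq[of h] z(2)[of h] by auto
    have "continuous (at z within S) \<kappa>"
      unfolding \<kappa>_def Im_b
      by (intro continuous_add continuous_diff continuous_divide continuous_const g_cont
          out_cont mid_cont zn z(1)) auto
    moreover have "\<kappa> w \<in> \<int>" if "w \<in> S" "w \<in> - {p, q True, q False}" for w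
      using that by (intro Ints) auto
    ultimately obtain r c where r: "r > 0" "\<And>w. w \<in> S \<Longrightarrow> w \<in> ball z r \<Longrightarrow> w \<in> - {p, q True, q False} \<Longrightarrow> \<kappa> w = c"
      using locally_constant_of_Ints[of z S \<kappa> "\<lambda>w. w \<in> - {p, q True, q False}"] by blast
    have "open (- {p, q True, q False})" by (simp add: open_Compl finite_imp_closed)
    then obtain r' where r': "r' > 0" "ball z r' \<subseteq> - {p, q True, q False}"
      using zn open_contains_ball[of "- {p, q True, q False}"] by (metis ComplI insertE singletonD)
    have "\<kappa> w = c" if "w \<in> S \<inter> ball z (min r r')" for w
      using that r'(2) by (intro r(2)) auto
    then show "\<exists>r>0. \<exists>c. \<forall>z'\<in>S \<inter> ball z r. \<kappa> z' = c"
      using r(1) r'(1) by (intro exI[of _ "min r r'"] conjI exI[of _ c] ballI) simp_all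
  next
    fix h z assume zS: "z \<in> S" and z: "crd (\<not> h) z = crd (\<not> h) p" "crd h p < crd h z" "crd h z < e h"
    have zp: "z \<noteq> p" "z \<noteq> q h" using z crd_q(1)[of h] by auto
    have zl: "z \<notin> closed_segment p (q (\<not> h))"
      unfolding leg_eq[of "\<not> h", symmetric] using z by (simp add: leg_def seg_def)
    then have zq: "z \<noteq> q (\<not> h)" by auto
    \<comment> \<open>Strictly inside the leg the ratio is a negative real, so its negative stays
      away from the branch cut of \<open>Ln\<close>.\<close>
    have opp: "continuous (at z within S) (\<lambda>z. Im (Ln (- mid h z)))"
    proof (rule Im_cont)
      have "- mid h z \<notin> \<real>\<^sub>\<le>\<^sub>0"
      proof
        assume "- mid h z \<in> \<real>\<^sub>\<le>\<^sub>0"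
        then have "Re (mid h z) \<ge> 0" by (auto simp: complex_nonpos_Reals_iff)
        moreover have "Re (mid h z) < 0"
        proof -
          have "Re (mid h z) = (crd h z - crd h p) * (crd h z - e h) / (crd h z - (if h then crd h p else e h))\<^sup>2"
            using z crd_q[of h] by (cases h) (auto simp: mid_def mratio_def Re_divide power2_eq_square)
          moreover have "(crd h z - (if h then crd h p else e h))\<^sup>2 > 0"
            using z by auto
          ultimately show ?thesis using z by (simp add: divide_neg_pos mult_pos_neg)
        qed
        ultimately show False by simp
      qed
      moreover have "isCont (\<lambda>z. - mid h z) z"
      proof -
        have "continuous_on (- {p, q h}) (\<lambda>z. - mid h z)"
          unfolding mid_def mratio_def[abs_def] by (cases h) (auto intro!: continuous_intros)
        moreover have "open (- {p, q h})" by (simp add: open_Compl finite_imp_closed)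
        ultimately show ?thesis using zp by (simp add: continuous_on_eq_continuous_at)
      qed
      ultimately show "isCont (\<lambda>z. Ln (- mid h z)) z" by (rule isCont_Ln'[rotated])
    qed
    \<comment> \<open>\<open>N\<close> is \<kappa> with \<open>Ln (mid h z)\<close> replaced by a
      branch that is continuous across the leg. The branches differ by \<open>pi\<close>, which is
      1/2 in \<kappa>; after the shift by 1/2, \<open>N\<close> equals \<kappa> above the leg and
      \<kappa> + 1 below it.\<close>
    define N where "N z = (Im (Ln (out h z)) + Im (Ln (- mid h z)) + (Im (Ln (out (\<not> h) z)) + Im (Ln (mid (\<not> h) z)))
        - Im (g z)) / (2 * pi) + 1 / 2" for z
    have N_cont: "continuous (at z within S) N"
      unfolding N_def
      by (intro continuous_add continuous_diff continuous_divide continuous_const g_cont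
          out_cont mid_cont opp zp zq zS zl) auto
    have Im_b': "Im (b z) = Im (Ln (out h z)) + Im (Ln (mid h z)) + (Im (Ln (out (\<not> h) z)) + Im (Ln (mid (\<not> h) z)))" for z
      by (cases h) (auto simp: Im_b)
    have Im_mid: "Im (mid h w) = (crd (\<not> h) w - crd (\<not> h) p) * (e h - crd h p) / (dist w (if h then p else q h))\<^sup>2" for w
      using crd_q[of h] by (cases h) (auto simp: mid_def Im_mratio algebra_simps diff_divide_distrib[symmetric] add_divide_distrib[symmetric])
    have above: "\<kappa> w = N w" if "w \<in> S" "w \<notin> {p, q h}" "crd (\<not> h) w > crd (\<not> h) z" for w
    proof -
      have "Im (mid h w) > 0" unfolding Im_mid using that z by (auto intro!: divide_pos_pos)
      then have "Im (Ln (mid h w)) = Im (Ln (- mid h w)) + pi"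
        using Im_Ln_mratio(1)[of _ _ w] mid_nz[of w h] that by (cases h) (auto simp: mid_def)
      then show ?thesis unfolding \<kappa>_def N_def Im_b' by (simp add: field_simps)
    qed
    have below: "\<kappa> w = N w - 1" if "w \<in> S" "w \<notin> {p, q h}" "crd (\<not> h) w < crd (\<not> h) z" for w
    proof -
      have "Im (mid h w) < 0" unfolding Im_mid using that z by (auto intro!: divide_neg_pos mult_neg_pos)
      then have "Im (Ln (mid h w)) = Im (Ln (- mid h w)) - pi"
        using Im_Ln_mratio(2)[of _ _ w] mid_nz[of w h] that by (cases h) (auto simp: mid_def)
      then show ?thesis unfolding \<kappa>_def N_def Im_b' by (simp add: field_simps)
    qed
    \<comment> \<open>The line of the leg is left out as well, since neither \<open>above\<close>
      nor \<open>below\<close> relates \<open>N\<close> to \<kappa> on it.\<close>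
    let ?P = "\<lambda>w. w \<in> - {p, q h, q (\<not> h)} \<and> crd (\<not> h) w \<noteq> crd (\<not> h) z"
    have "N w \<in> \<int>" if "w \<in> S" "?P w" for w
    proof -
      have "\<kappa> w \<in> \<int>" using that by (intro Ints; cases h) auto
      moreover have "N w = \<kappa> w \<or> N w = \<kappa> w + 1"
        using above[of w] below[of w] that by (cases "crd (\<not> h) w > crd (\<not> h) z") auto
      ultimately show ?thesis by auto
    qed
    from locally_constant_of_Ints[of z S N ?P, OF N_cont this]
    obtain r c where r: "r > 0" "\<And>w. w \<in> S \<Longrightarrow> w \<in> ball z r \<Longrightarrow> ?P w \<Longrightarrow> N w = c" by blast
    have "open (- {p, q h, q (\<not> h)})" by (simp add: open_Compl finite_imp_closed)
    then obtain r' where r': "r' > 0" "ball z r' \<subseteq> - {p, q h, q (\<not> h)}"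
      using zp zq open_contains_ball[of "- {p, q h, q (\<not> h)}"] by (metis ComplI insertE singletonD)
    \<comment> \<open>\<open>N\<close> is \<open>c\<close> near \<open>z\<close>, so the lower one
      of the two values of \<kappa> is \<open>c - 1\<close>.\<close>
    have "(crd (\<not> h) w > crd (\<not> h) z \<longrightarrow> \<kappa> w = (c - 1) + 1) \<and> (crd (\<not> h) w < crd (\<not> h) z \<longrightarrow> \<kappa> w = c - 1)"
      if "w \<in> S \<inter> ball z (min r r')" for w
    proof -
      have w: "w \<in> S" "w \<in> ball z r" "w \<notin> {p, q h, q (\<not> h)}" using that r'(2) by (auto simp del: Compl_iff)
      show ?thesis
      proof (intro conjI impI)
        assume gt: "crd (\<not> h) w > crd (\<not> h) z"
        with w have "N w = c" by (intro r(2)) auto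
        with above[of w] w gt show "\<kappa> w = (c - 1) + 1" by auto
      next
        assume lt: "crd (\<not> h) w < crd (\<not> h) z"
        with w have "N w = c" by (intro r(2)) auto
        with below[of w] w lt show "\<kappa> w = c - 1" by auto
      qed
    qed
    moreover have "min r r' > 0" using r(1) r'(1) by simp
    ultimately show "\<exists>r>0. \<exists>c. \<forall>z'\<in>S \<inter> ball z r.
             (crd (\<not> h) z' > crd (\<not> h) z \<longrightarrow> \<kappa> z' = c + 1) \<and> (crd (\<not> h) z' < crd (\<not> h) z \<longrightarrow> \<kappa> z' = c)"
      by blast
  qed
qed

section \<open>Dimension and linear conditions\<close>

text \<open>If some \<open>b0\<close> in \<open>B\<close> lies outside the kernel, a multiple of it
  moves any other vector of \<open>B\<close> into the kernel. Hence a basis of the kernel within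
  \<open>span B\<close> spans \<open>B\<close> once \<open>b0\<close> is added.\<close>

lemma (in vector_space) independent_in_kernel:
  assumes "finite B" "independent B"
    and add: "\<And>x y. \<phi> (x + y) = \<phi> x + \<phi> y" and scaled: "\<And>r x. \<phi> (scale r x) = r * \<phi> x"
  shows "\<exists>B'. finite B' \<and> independent B' \<and> B' \<subseteq> span B \<and> (\<forall>b\<in>B'. \<phi> b = 0) \<and> card B \<le> card B' + 1"
proof (cases "\<forall>b\<in>B. \<phi> b = 0")
  case True
  then show ?thesis using assms(1,2) span_base by (intro exI[of _ B]) auto
next
  case False
  then obtain b0 where b0: "b0 \<in> B" "\<phi> b0 \<noteq> 0" by auto
  obtain B' where B': "B' \<subseteq> span B \<inter> {x. \<phi> x = 0}" "independent B'" "span B \<inter> {x. \<phi> x = 0} \<subseteq> span B'"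
    using maximal_independent_subset[of "span B \<inter> {x. \<phi> x = 0}"] by blast
  have fin: "finite B'"
    using independent_span_bound[OF assms(1) B'(2)] B'(1) by blast
  have "b \<in> span (insert b0 B')" if "b \<in> B" for b
  proof -
    define r where "r = \<phi> b / \<phi> b0"
    have "b - scale r b0 \<in> span B" using that b0 by (intro span_diff span_scale span_base)
    moreover have "\<phi> (b - scale r b0) = 0"
    proof -
      have "\<phi> b = \<phi> (b - scale r b0 + scale r b0)" by simp
      also have "\<dots> = \<phi> (b - scale r b0) + r * \<phi> b0" unfolding add scaled ..
      finally show ?thesis using b0 by (simp add: r_def)
    qed
    ultimately have "b - scale r b0 \<in> span B'" using B'(3) by auto
    then have "b - scale r b0 \<in> span (insert b0 B')" using span_mono[of B' "insert b0 B'"] by auto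
    moreover have "scale r b0 \<in> span (insert b0 B')" by (intro span_scale span_base) auto
    ultimately have "b - scale r b0 + scale r b0 \<in> span (insert b0 B')" by (rule span_add)
    then show ?thesis by simp
  qed
  then have "card B \<le> card (insert b0 B')"
    using independent_span_bound[of "insert b0 B'" B] fin assms(2) by auto
  also have "\<dots> \<le> card B' + 1" using fin by (simp add: card_insert_if)
  finally show ?thesis using B' fin by (intro exI[of _ B']) auto
qed

lemma (in vector_space) independent_in_kernels:
  assumes "finite \<Lambda>" "finite B" "independent B"
    and add: "\<And>k x y. k \<in> \<Lambda> \<Longrightarrow> \<phi> k (x + y) = \<phi> k x + \<phi> k y"
    and scaled: "\<And>k r x. k \<in> \<Lambda> \<Longrightarrow> \<phi> k (scale r x) = r * \<phi> k x"
  shows "\<exists>B'. finite B' \<and> independent B' \<and> B' \<subseteq> span B \<and> (\<forall>b\<in>B'. \<forall>k\<in>\<Lambda>. \<phi> k b = 0) \<and>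
    card B \<le> card B' + card \<Lambda>"
  using assms(1) add scaled
proof (induction \<Lambda>)
  case empty
  then show ?case using assms span_base by (intro exI[of _ B]) auto
next
  case (insert k \<Lambda>)
  then obtain B1 where B1: "finite B1" "independent B1" "B1 \<subseteq> span B" "\<And>b k. b \<in> B1 \<Longrightarrow> k \<in> \<Lambda> \<Longrightarrow> \<phi> k b = 0"
      "card B \<le> card B1 + card \<Lambda>" by auto
  obtain B2 where B2: "finite B2" "independent B2" "B2 \<subseteq> span B1" "\<And>b. b \<in> B2 \<Longrightarrow> \<phi> k b = 0" "card B1 \<le> card B2 + 1"
    using independent_in_kernel[OF B1(1,2), of "\<phi> k"] insert.prems by auto
  have "B2 \<subseteq> span B" using B2(3) B1(3) span_mono[OF B1(3)] by (auto simp: span_span)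
  \<comment> \<open>The conditions treated earlier persist: they vanish on \<open>B1\<close>, hence
    on its span, which contains \<open>B2\<close>.\<close>
  moreover have "\<phi> j b = 0" if "b \<in> B2" "j \<in> \<Lambda>" for j b
  proof -
    have zero: "\<phi> j 0 = 0" using insert.prems(2)[of j 0 0] that by simp
    have "b \<in> span B1" using that B2 by auto
    then show ?thesis
      by (induction rule: span_induct_alt) (use zero insert.prems that B1(4) in auto)
  qed
  ultimately show ?case using B2 B1(5) insert.hyps by (intro exI[of _ B2]) auto
qed

lemma sum_fun_apply: "(\<Sum>i\<in>I. f i) z = (\<Sum>i\<in>I. f i z)"
  by (induction I rule: infinite_finite_induct) auto

text \<open>\<open>dim\<close> is the cardinality of a basis, which is 0 for an infinite one; the
  finite set \<open>W\<close> rules this out.\<close>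

lemma (in vector_space) card_le_dim:
  assumes "B \<subseteq> V" "independent B" "V \<subseteq> span W" "finite W"
  shows "card B \<le> dim V"
proof -
  obtain D where D: "B \<subseteq> D" "D \<subseteq> V" "independent D" "V \<subseteq> span D"
    using maximal_independent_subset_extend[OF assms(1,2)] by auto
  have "finite D" using independent_span_bound[OF assms(4) D(3)] D(2) assms(3) by auto
  then have "card B \<le> card D" using D by (intro card_mono)
  also have "card D = dim V" using basis_card_eq_dim D by blast
  finally show ?thesis .
qed

text \<open>A rank argument on coefficient vectors: those killed by \<open>\<Lambda>\<close> have
  dimension at least \<open>card I - card \<Lambda>\<close>, and summation maps them injectively
  into \<open>S\<close>. The conditions act on coefficients because a single function
  \<open>\<Phi> i\<close> may lie outside \<open>S\<close>.\<close>

lemma card_le_dim_fun_space: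
  fixes \<Phi> :: "'i \<Rightarrow> 'z \<Rightarrow> real" and \<phi> :: "'k \<Rightarrow> ('i \<Rightarrow> real) \<Rightarrow> real"
  assumes "finite I" "finite \<Lambda>"
    and inj: "\<And>c. (\<And>z. (\<Sum>i\<in>I. c i * \<Phi> i z) = 0) \<Longrightarrow> (\<And>i. i \<in> I \<Longrightarrow> c i = 0)"
    and add: "\<And>k x y. k \<in> \<Lambda> \<Longrightarrow> \<phi> k (\<lambda>i. x i + y i) = \<phi> k x + \<phi> k y"
    and scale: "\<And>k r x. k \<in> \<Lambda> \<Longrightarrow> \<phi> k (\<lambda>i. r * x i) = r * \<phi> k x"
    and mem: "\<And>c. (\<And>k. k \<in> \<Lambda> \<Longrightarrow> \<phi> k c = 0) \<Longrightarrow> (\<lambda>z. \<Sum>i\<in>I. c i * \<Phi> i z) \<in> S"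
    and W: "finite W" "S \<subseteq> module.span fun_scale W"
  shows "card I \<le> vector_space.dim fun_scale S + card \<Lambda>"
proof -
  interpret C: vector_space "fun_scale :: real \<Rightarrow> ('i \<Rightarrow> real) \<Rightarrow> 'i \<Rightarrow> real"
    by (rule vector_space_fun_scale)
  interpret Z: vector_space "fun_scale :: real \<Rightarrow> ('z \<Rightarrow> real) \<Rightarrow> 'z \<Rightarrow> real"
    by (rule vector_space_fun_scale)
  interpret CZ: vector_space_pair "fun_scale :: real \<Rightarrow> ('i \<Rightarrow> real) \<Rightarrow> 'i \<Rightarrow> real"
    "fun_scale :: real \<Rightarrow> ('z \<Rightarrow> real) \<Rightarrow> 'z \<Rightarrow> real" ..
  define \<delta> :: "'i \<Rightarrow> 'i \<Rightarrow> real" where "\<delta> i j = (if i = j then 1 else 0)" for i j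
  have inj_\<delta>: "inj \<delta>" by (auto simp: inj_def \<delta>_def fun_eq_iff split: if_splits)
  have ind: "C.independent (\<delta> ` I)"
  proof (rule C.independent_if_scalars_zero)
    show "finite (\<delta> ` I)" using assms by simp
    fix f x assume "(\<Sum>x\<in>\<delta> ` I. fun_scale (f x) x) = 0" "x \<in> \<delta> ` I"
    then obtain i where i: "x = \<delta> i" "i \<in> I" by auto
    have "0 = (\<Sum>x\<in>\<delta> ` I. fun_scale (f x) x) i" using \<open>_ = 0\<close> by simp
    also have "\<dots> = (\<Sum>j\<in>I. f (\<delta> j) * \<delta> j i)"
      unfolding sum_fun_apply using inj_\<delta>
      by (subst sum.reindex) (auto simp: fun_scale_def inj_on_def inj_def)
    also have "\<dots> = f (\<delta> i)" using i assms(1) by (simp add: \<delta>_def if_distrib sum.delta cong: if_cong)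
    finally show "f x = 0" using i by simp
  qed
  obtain B where B: "finite B" "C.independent B" "B \<subseteq> C.span (\<delta> ` I)" "\<And>b k. b \<in> B \<Longrightarrow> k \<in> \<Lambda> \<Longrightarrow> \<phi> k b = 0"
      "card (\<delta> ` I) \<le> card B + card \<Lambda>"
    using C.independent_in_kernels[OF assms(2) _ ind, of \<phi>] assms(1) add scale
    by (auto simp: plus_fun_def fun_scale_def)
  define T where "T c = (\<lambda>z. \<Sum>i\<in>I. c i * \<Phi> i z)" for c
  have lin: "Vector_Spaces.linear fun_scale fun_scale T"
    by unfold_locales
      (auto simp: T_def fun_scale_def fun_eq_iff sum_distrib_left algebra_simps sum.distrib)
  \<comment> \<open>\<open>T\<close> sees only the coefficients in \<open>I\<close>; it is injective
    on the span of the unit vectors because these vanish elsewhere.\<close>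
  have supp: "c i = 0" if "c \<in> C.span (\<delta> ` I)" "i \<notin> I" for c i
    using that(1) by (induction rule: C.span_induct_alt) (use that(2) in \<open>auto simp: \<delta>_def fun_scale_def split: if_splits\<close>)
  have inj_T: "inj_on T (C.span B)"
  proof (rule inj_onI)
    fix x y assume xy: "x \<in> C.span B" "y \<in> C.span B" "T x = T y"
    have span: "C.span B \<subseteq> C.span (\<delta> ` I)" using C.span_mono[OF B(3)] by (simp add: C.span_span)
    show "x = y"
    proof (rule ext)
      fix i
      have "(\<Sum>i\<in>I. (x i - y i) * \<Phi> i z) = 0" for z
        using fun_cong[OF xy(3), of z] by (simp add: T_def sum_subtractf algebra_simps)
      then have "i \<in> I \<Longrightarrow> x i - y i = 0" by (rule inj)
      moreover have "x i = 0" "y i = 0" if "i \<notin> I" using supp xy span that by blast+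
      ultimately show "x i = y i" by (cases "i \<in> I") auto
    qed
  qed
  have "Z.independent (T ` B)"
    using CZ.linear_independent_injective_image[OF lin B(2) inj_T] .
  moreover have "T ` B \<subseteq> S" using mem B(4) by (auto simp: T_def)
  ultimately have "card (T ` B) \<le> Z.dim S" using Z.card_le_dim W by blast
  moreover have "card (T ` B) = card B"
    using inj_T C.span_superset by (metis card_image inj_on_subset)
  moreover have "card (\<delta> ` I) = card I" using inj_\<delta> by (simp add: card_image inj_on_def inj_def)
  ultimately show ?thesis using B(5) by linarith
qed

section \<open>Polynomials of bounded bidegree and differentiability\<close>

text \<open>Unlike \<open>bipoly_on\<close> this speaks of functions on the whole plane, so that
  representations found at different points can be identified by \<open>bipoly_eq\<close>.\<close>

definition bipoly :: "nat \<Rightarrow> (real \<times> real \<Rightarrow> real) \<Rightarrow> bool" where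
  "bipoly d f \<longleftrightarrow> (\<exists>c. \<forall>z. f z = (\<Sum>i\<le>d. \<Sum>j\<le>d. c i j * fst z ^ i * snd z ^ j))"

lemma bipoly_add: "bipoly d f \<Longrightarrow> bipoly d g \<Longrightarrow> bipoly d (\<lambda>z. f z + g z)"
  unfolding bipoly_def
proof (elim exE)
  fix c c' assume "\<forall>z. f z = (\<Sum>i\<le>d. \<Sum>j\<le>d. c i j * fst z ^ i * snd z ^ j)"
    "\<forall>z. g z = (\<Sum>i\<le>d. \<Sum>j\<le>d. c' i j * fst z ^ i * snd z ^ j)"
  then show "\<exists>c. \<forall>z. f z + g z = (\<Sum>i\<le>d. \<Sum>j\<le>d. c i j * fst z ^ i * snd z ^ j)"
    by (intro exI[of _ "\<lambda>i j. c i j + c' i j"]) (simp add: sum.distrib algebra_simps)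
qed

lemma bipoly_scale: "bipoly d f \<Longrightarrow> bipoly d (\<lambda>z. r * f z)"
  unfolding bipoly_def
proof (elim exE)
  fix c assume "\<forall>z. f z = (\<Sum>i\<le>d. \<Sum>j\<le>d. c i j * fst z ^ i * snd z ^ j)"
  then show "\<exists>c. \<forall>z. r * f z = (\<Sum>i\<le>d. \<Sum>j\<le>d. c i j * fst z ^ i * snd z ^ j)"
    by (intro exI[of _ "\<lambda>i j. r * c i j"]) (simp add: sum_distrib_left algebra_simps)
qed

lemma bipoly_zero: "bipoly d (\<lambda>z. 0)"
  unfolding bipoly_def by (intro exI[of _ "\<lambda>i j. 0"]) simp

lemma bipoly_sum: "(\<And>i. i \<in> I \<Longrightarrow> bipoly d (f i)) \<Longrightarrow> bipoly d (\<lambda>z. \<Sum>i\<in>I. f i z)"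
  by (induction I rule: infinite_finite_induct) (auto intro: bipoly_zero bipoly_add)

lemma poly_eq_sum_le:
  fixes p :: "real poly"
  assumes "degree p \<le> d"
  shows "poly p x = (\<Sum>i\<le>d. coeff p i * x ^ i)"
  unfolding poly_altdef using assms
  by (intro sum.mono_neutral_left) (auto simp: coeff_eq_0)

lemma bipoly_mult:
  assumes "degree p \<le> d" "degree q \<le> d"
  shows "bipoly d (\<lambda>z. poly p (fst z) * poly q (snd z))"
  unfolding bipoly_def
  by (intro exI[of _ "\<lambda>i j. coeff p i * coeff q j"])
    (simp add: poly_eq_sum_le[OF assms(1)] poly_eq_sum_le[OF assms(2)] sum_product algebra_simps)

lemma infinite_open_real:
  assumes "open A" "x \<in> A"
  shows "infinite (A :: real set)"
proof -
  obtain e where "e > 0" "ball x e \<subseteq> A" using assms open_contains_ball by blast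
  then have "{x<..<x + e} \<subseteq> A" by (auto simp: dist_real_def)
  moreover have "infinite {x<..<x + e}" using \<open>e > 0\<close> by (simp add: infinite_Ioo)
  ultimately show ?thesis using finite_subset by blast
qed

text \<open>On an open rectangle inside \<open>U\<close>, fixing the first coordinate leaves a
  polynomial in the second with infinitely many roots. Its coefficients are polynomials in the first
  coordinate that again vanish on an infinite set.\<close>

lemma bipoly_coeffs_zero:
  assumes "open U" "U \<noteq> {}" "\<And>z. z \<in> U \<Longrightarrow> (\<Sum>i\<le>d. \<Sum>j\<le>d. c i j * fst z ^ i * snd z ^ j) = (0::real)"
    and "i \<le> d" "j \<le> d"
  shows "c i j = 0"
proof -
  obtain z where "z \<in> U" using assms(2) by auto
  then obtain A B where AB: "open A" "open B" "z \<in> A \<times> B" "A \<times> B \<subseteq> U"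
    using open_prod_elim[OF assms(1)] by metis
  have inf: "infinite A" "infinite B"
    using AB infinite_open_real[of A "fst z"] infinite_open_real[of B "snd z"] by (auto simp: mem_Times_iff)
  have "(\<Sum>i\<le>d. c i j * x ^ i) = 0" if "x \<in> A" "j \<le> d" for x j
  proof -
    have "B \<subseteq> {y. (\<Sum>j\<le>d. (\<Sum>i\<le>d. c i j * x ^ i) * y ^ j) = 0}"
    proof
      fix y assume "y \<in> B"
      then have "(\<Sum>i\<le>d. \<Sum>j\<le>d. c i j * x ^ i * y ^ j) = 0" using assms(3)[of "(x, y)"] AB that by auto
      then show "y \<in> {y. (\<Sum>j\<le>d. (\<Sum>i\<le>d. c i j * x ^ i) * y ^ j) = 0}"
        by (subst (asm) sum.swap) (simp add: sum_distrib_right)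
    qed
    then have "infinite {y. (\<Sum>j\<le>d. (\<Sum>i\<le>d. c i j * x ^ i) * y ^ j) = 0}"
      using inf finite_subset by blast
    then show ?thesis using that polyfun_finite_roots[of "\<lambda>j. \<Sum>i\<le>d. c i j * x ^ i" d] by blast
  qed
  then have "A \<subseteq> {x. (\<Sum>i\<le>d. c i j * x ^ i) = 0}" using assms by auto
  then have "infinite {x. (\<Sum>i\<le>d. c i j * x ^ i) = 0}" using inf finite_subset by blast
  then show ?thesis using assms(4) polyfun_finite_roots[of "\<lambda>i. c i j" d] by blast
qed

lemma bipoly_eq_zero:
  assumes "bipoly d f" "open U" "U \<noteq> {}" "\<And>z. z \<in> U \<Longrightarrow> f z = 0"
  shows "f z = 0"
proof -
  obtain c where c: "\<And>z. f z = (\<Sum>i\<le>d. \<Sum>j\<le>d. c i j * fst z ^ i * snd z ^ j)"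
    using assms(1) unfolding bipoly_def by auto
  have "c i j = 0" if "i \<le> d" "j \<le> d" for i j
    using bipoly_coeffs_zero[OF assms(2,3), where c = c and d = d] assms(4) c that by simp
  then show ?thesis unfolding c by simp
qed

lemma bipoly_eq:
  assumes "bipoly d f" "bipoly d g" "open U" "U \<noteq> {}" "\<And>z. z \<in> U \<Longrightarrow> f z = g z"
  shows "f = g"
proof
  fix z
  have "bipoly d (\<lambda>z. f z + (- 1) * g z)" using assms by (intro bipoly_add bipoly_scale)
  from bipoly_eq_zero[OF this assms(3,4), of z] assms(5) show "f z = g z" by simp
qed

lemma linear_power_dvd_pderiv:
  fixes p :: "real poly"
  assumes "r ^ Suc k dvd p"
  shows "r ^ k dvd pderiv p"
proof -
  obtain s where "p = r ^ Suc k * s" using assms by (auto elim: dvdE)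
  then have "pderiv p = r ^ k * (r * pderiv s + smult (of_nat (Suc k)) (s * pderiv r))"
    by (simp only: pderiv_mult pderiv_power_Suc) (simp add: algebra_simps)
  then show ?thesis by simp
qed

text \<open>Each derivative removes at most one of the \<open>d\<close> linear factors, so at least
  one is left.\<close>

lemma poly_higher_pderiv_linear_power:
  assumes "i < d"
  shows "poly ((pderiv ^^ i) ([:- a, 1:] ^ d)) (a::real) = 0"
proof -
  have "[:- a, 1:] ^ (d - i) dvd (pderiv ^^ i) ([:- a, 1:] ^ d)" using assms
  proof (induction i)
    case (Suc i)
    then have "[:- a, 1:] ^ Suc (d - Suc i) dvd (pderiv ^^ i) ([:- a, 1:] ^ d)"
      by (simp add: Suc_diff_Suc del: power_Suc)
    from linear_power_dvd_pderiv[OF this] show ?case by simp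
  qed simp
  moreover have "[:- a, 1:] dvd [:- a, 1:] ^ (d - i)" using assms by (simp add: dvd_power)
  ultimately show ?thesis using dvd_trans poly_eq_0_iff_dvd by blast
qed

text \<open>\<open>C_diff_x\<close> and \<open>C_diff_y\<close> in one form. The family
  \<open>D\<close> is a parameter, so that the derivatives of sums and of cut polynomials can be
  named explicitly.\<close>

definition partials :: "bool \<Rightarrow> nat \<Rightarrow> (real \<times> real) set \<Rightarrow> (nat \<Rightarrow> real \<times> real \<Rightarrow> real) \<Rightarrow> bool" where
  "partials h m S D \<longleftrightarrow> (\<forall>i\<le>m. continuous_on S (D i)) \<and>
     (\<forall>i<m. \<forall>z\<in>S. ((\<lambda>u. D i (pt h u (crd (\<not> h) z))) has_real_derivative D (Suc i) z)
        (at (crd h z) within {u. pt h u (crd (\<not> h) z) \<in> S}))"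

definition C_diff :: "bool \<Rightarrow> nat \<Rightarrow> (real \<times> real) set \<Rightarrow> (real \<times> real \<Rightarrow> real) \<Rightarrow> bool" where
  "C_diff h m S f \<longleftrightarrow> (\<exists>D. D 0 = f \<and> partials h m S D)"

lemma C_diff_x_iff: "C_diff_x m S f \<longleftrightarrow> C_diff True m S f"
  unfolding C_diff_x_def C_diff_def partials_def by (simp add: pt_def Ball_def split_paired_all)

lemma C_diff_y_iff: "C_diff_y m S f \<longleftrightarrow> C_diff False m S f"
  unfolding C_diff_y_def C_diff_def partials_def by (simp add: pt_def Ball_def split_paired_all)

lemma partials_add:
  assumes "partials h m S D" "partials h m S E"
  shows "partials h m S (\<lambda>i z. D i z + E i z)"
  using assms unfolding partials_def by (intro conjI allI impI ballI continuous_on_add DERIV_add) simp_all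

lemma partials_scale:
  assumes "partials h m S D"
  shows "partials h m S (\<lambda>i z. r * D i z)"
  using assms unfolding partials_def
  by (intro conjI allI impI ballI continuous_on_mult_left DERIV_cmult) simp_all

lemma C_diff_add: "C_diff h m S f \<Longrightarrow> C_diff h m S g \<Longrightarrow> C_diff h m S (\<lambda>z. f z + g z)"
  unfolding C_diff_def
proof (elim exE conjE)
  fix D E assume "D 0 = f" "E 0 = g" "partials h m S D" "partials h m S E"
  then show "\<exists>D. D 0 = (\<lambda>z. f z + g z) \<and> partials h m S D"
    by (intro exI[of _ "\<lambda>i z. D i z + E i z"] conjI partials_add) simp_all
qed

lemma C_diff_scale: "C_diff h m S f \<Longrightarrow> C_diff h m S (\<lambda>z. r * f z)"
  unfolding C_diff_def
proof (elim exE conjE)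
  fix D assume "D 0 = f" "partials h m S D"
  then show "\<exists>D. D 0 = (\<lambda>z. r * f z) \<and> partials h m S D"
    by (intro exI[of _ "\<lambda>i z. r * D i z"] conjI partials_scale) simp_all
qed

lemma C_diff_zero: "C_diff h m S (\<lambda>z. 0)"
  unfolding C_diff_def partials_def by (rule exI[of _ "\<lambda>i z. 0"]) (auto intro!: continuous_intros)

lemma C_diff_sum: "(\<And>i. i \<in> I \<Longrightarrow> C_diff h m S (f i)) \<Longrightarrow> C_diff h m S (\<lambda>z. \<Sum>i\<in>I. f i z)"
  by (induction I rule: infinite_finite_induct) (auto intro: C_diff_zero C_diff_add)

lemma C_diff_imp_continuous_on: "C_diff h m S f \<Longrightarrow> continuous_on S f"
  unfolding C_diff_def partials_def by (metis le0)

text \<open>Both functions vanish at \<open>x\<close>, so the difference quotient of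
  \<open>f\<close> is squeezed by \<open>B\<close> times that of \<open>g\<close>. This yields a
  derivative where \<open>f\<close> is \<open>g\<close> times a factor that is merely
  bounded.\<close>

lemma has_real_derivative_zero_of_dominated:
  fixes f g :: "real \<Rightarrow> real"
  assumes "(g has_real_derivative 0) (at x within A)" "g x = 0"
    and "\<And>u. u \<in> A \<Longrightarrow> \<bar>f u\<bar> \<le> B * \<bar>g u\<bar>" "f x = 0"
  shows "(f has_real_derivative 0) (at x within A)"
  unfolding has_field_derivative_iff
proof (rule Lim_null_comparison)
  have "((\<lambda>u. (g u - g x) / (u - x)) \<longlongrightarrow> 0) (at x within A)"
    using assms(1) by (simp add: has_field_derivative_iff)
  then have "((\<lambda>u. B * \<bar>(g u - g x) / (u - x)\<bar>) \<longlongrightarrow> B * \<bar>0\<bar>) (at x within A)"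
    by (intro tendsto_intros)
  then show "((\<lambda>u. B * \<bar>(g u - g x) / (u - x)\<bar>) \<longlongrightarrow> 0) (at x within A)" by simp
  show "\<forall>\<^sub>F u in at x within A. norm ((f u - f x) / (u - x)) \<le> B * \<bar>(g u - g x) / (u - x)\<bar>"
    unfolding eventually_at_filter
    by (rule always_eventually) (use assms in \<open>auto simp: divide_right_mono\<close>)
qed

text \<open>The hypothesis \<open>zero\<close> makes the derivatives up to order \<open>m\<close> vanish where \<open>\<kappa>\<close> jumps.\<close>

lemma C_diff_cut:
  fixes Q :: "bool \<Rightarrow> real poly" and \<kappa> :: "real \<times> real \<Rightarrow> real"
  assumes bound: "\<And>z. z \<in> S \<Longrightarrow> \<bar>\<kappa> z\<bar> \<le> B"
    and loc: "\<And>z. z \<in> S \<Longrightarrow> z \<notin> L \<Longrightarrow> \<exists>r>0. \<exists>c. \<forall>w\<in>S \<inter> ball z r. \<kappa> w = c"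
    and zero: "\<And>z i. z \<in> L \<Longrightarrow> i \<le> m \<Longrightarrow>
      poly ((pderiv ^^ i) (Q h)) (crd h z) * poly (Q (\<not> h)) (crd (\<not> h) z) = 0"
  shows "C_diff h m S (\<lambda>z. if z \<in> S then \<kappa> z * (poly (Q True) (fst z) * poly (Q False) (snd z)) else 0)"
proof -
  \<comment> \<open>\<open>D i\<close> is the candidate for the derivative of order \<open>i\<close>
    in direction \<open>h\<close>: \<kappa> is treated as a constant and only the polynomial is
    differentiated.\<close>
  define G where "G i z = poly ((pderiv ^^ i) (Q h)) (crd h z) * poly (Q (\<not> h)) (crd (\<not> h) z)" for i z
  define D where "D i z = (if z \<in> S then \<kappa> z * G i z else 0)" for i z
  have G_cont: "continuous_on UNIV (G i)" for i
    unfolding G_def by (intro continuous_intros)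
  have G_lim: "(G i \<longlongrightarrow> G i z) (at z within A)" for i z A
    using G_cont[of i] by (metis continuous_on_def tendsto_within_subset subset_UNIV UNIV_I)
  have G_der: "((\<lambda>u. G i (pt h u s)) has_real_derivative G (Suc i) (pt h x s)) (at x within A)" for i s x A
    unfolding G_def by (auto intro!: derivative_eq_intros has_field_derivative_at_within[OF poly_DERIV])
  have D0: "D 0 = (\<lambda>z. if z \<in> S then \<kappa> z * (poly (Q True) (fst z) * poly (Q False) (snd z)) else 0)"
    by (cases h) (auto simp: D_def G_def fun_eq_iff)
  have B: "\<bar>D i z\<bar> \<le> B * \<bar>G i z\<bar>" if "z \<in> S" for i z
    using bound[OF that] that by (simp add: D_def abs_mult mult_right_mono)
  have "(D i \<longlongrightarrow> D i z) (at z within S)" if "i \<le> m" and zS: "z \<in> S" for i z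
  proof (cases "z \<in> L")
    case True
    then have "G i z = 0" using zero that by (simp add: G_def)
    moreover from this have "D i z = 0" by (simp add: D_def)
    moreover have "((\<lambda>w. B * \<bar>G i w\<bar>) \<longlongrightarrow> B * \<bar>G i z\<bar>) (at z within S)"
      by (intro tendsto_intros G_lim)
    moreover have "\<forall>\<^sub>F w in at z within S. norm (D i w) \<le> B * \<bar>G i w\<bar>"
      unfolding eventually_at_filter by (rule always_eventually) (use B in auto)
    ultimately show ?thesis using Lim_null_comparison[of "D i" "\<lambda>w. B * \<bar>G i w\<bar>"] by simp
  next
    case False
    then obtain r c where r: "r > 0" "\<And>w. w \<in> S \<Longrightarrow> w \<in> ball z r \<Longrightarrow> \<kappa> w = c"
      using loc[OF zS False] by (auto simp del: mem_ball)
    have lim: "((\<lambda>w. c * G i w) \<longlongrightarrow> c * G i z) (at z within S)" by (intro tendsto_intros G_lim)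
    have eq: "c * G i z = D i z" using r(1) r(2)[OF zS] zS by (simp add: D_def)
    have "\<forall>\<^sub>F w in at z within S. c * G i w = D i w"
      unfolding eventually_at using r by (intro exI[of _ r]) (auto simp: D_def dist_commute)
    from Lim_transform_eventually[OF lim this] show ?thesis unfolding eq .
  qed
  then have cont: "continuous_on S (D i)" if "i \<le> m" for i
    using that by (simp add: continuous_on_def)
  have der: "((\<lambda>u. D i (pt h u (crd (\<not> h) z))) has_real_derivative D (Suc i) z)
        (at (crd h z) within {u. pt h u (crd (\<not> h) z) \<in> S})" if "i < m" and zS: "z \<in> S" for i z
  proof (cases "z \<in> L")
    case True
    \<comment> \<open>\<open>Suc i\<close> is still at most \<open>m\<close>, so \<open>zero\<close>
      covers the next derivative too.\<close>
    have Gz: "G i z = 0" "G (Suc i) z = 0"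
      using zero[OF True, of i] zero[OF True, of "Suc i"] that(1) unfolding G_def by simp_all
    have "((\<lambda>u. D i (pt h u (crd (\<not> h) z))) has_real_derivative 0)
        (at (crd h z) within {u. pt h u (crd (\<not> h) z) \<in> S})"
    proof (rule has_real_derivative_zero_of_dominated)
      show "((\<lambda>u. G i (pt h u (crd (\<not> h) z))) has_real_derivative 0)
          (at (crd h z) within {u. pt h u (crd (\<not> h) z) \<in> S})"
        using G_der[of i "crd (\<not> h) z" "crd h z"] unfolding pt_crd Gz(2) .
      show "G i (pt h (crd h z) (crd (\<not> h) z)) = 0" "D i (pt h (crd h z) (crd (\<not> h) z)) = 0"
        using Gz by (simp_all add: D_def)
      show "\<bar>D i (pt h u (crd (\<not> h) z))\<bar> \<le> B * \<bar>G i (pt h u (crd (\<not> h) z))\<bar>"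
        if "u \<in> {u. pt h u (crd (\<not> h) z) \<in> S}" for u
        using that B by simp
    qed
    moreover have "D (Suc i) z = 0" using Gz(2) unfolding D_def by simp
    ultimately show ?thesis by simp
  next
    case False
    then obtain r c where r: "r > 0" "\<And>w. w \<in> S \<Longrightarrow> w \<in> ball z r \<Longrightarrow> \<kappa> w = c"
      using loc[OF zS False] by (auto simp del: mem_ball)
    have "((\<lambda>u. c * G i (pt h u (crd (\<not> h) z))) has_real_derivative c * G (Suc i) z)
        (at (crd h z) within {u. pt h u (crd (\<not> h) z) \<in> S})"
      using G_der[of i "crd (\<not> h) z" "crd h z"] unfolding pt_crd by (rule DERIV_cmult)
    moreover have "c * G (Suc i) z = D (Suc i) z" using r(1) r(2)[OF zS] zS unfolding D_def by simp
    moreover have "c * G i (pt h u (crd (\<not> h) z)) = D i (pt h u (crd (\<not> h) z))"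
      if "pt h u (crd (\<not> h) z) \<in> S" "dist u (crd h z) < r" for u
    proof -
      have "dist z (pt h u (crd (\<not> h) z)) = dist u (crd h z)"
        using dist_pt[of h "crd h z" "crd (\<not> h) z" u] by (simp add: dist_real_def abs_minus_commute)
      then show ?thesis using r(2)[OF that(1)] that by (simp add: D_def)
    qed
    ultimately show ?thesis
      using has_field_derivative_transform_within[of "\<lambda>u. c * G i (pt h u (crd (\<not> h) z))" "c * G (Suc i) z"
          "crd h z" "{u. pt h u (crd (\<not> h) z) \<in> S}" r "\<lambda>u. D i (pt h u (crd (\<not> h) z))"] r(1) zS
      by simp
  qed
  show ?thesis
    unfolding C_diff_def D0[symmetric] partials_def
    by (intro exI[of _ D] conjI refl allI impI ballI cont der)
qed

text \<open>Monomials cut off to the cells span a finite-dimensional space containing all splines.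
  Cells share sides, so \<open>sel\<close> assigns every point to a single cell and nothing is
  counted twice.\<close>

lemma spline_space_finite_dim:
  assumes "finite M"
  obtains W where "finite W" "spline_space d M \<subseteq> module.span fun_scale W"
proof -
  interpret Z: vector_space "fun_scale :: real \<Rightarrow> (real \<times> real \<Rightarrow> real) \<Rightarrow> real \<times> real \<Rightarrow> real"
    by (rule vector_space_fun_scale)
  define sel where "sel z = (SOME K. K \<in> M \<and> z \<in> K)" for z
  have sel: "sel z \<in> M" "z \<in> sel z" if "z \<in> mesh_domain M" for z
    using that someI_ex[of "\<lambda>K. K \<in> M \<and> z \<in> K"] by (auto simp: sel_def mesh_domain_def)
  define w where "w K i j = (\<lambda>z. if z \<in> mesh_domain M \<and> sel z = K then fst z ^ i * snd z ^ j else 0 :: real)" for K i j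
  define W where "W = (\<lambda>(K, i, j). w K i j) ` (M \<times> {..d} \<times> {..d})"
  have "f \<in> Z.span W" if f: "f \<in> spline_space d M" for f
  proof -
    have "\<forall>K\<in>M. \<exists>c. \<forall>x y. (x, y) \<in> K \<longrightarrow> f (x, y) = (\<Sum>i\<le>d. \<Sum>j\<le>d. c i j * x ^ i * y ^ j)"
      using f unfolding spline_space_def bipoly_on_def by blast
    from bchoice[OF this] obtain c where
      c: "\<forall>K\<in>M. \<forall>x y. (x, y) \<in> K \<longrightarrow> f (x, y) = (\<Sum>i\<le>d. \<Sum>j\<le>d. c K i j * x ^ i * y ^ j)" ..
    have "f = (\<Sum>K\<in>M. \<Sum>i\<le>d. \<Sum>j\<le>d. fun_scale (c K i j) (w K i j))"
    proof
      fix z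
      show "f z = (\<Sum>K\<in>M. \<Sum>i\<le>d. \<Sum>j\<le>d. fun_scale (c K i j) (w K i j)) z"
      proof (cases "z \<in> mesh_domain M")
        case True
        have "(\<Sum>K\<in>M. \<Sum>i\<le>d. \<Sum>j\<le>d. fun_scale (c K i j) (w K i j)) z =
            (\<Sum>K\<in>M. if sel z = K then \<Sum>i\<le>d. \<Sum>j\<le>d. c K i j * fst z ^ i * snd z ^ j else 0)"
          unfolding sum_fun_apply fun_scale_def w_def using True by (intro sum.cong refl) (simp add: algebra_simps)
        also have "\<dots> = (\<Sum>i\<le>d. \<Sum>j\<le>d. c (sel z) i j * fst z ^ i * snd z ^ j)"
          using sel[OF True] assms by simp
        also have "\<dots> = f z" using c[rule_format, of "sel z" "fst z" "snd z"] sel[OF True] by simp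
        finally show ?thesis by simp
      next
        case False
        then have "f z = 0" using f unfolding spline_space_def by blast
        then show ?thesis unfolding sum_fun_apply fun_scale_def w_def using False by simp
      qed
    qed
    also have "\<dots> \<in> Z.span W"
    proof (intro Z.span_sum Z.span_scale Z.span_base)
      fix K i j assume "K \<in> M" "i \<in> {..d}" "j \<in> {..d}"
      then show "w K i j \<in> W" unfolding W_def by (intro image_eqI[of _ _ "(K, i, j)"]) auto
    qed
    finally show ?thesis .
  qed
  moreover have "finite W" using assms by (auto simp: W_def)
  ultimately show ?thesis using that by blast
qed

section \<open>Cells, edges and \<open>l\<close>-edges of a mesh\<close>

lemma mem_cbox_crd: "z \<in> cbox a b \<longleftrightarrow> (\<forall>h. crd h a \<le> crd h z \<and> crd h z \<le> crd h b)"
  by (cases a; cases b; cases z) (auto simp: cbox_Pair_eq all_bool_eq)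

lemma mem_box_crd: "z \<in> box a b \<longleftrightarrow> (\<forall>h. crd h a < crd h z \<and> crd h z < crd h b)"
  for z :: "real \<times> real"
  by (cases a; cases b; cases z) (auto simp: mem_box Basis_prod_def all_bool_eq)

text \<open>\<open>lob K h\<close> and \<open>hib K h\<close> are the bounds of the cell \<open>K\<close> in direction \<open>h\<close>; they are
  meaningless if \<open>K\<close> is not a non-empty box.\<close>

definition lob :: "(real \<times> real) set \<Rightarrow> bool \<Rightarrow> real" where
  "lob K h = crd h (fst (SOME ab. K = cbox (fst ab) (snd ab)))"

definition hib :: "(real \<times> real) set \<Rightarrow> bool \<Rightarrow> real" where
  "hib K h = crd h (snd (SOME ab. K = cbox (fst ab) (snd ab)))"

lemma lob_hib_cbox:
  assumes "cbox a b \<noteq> ({} :: (real \<times> real) set)"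
  shows "lob (cbox a b) h = crd h a" "hib (cbox a b) h = crd h b"
proof -
  define ab where "ab = (SOME ab. cbox a b = cbox (fst ab) (snd ab))"
  have "cbox a b = cbox (fst ab) (snd ab)"
    unfolding ab_def by (rule someI[of _ "(a, b)"]) simp
  then have "fst ab = a" "snd ab = b" using assms by (auto simp: eq_cbox)
  then show "lob (cbox a b) h = crd h a" "hib (cbox a b) h = crd h b"
    by (simp_all add: lob_def hib_def flip: ab_def)
qed

lemma seg_subset_seg:
  assumes "a < b" "seg h s a b \<subseteq> seg h' s' a' b'"
  shows "h = h'" "s = s'" "a' \<le> a" "b \<le> b'"
proof -
  have "pt h a s \<in> seg h s a b" "pt h b s \<in> seg h s a b" using assms(1) by (auto simp: seg_def)
  then have in': "pt h a s \<in> seg h' s' a' b'" "pt h b s \<in> seg h' s' a' b'" using assms(2) by auto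
  show h: "h = h'"
  proof (rule ccontr)
    assume "h \<noteq> h'"
    then have "h' = (\<not> h)" by auto
    then show False using in' assms(1) by (simp add: seg_def)
  qed
  show "s = s'" "a' \<le> a" "b \<le> b'" using in' unfolding h by (simp_all add: seg_def)
qed

lemma seg_eq_seg:
  assumes "a < b" "a' < b'" "seg h s a b = seg h' s' a' b'"
  shows "h = h'" "s = s'" "a = a'" "b = b'"
  using seg_subset_seg[of a b h s h' s' a' b'] seg_subset_seg[of a' b' h' s' h s a b] assms
  by (auto intro: antisym)

lemma axis_segment:
  assumes "v \<noteq> w" "axis_aligned v w"
  obtains h s a b where "a < b" "closed_segment v w = seg h s a b" "{v, w} = {pt h a s, pt h b s}"
proof -
  obtain h where h: "crd (\<not> h) v = crd (\<not> h) w"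
    using assms(2) unfolding axis_aligned_def by (metis crd_simps(1,2))
  have vw: "v = pt h (crd h v) (crd (\<not> h) v)" "w = pt h (crd h w) (crd (\<not> h) v)"
    using h pt_crd by metis+
  have ne: "crd h v \<noteq> crd h w" using vw assms(1) by metis
  show thesis
  proof (cases "crd h v < crd h w")
    case True
    show thesis
    proof (rule that[OF True])
      show "closed_segment v w = seg h (crd (\<not> h) v) (crd h v) (crd h w)"
        using closed_segment_pt[of "crd h v" "crd h w" h "crd (\<not> h) v"] True vw by simp
      show "{v, w} = {pt h (crd h v) (crd (\<not> h) v), pt h (crd h w) (crd (\<not> h) v)}"
        using vw by simp
    qed
  next
    case False
    then have less: "crd h w < crd h v" using ne by simp
    show thesis
    proof (rule that[OF less])
      show "closed_segment v w = seg h (crd (\<not> h) v) (crd h w) (crd h v)"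
        using closed_segment_pt[of "crd h w" "crd h v" h "crd (\<not> h) v"] less vw
        by (simp add: closed_segment_commute)
      show "{v, w} = {pt h (crd h w) (crd (\<not> h) v), pt h (crd h v) (crd (\<not> h) v)}"
        using vw by auto
    qed
  qed
qed

lemma axis_aligned_pt: "axis_aligned (pt h a s) (pt h b s)"
  by (cases h) (auto simp: axis_aligned_def pt_def)

text \<open>The point at distance \<open>t\<close> from \<open>w\<close> in direction \<open>h\<close>, to the right or upwards if \<open>\<sigma>\<close>.\<close>

definition dirpt :: "bool \<Rightarrow> bool \<Rightarrow> real \<times> real \<Rightarrow> real \<Rightarrow> real \<times> real" where
  "dirpt h \<sigma> w t = pt h (crd h w + (if \<sigma> then t else - t)) (crd (\<not> h) w)"

lemma crd_dirpt [simp]: "crd h (dirpt h \<sigma> w t) = crd h w + (if \<sigma> then t else - t)"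
    "crd (\<not> h) (dirpt h \<sigma> w t) = crd (\<not> h) w"
  by (simp_all add: dirpt_def)

lemma axis_aligned_dirpt: "axis_aligned w (dirpt h \<sigma> w t)"
  using axis_aligned_pt[of h "crd h w" "crd (\<not> h) w"] by (simp add: dirpt_def)

lemma closed_segment_dirpt:
  assumes "t > 0"
  shows "closed_segment w (dirpt h \<sigma> w t) =
    (if \<sigma> then seg h (crd (\<not> h) w) (crd h w) (crd h w + t) else seg h (crd (\<not> h) w) (crd h w - t) (crd h w))"
proof -
  have w: "w = pt h (crd h w) (crd (\<not> h) w)" by simp
  show ?thesis
    using closed_segment_pt[of "crd h w" "crd h w + t" h "crd (\<not> h) w"]
      closed_segment_pt[of "crd h w - t" "crd h w" h "crd (\<not> h) w"] assms
    by (simp add: dirpt_def closed_segment_commute)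
qed

lemma mem_closed_segment_dirpt:
  assumes "t > 0" "z \<in> closed_segment w (dirpt h \<sigma> w t)"
  obtains u where "0 \<le> u" "u \<le> t" "z = dirpt h \<sigma> w u"
proof (cases \<sigma>)
  case True
  then have "z \<in> seg h (crd (\<not> h) w) (crd h w) (crd h w + t)" using assms closed_segment_dirpt by simp
  then show thesis using True
    by (intro that[of "crd h z - crd h w"]) (auto simp: seg_def dirpt_def pt_eq_iff)
next
  case False
  then have "z \<in> seg h (crd (\<not> h) w) (crd h w - t) (crd h w)" using assms closed_segment_dirpt by simp
  then show thesis using False
    by (intro that[of "crd h w - crd h z"]) (auto simp: seg_def dirpt_def pt_eq_iff)
qed

lemma dirpt_inject:
  assumes "t > 0" "t' > 0" "dirpt h \<sigma> w t = dirpt h' \<sigma>' w t'"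
  shows "h = h'" "\<sigma> = \<sigma>'" "t = t'"
proof -
  show h: "h = h'"
  proof (rule ccontr)
    assume "h \<noteq> h'"
    then have "h' = (\<not> h)" by auto
    then have "crd h (dirpt h' \<sigma>' w t') = crd h w"
      using crd_dirpt(2)[of h' \<sigma>' w t'] by simp
    then have "crd h w + (if \<sigma> then t else - t) = crd h w" by (simp only: assms(3)[symmetric] crd_dirpt)
    then show False using assms(1) by (simp split: if_splits)
  qed
  have "crd h w + (if \<sigma> then t else - t) = crd h w + (if \<sigma>' then t' else - t')"
    using assms(3) crd_dirpt(1) unfolding h by metis
  then show "\<sigma> = \<sigma>'" "t = t'" using assms(1,2) by (auto split: if_splits)
qed

lemma dirpt_neq:
  assumes "t > 0"
  shows "dirpt h \<sigma> w t \<noteq> w"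
proof
  assume "dirpt h \<sigma> w t = w"
  then have "crd h w + (if \<sigma> then t else - t) = crd h w" using crd_dirpt(1) by metis
  then show False using assms by (simp split: if_splits)
qed

lemma axis_aligned_commute: "axis_aligned v w \<longleftrightarrow> axis_aligned w v"
  by (auto simp: axis_aligned_def)

lemma dirpt_exists:
  assumes "u \<noteq> w" "axis_aligned w u"
  obtains h \<sigma> t where "t > 0" "u = dirpt h \<sigma> w t"
proof -
  obtain h where h: "crd (\<not> h) w = crd (\<not> h) u"
    using assms(2) unfolding axis_aligned_def by (metis crd_simps(1,2))
  then have ne: "crd h u \<noteq> crd h w" using assms(1) point_eq_iff by metis
  show thesis
    using that[of "\<bar>crd h u - crd h w\<bar>" h "crd h w < crd h u"] ne h
    by (simp add: dirpt_def pt_eq_iff)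
qed

section \<open>Cells, grid lines and quadrants\<close>

locale mesh =
  fixes M :: mesh
  assumes t_mesh: "t_mesh M"
begin

abbreviation \<Omega> where "\<Omega> \<equiv> mesh_domain M"

lemma finite_cells: "finite M"
  using t_mesh unfolding t_mesh_def by (auto dest: division_ofD(1))

lemma cell_cbox:
  assumes "K \<in> M"
  obtains a b where "K = cbox a b" "box a b \<noteq> {}"
  using t_mesh assms unfolding t_mesh_def by (metis division_ofD(4) interior_cbox)

lemma lob_less_hib: "K \<in> M \<Longrightarrow> lob K h < hib K h"
proof (rule cell_cbox)
  fix a b assume K: "K = cbox a b" "box a b \<noteq> {}"
  then obtain z where "z \<in> box a b" by auto
  then have "crd h a < crd h z" "crd h z < crd h b" by (auto simp: mem_box_crd)
  moreover have "cbox a b \<noteq> {}" using K(2) box_subset_cbox by blast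
  ultimately show ?thesis unfolding K(1) by (simp add: lob_hib_cbox)
qed

lemma mem_cell: "K \<in> M \<Longrightarrow> z \<in> K \<longleftrightarrow> (\<forall>h. lob K h \<le> crd h z \<and> crd h z \<le> hib K h)"
proof (rule cell_cbox)
  fix a b assume K: "K = cbox a b" "box a b \<noteq> {}"
  have "cbox a b \<noteq> {}" using K(2) box_subset_cbox by blast
  then show ?thesis unfolding K(1) by (simp add: lob_hib_cbox mem_cbox_crd)
qed

lemma mem_interior_cell: "K \<in> M \<Longrightarrow> z \<in> interior K \<longleftrightarrow> (\<forall>h. lob K h < crd h z \<and> crd h z < hib K h)"
proof (rule cell_cbox)
  fix a b assume K: "K = cbox a b" "box a b \<noteq> {}"
  have "cbox a b \<noteq> {}" using K(2) box_subset_cbox by blast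
  then show ?thesis unfolding K(1) by (simp add: lob_hib_cbox mem_box_crd)
qed

lemma closed_cell: "K \<in> M \<Longrightarrow> closed K"
  by (rule cell_cbox) auto

lemma frontier_cell: "K \<in> M \<Longrightarrow> frontier K = K - interior K"
  by (simp add: frontier_def closed_cell)

lemma compact_domain: "compact \<Omega>"
  unfolding mesh_domain_def using finite_cells
  by (intro compact_Union) (auto elim: cell_cbox)

lemma frontier_domain: "frontier \<Omega> = \<Omega> - interior \<Omega>"
  using compact_domain by (simp add: frontier_def compact_imp_closed)

lemma mem_domain: "z \<in> \<Omega> \<longleftrightarrow> (\<exists>K\<in>M. z \<in> K)"
  by (auto simp: mesh_domain_def)

lemma simply_connected_domain: "simply_connected \<Omega>"
  using t_mesh unfolding t_mesh_def by blast

text \<open>Required by the global logarithm alongside simple connectedness; a finite union of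
  closed convex sets is an absolute neighbourhood retract.\<close>

lemma locally_path_connected_domain: "locally path_connected \<Omega>"
  unfolding mesh_domain_def
  by (intro ANR_imp_locally_path_connected ANR_finite_Union_convex_closed finite_cells closed_cell)
    (auto elim: cell_cbox)

text \<open>The midpoint of the overlap is interior to both cells, while distinct cells of a
  division have disjoint interiors.\<close>

lemma cells_eq:
  assumes "K \<in> M" "K' \<in> M" "\<And>h. max (lob K h) (lob K' h) < min (hib K h) (hib K' h)"
  shows "K = K'"
proof (rule ccontr)
  assume "K \<noteq> K'"
  then have disj: "interior K \<inter> interior K' = {}"
    using t_mesh assms unfolding t_mesh_def by (metis division_ofD(5))
  define m where "m h = (max (lob K h) (lob K' h) + min (hib K h) (hib K' h)) / 2" for h
  have m: "lob K h < m h \<and> m h < hib K h \<and> lob K' h < m h \<and> m h < hib K' h" for h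
    using assms(3)[of h] unfolding m_def by auto
  have "crd h (m True, m False) = m h" for h by (cases h) auto
  then have "(m True, m False) \<in> interior K \<inter> interior K'"
    using m assms by (simp add: mem_interior_cell)
  then show False using disj by auto
qed

lemma cell_eq_if_interior:
  assumes "K \<in> M" "K' \<in> M" "z \<in> interior K" "z \<in> K'"
  shows "K = K'"
proof (rule cells_eq[OF assms(1,2)])
  fix h
  have "lob K h < crd h z" "crd h z < hib K h" "lob K' h \<le> crd h z" "crd h z \<le> hib K' h"
    using assms mem_interior_cell mem_cell by auto
  then show "max (lob K h) (lob K' h) < min (hib K h) (hib K' h)"
    using lob_less_hib[OF assms(1), of h] lob_less_hib[OF assms(2), of h] by auto
qed

lemma mem_vertices: "v \<in> vertices M \<longleftrightarrow> (\<exists>K\<in>M. \<forall>h. crd h v = lob K h \<or> crd h v = hib K h)"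
proof
  assume "v \<in> vertices M"
  then obtain a b where ab: "cbox a b \<in> M" "fst v \<in> {fst a, fst b}" "snd v \<in> {snd a, snd b}"
    unfolding vertices_def by blast
  have "cbox a b \<noteq> {}" using lob_less_hib[OF ab(1)] mem_cell[OF ab(1), of "(lob (cbox a b) True, lob (cbox a b) False)"]
    by (auto simp: all_bool_eq intro: less_imp_le)
  then show "\<exists>K\<in>M. \<forall>h. crd h v = lob K h \<or> crd h v = hib K h"
    using ab by (intro bexI[of _ "cbox a b"]) (auto simp: lob_hib_cbox all_bool_eq)
next
  assume "\<exists>K\<in>M. \<forall>h. crd h v = lob K h \<or> crd h v = hib K h"
  then obtain K where K: "K \<in> M" "\<And>h. crd h v = lob K h \<or> crd h v = hib K h" by auto
  obtain a b where ab: "K = cbox a b" "box a b \<noteq> {}" using cell_cbox[OF K(1)] .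
  have ne: "cbox a b \<noteq> {}" using ab(2) box_subset_cbox by blast
  have "crd h v = crd h a \<or> crd h v = crd h b" for h
    using K(2)[of h] unfolding ab(1) lob_hib_cbox[OF ne] .
  from this[of True] this[of False] show "v \<in> vertices M"
    unfolding vertices_def mem_Collect_eq using K(1) ab(1) by (intro exI[of _ a] exI[of _ b]) simp
qed

lemma finite_vertices: "finite (vertices M)"
proof -
  have "vertices M \<subseteq> (\<lambda>(K, i, j). (if i then lob K True else hib K True, if j then lob K False else hib K False)) `
      (M \<times> UNIV \<times> UNIV)" (is "_ \<subseteq> ?f ` _")
  proof
    fix v assume "v \<in> vertices M"
    then obtain K where K: "K \<in> M" "\<And>h. crd h v = lob K h \<or> crd h v = hib K h"
      unfolding mem_vertices by auto
    have "v = ?f (K, fst v = lob K True, snd v = lob K False)"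
      using K(2)[of True] K(2)[of False] by (auto simp: prod_eq_iff)
    then show "v \<in> ?f ` (M \<times> UNIV \<times> UNIV)" using K(1) by blast
  qed
  then show ?thesis by (rule finite_subset) (use finite_cells in auto)
qed

lemma vertex_notin_interior: "v \<in> vertices M \<Longrightarrow> K \<in> M \<Longrightarrow> v \<notin> interior K"
proof
  assume "v \<in> vertices M" "K \<in> M" "v \<in> interior K"
  then obtain K' where K': "K' \<in> M" "\<And>h. crd h v = lob K' h \<or> crd h v = hib K' h"
    unfolding mem_vertices by auto
  have "lob K' h \<le> crd h v \<and> crd h v \<le> hib K' h" for h
    using K'(2)[of h] lob_less_hib[OF K'(1), of h] by auto
  then have "v \<in> K'" using mem_cell[OF K'(1)] by simp
  then have "K = K'" using cell_eq_if_interior \<open>K \<in> M\<close> K'(1) \<open>v \<in> interior K\<close> by blast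
  then have "lob K' True < crd True v \<and> crd True v < hib K' True"
    using \<open>v \<in> interior K\<close> mem_interior_cell[OF K'(1)] by blast
  then show False using K'(2)[of True] by auto
qed

lemma vertices_subset_domain: "vertices M \<subseteq> \<Omega>"
proof
  fix v assume "v \<in> vertices M"
  then obtain K' where K': "K' \<in> M" "\<And>h. crd h v = lob K' h \<or> crd h v = hib K' h"
    unfolding mem_vertices by auto
  have "lob K' h \<le> crd h v \<and> crd h v \<le> hib K' h" for h
    using K'(2)[of h] lob_less_hib[OF K'(1), of h] by auto
  then have "v \<in> K'" using mem_cell[OF K'(1)] by simp
  then show "v \<in> \<Omega>" using K'(1) mem_domain by blast
qed

lemma skeleton_notin_interior: "z \<in> (\<Union>K\<in>M. frontier K) \<Longrightarrow> K \<in> M \<Longrightarrow> z \<notin> interior K"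
proof
  assume "z \<in> (\<Union>K\<in>M. frontier K)" "K \<in> M" "z \<in> interior K"
  then obtain K' where K': "K' \<in> M" "z \<in> K'" "z \<notin> interior K'" using frontier_cell by auto
  then show False using cell_eq_if_interior[OF \<open>K \<in> M\<close> K'(1) \<open>z \<in> interior K\<close>] \<open>z \<in> interior K\<close> by auto
qed

text \<open>Closer to \<open>e\<close> than \<open>\<delta>\<close> there are no grid lines except
  those through \<open>e\<close>. The descriptions of the domain near a point take their radius from
  here.\<close>

lemma grid_margin:
  obtains \<delta> where "\<delta> > 0"
    "\<And>K h. K \<in> M \<Longrightarrow> lob K h \<noteq> crd h e \<Longrightarrow> \<delta> \<le> \<bar>lob K h - crd h e\<bar>"
    "\<And>K h. K \<in> M \<Longrightarrow> hib K h \<noteq> crd h e \<Longrightarrow> \<delta> \<le> \<bar>hib K h - crd h e\<bar>"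
proof -
  define X where "X = (\<lambda>(K, h). \<bar>lob K h - crd h e\<bar>) ` (M \<times> UNIV) \<union> (\<lambda>(K, h). \<bar>hib K h - crd h e\<bar>) ` (M \<times> UNIV)"
  \<comment> \<open>The element 1 keeps the set non-empty, so that its \<open>Min\<close> is
    meaningful.\<close>
  define Y where "Y = insert 1 (X - {0})"
  have "finite X" using finite_cells by (auto simp: X_def)
  then have fin: "finite Y" by (auto simp: Y_def)
  have mem: "\<bar>lob K h - crd h e\<bar> \<in> X" "\<bar>hib K h - crd h e\<bar> \<in> X" if "K \<in> M" for K h
    using that unfolding X_def by force+
  show thesis
  proof
    have "\<forall>y\<in>Y. y > 0" unfolding Y_def X_def by auto
    then show "Min Y > 0" using fin by (simp add: Y_def)
    show "Min Y \<le> \<bar>lob K h - crd h e\<bar>" if "K \<in> M" "lob K h \<noteq> crd h e" for K h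
      using mem(1)[OF that(1), of h] that(2) fin by (intro Min_le) (auto simp: Y_def)
    show "Min Y \<le> \<bar>hib K h - crd h e\<bar>" if "K \<in> M" "hib K h \<noteq> crd h e" for K h
      using mem(2)[OF that(1), of h] that(2) fin by (intro Min_le) (auto simp: Y_def)
  qed
qed

text \<open>\<open>K\<close> contains a neighbourhood of \<open>e\<close> within the quadrant at \<open>e\<close> with signs \<open>q\<close>.\<close>

definition quad :: "(bool \<Rightarrow> bool) \<Rightarrow> (real \<times> real) set \<Rightarrow> real \<times> real \<Rightarrow> bool" where
  "quad q K e \<longleftrightarrow> (\<forall>h. if q h then lob K h \<le> crd h e \<and> crd h e < hib K h
                          else lob K h < crd h e \<and> crd h e \<le> hib K h)"

lemma quad_bounds:
  assumes "quad q K e"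
  shows "lob K h \<le> crd h e" "crd h e \<le> hib K h" "q h \<Longrightarrow> crd h e < hib K h" "\<not> q h \<Longrightarrow> lob K h < crd h e"
  using assms[unfolded quad_def, rule_format, of h] by (auto split: if_splits)

lemma quad_mem: "K \<in> M \<Longrightarrow> quad q K e \<Longrightarrow> e \<in> K"
  using mem_cell quad_bounds by blast

lemma quad_unique:
  assumes "K \<in> M" "K' \<in> M" "quad q K e" "quad q K' e"
  shows "K = K'"
proof (rule cells_eq[OF assms(1,2)])
  fix h
  show "max (lob K h) (lob K' h) < min (hib K h) (hib K' h)"
    using quad_bounds[OF assms(3), of h] quad_bounds[OF assms(4), of h] by (cases "q h") auto
qed

lemma quad_exists:
  assumes "e \<in> interior \<Omega>"
  obtains K where "K \<in> M" "quad q K e"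
proof -
  obtain \<epsilon> where \<epsilon>: "\<epsilon> > 0" "ball e \<epsilon> \<subseteq> \<Omega>" using assms unfolding mem_interior by blast
  obtain \<delta> where \<delta>: "\<delta> > 0" "\<And>K h. K \<in> M \<Longrightarrow> lob K h \<noteq> crd h e \<Longrightarrow> \<delta> \<le> \<bar>lob K h - crd h e\<bar>"
    "\<And>K h. K \<in> M \<Longrightarrow> hib K h \<noteq> crd h e \<Longrightarrow> \<delta> \<le> \<bar>hib K h - crd h e\<bar>"
    using grid_margin by metis
  \<comment> \<open>The probe \<open>z\<close> is displaced by \<open>r\<close> in both coordinates:
    \<open>2 * r < \<epsilon>\<close> keeps it in the domain, and \<open>r < \<delta>\<close>
    ensures that no grid line separates it from \<open>e\<close>, so its cell reaches up to
    \<open>e\<close>.\<close>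
  define r where "r = min (\<epsilon> / 3) (\<delta> / 2)"
  have r: "r > 0" "r < \<delta>" "2 * r < \<epsilon>" using \<epsilon>(1) \<delta>(1) by (auto simp: r_def)
  define g where "g h = crd h e + (if q h then r else - r)" for h
  define z where "z = (g True, g False)"
  have z: "crd h z = g h" for h by (cases h) (auto simp: z_def)
  have "dist z e \<le> \<bar>crd True z - crd True e\<bar> + \<bar>crd (\<not> True) z - crd (\<not> True) e\<bar>" by (rule dist_le_crd)
  also have "\<dots> \<le> 2 * r" unfolding z g_def using r(1) by auto
  finally have "z \<in> ball e \<epsilon>" using r by (simp add: dist_commute)
  then have "z \<in> \<Omega>" using \<epsilon>(2) by blast
  then obtain K where K: "K \<in> M" "z \<in> K" using mem_domain by blast
  have "if q h then lob K h \<le> crd h e \<and> crd h e < hib K h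
                          else lob K h < crd h e \<and> crd h e \<le> hib K h" for h
  proof -
    have "lob K h \<le> g h" "g h \<le> hib K h" using K mem_cell[OF K(1)] z by auto
    then show ?thesis using \<delta>(2,3)[OF K(1), of h] r unfolding g_def
      by (cases "q h"; cases "lob K h = crd h e"; cases "hib K h = crd h e") (auto simp: abs_if split: if_splits)
  qed
  then show thesis using that[OF K(1)] by (simp add: quad_def)
qed

text \<open>A cell of a quadrant at \<open>e\<close> extends by at least \<open>\<delta>\<close>
  into it, so the cells of the four quadrants cover a ball.\<close>

lemma interior_of_quads:
  assumes "\<And>q. \<exists>K\<in>M. quad q K e"
  shows "e \<in> interior \<Omega>"
proof -
  obtain \<delta> where \<delta>: "\<delta> > 0" "\<And>K h. K \<in> M \<Longrightarrow> lob K h \<noteq> crd h e \<Longrightarrow> \<delta> \<le> \<bar>lob K h - crd h e\<bar>"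
    "\<And>K h. K \<in> M \<Longrightarrow> hib K h \<noteq> crd h e \<Longrightarrow> \<delta> \<le> \<bar>hib K h - crd h e\<bar>"
    using grid_margin by metis
  have "z \<in> \<Omega>" if "z \<in> ball e \<delta>" for z
  proof -
    obtain K where K: "K \<in> M" "quad (\<lambda>h. crd h e \<le> crd h z) K e" using assms by blast
    have "lob K h \<le> crd h z \<and> crd h z \<le> hib K h" for h
    proof -
      have "\<bar>crd h z - crd h e\<bar> < \<delta>" using abs_crd_le_dist[of h z e] that by (simp add: dist_commute)
      then show ?thesis using quad_bounds[OF K(2), of h] \<delta>(2,3)[OF K(1), of h]
        by (cases "crd h e \<le> crd h z") auto
    qed
    then show ?thesis using mem_cell[OF K(1)] K(1) mem_domain by blast
  qed
  then show ?thesis unfolding mem_interior using \<delta>(1) by blast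
qed

section \<open>Edges and the cells along them\<close>

lemma edgeE:
  assumes "e \<in> edges M"
  obtains h s a b where "a < b" "e = seg h s a b" "e \<subseteq> (\<Union>K\<in>M. frontier K)"
    "vertices M \<inter> e = {pt h a s, pt h b s}"
proof -
  obtain v w where vw: "e = closed_segment v w" "v \<noteq> w" "axis_aligned v w"
      "e \<subseteq> (\<Union>K\<in>M. frontier K)" "vertices M \<inter> e = {v, w}"
    using assms unfolding edges_def by blast
  obtain h s a b where "a < b" "closed_segment v w = seg h s a b" "{v, w} = {pt h a s, pt h b s}"
    using axis_segment[OF vw(2,3)] by metis
  then show thesis using that vw by simp
qed

lemma seg_edge:
  assumes "seg h s a b \<in> edges M" "a < b"
  shows "seg h s a b \<subseteq> (\<Union>K\<in>M. frontier K)" "vertices M \<inter> seg h s a b = {pt h a s, pt h b s}"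
proof -
  obtain h' s' a' b' where *: "a' < b'" "seg h s a b = seg h' s' a' b'" "seg h s a b \<subseteq> (\<Union>K\<in>M. frontier K)"
    "vertices M \<inter> seg h s a b = {pt h' a' s', pt h' b' s'}"
    using edgeE[OF assms(1)] by metis
  note eq = seg_eq_seg[OF assms(2) *(1,2)]
  show "seg h s a b \<subseteq> (\<Union>K\<in>M. frontier K)" "vertices M \<inter> seg h s a b = {pt h a s, pt h b s}"
    using * eq by simp_all
qed

text \<open>An edge avoids the interiors of cells, so it runs along a side of \<open>K\<close>. The
  corners on that side are vertices, and an edge contains no vertices besides its ends; hence it
  does not go beyond the side.\<close>

lemma edge_side:
  assumes "seg h s a b \<in> edges M" "a < t" "t < b" "K \<in> M" "pt h t s \<in> K"
  shows "s = lob K (\<not> h) \<or> s = hib K (\<not> h)" "lob K h \<le> a" "b \<le> hib K h"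
proof -
  have ab: "a < b" using assms by simp
  note e = seg_edge[OF assms(1) ab]
  have tK: "lob K h \<le> t" "t \<le> hib K h" "lob K (\<not> h) \<le> s" "s \<le> hib K (\<not> h)"
    using mem_cell[OF assms(4), of "pt h t s"] assms(5) by (metis crd_pt(1,2))+
  show side: "s = lob K (\<not> h) \<or> s = hib K (\<not> h)"
  proof (rule ccontr)
    assume "\<not> ?thesis"
    then have s: "lob K (\<not> h) < s" "s < hib K (\<not> h)" using tK by auto
    define u where "u = (max a (lob K h) + min b (hib K h)) / 2"
    have u: "a < u" "u < b" "lob K h < u" "u < hib K h"
      using assms(2,3) tK lob_less_hib[OF assms(4), of h] unfolding u_def by auto
    have "pt h u s \<in> interior K"
      unfolding mem_interior_cell[OF assms(4)] all_bool_iff[of _ h] using u s by simp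
    moreover have "pt h u s \<in> seg h s a b" using u by (simp add: seg_def)
    ultimately show False using skeleton_notin_interior e(1) assms(4) by blast
  qed
  have corner: "pt h x s \<in> vertices M" if "x = lob K h \<or> x = hib K h" for x
    unfolding mem_vertices all_bool_iff[of _ h] using side that assms(4) by auto
  show "lob K h \<le> a"
  proof (rule ccontr)
    assume less: "\<not> ?thesis"
    then have "pt h (lob K h) s \<in> vertices M \<inter> seg h s a b"
      using corner tK assms by (simp add: seg_def)
    then show False using e(2) less tK assms by auto
  qed
  show "b \<le> hib K h"
  proof (rule ccontr)
    assume less: "\<not> ?thesis"
    then have "pt h (hib K h) s \<in> vertices M \<inter> seg h s a b"
      using corner tK assms by (simp add: seg_def)
    then show False using e(2) less tK assms by auto
  qed
qed

text \<open>Being interior promises just one point of the edge off the frontier. The cell found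
  there on the side \<open>\<sigma>\<close> accompanies the whole edge by
  \<open>edge_side\<close>.\<close>

lemma interior_edge_cell:
  assumes "seg h s a b \<in> interior_edges M" "a < b"
  obtains K where "K \<in> M" "lob K h \<le> a" "b \<le> hib K h" "lob K (\<not> h) \<le> s" "s \<le> hib K (\<not> h)"
    "if \<sigma> then s < hib K (\<not> h) else lob K (\<not> h) < s"
proof -
  have e: "seg h s a b \<in> edges M" "\<not> seg h s a b \<subseteq> frontier \<Omega>"
    using assms(1) by (auto simp: interior_edges_def)
  then obtain z where z: "z \<in> seg h s a b" "z \<notin> frontier \<Omega>" by blast
  have "z \<in> \<Omega>" using z(1) seg_edge(1)[OF e(1) assms(2)] frontier_cell mem_domain by blast
  then have "z \<in> interior \<Omega>" using z(2) frontier_domain by blast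
  then obtain \<epsilon> where \<epsilon>: "\<epsilon> > 0" "ball z \<epsilon> \<subseteq> interior \<Omega>"
    using open_contains_ball open_interior by metis
  \<comment> \<open>\<open>z\<close> may be an end of the edge; \<open>u\<close> lies strictly
    between the ends and closer to \<open>z\<close> than \<open>\<epsilon>\<close>.\<close>
  define u where "u = (max a (crd h z - \<epsilon> / 2) + min b (crd h z + \<epsilon> / 2)) / 2"
  have zc: "a \<le> crd h z" "crd h z \<le> b" "crd (\<not> h) z = s" using z(1) by (auto simp: seg_def)
  have u: "a < u" "u < b" "\<bar>u - crd h z\<bar> < \<epsilon>"
    using \<epsilon>(1) zc assms(2) unfolding u_def max_def min_def abs_less_iff by (auto split: if_splits simp: field_simps)
  have "dist z (pt h u s) < \<epsilon>"
    using dist_pt[of h "crd h z" s u] zc(3) u(3) pt_crd[of h z] by (simp add: abs_minus_commute)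
  then have "pt h u s \<in> interior \<Omega>" using \<epsilon>(2) by auto
  then obtain K where K: "K \<in> M" "quad (\<lambda>k. if k = h then True else \<sigma>) K (pt h u s)" using quad_exists by metis
  note side = edge_side[OF e(1) u(1,2) K(1) quad_mem[OF K]]
  show thesis
    using that[OF K(1) side(2,3)] quad_bounds[OF K(2), of "\<not> h"] by simp
qed

lemma finite_edges: "finite (edges M)"
proof -
  have "edges M \<subseteq> (\<lambda>(v, w). closed_segment v w) ` (vertices M \<times> vertices M)"
    unfolding edges_def by auto
  then show ?thesis by (rule finite_subset) (use finite_vertices in auto)
qed

text \<open>Nothing is required of the ends, so that runs can be lengthened edge by edge before
  maximality is considered.\<close>

definition run :: "bool \<Rightarrow> real \<Rightarrow> real \<Rightarrow> real \<Rightarrow> bool" where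
  "run h s a b \<longleftrightarrow> a < b \<and> (\<exists>E \<subseteq> interior_edges M. seg h s a b = \<Union>E)"

text \<open>The point \<open>u\<close> only indicates a direction. The finitely many edges not
  containing the point at \<open>t\<close> keep a positive distance from it, so the edge through a
  point slightly towards \<open>u\<close> also contains the point at \<open>t\<close>.\<close>

lemma run_edge:
  assumes "run h s a b" "a \<le> t" "t \<le> b" "a \<le> u" "u \<le> b" "u \<noteq> t"
  obtains a1 b1 where "a1 < b1" "seg h s a1 b1 \<in> interior_edges M" "a1 \<le> t" "t \<le> b1"
    "u < t \<Longrightarrow> a1 < t" "t < u \<Longrightarrow> t < b1"
proof -
  obtain E where E: "E \<subseteq> interior_edges M" "seg h s a b = \<Union>E" using assms(1) by (auto simp: run_def)
  have Ee: "E \<subseteq> edges M" using E(1) by (auto simp: interior_edges_def)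
  have fin: "finite E" using Ee finite_edges finite_subset by blast
  have "closed e" if "e \<in> edges M" for e
    using edgeE[OF that] compact_seg compact_imp_closed by metis
  then have "closed (\<Union>{e\<in>E. pt h t s \<notin> e})" using fin Ee by (intro closed_Union) auto
  then have "open (- \<Union>{e\<in>E. pt h t s \<notin> e})" by (simp add: open_Compl)
  moreover have "pt h t s \<in> - \<Union>{e\<in>E. pt h t s \<notin> e}" by auto
  ultimately obtain \<epsilon> where \<epsilon>: "\<epsilon> > 0" "ball (pt h t s) \<epsilon> \<subseteq> - \<Union>{e\<in>E. pt h t s \<notin> e}"
    using open_contains_ball by metis
  define t' where "t' = (if u < t then max u (t - \<epsilon> / 2) else min u (t + \<epsilon> / 2))"
  have t': "a \<le> t'" "t' \<le> b" "\<bar>t - t'\<bar> < \<epsilon>" "u < t \<Longrightarrow> t' < t" "t < u \<Longrightarrow> t < t'"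
    using assms \<epsilon>(1) by (auto simp: t'_def)
  have "pt h t' s \<in> seg h s a b" using t' by (simp add: seg_def)
  then obtain e where e: "e \<in> E" "pt h t' s \<in> e" using E(2) by auto
  have te: "pt h t s \<in> e"
  proof (rule ccontr)
    assume "pt h t s \<notin> e"
    moreover have "pt h t' s \<in> ball (pt h t s) \<epsilon>" using t'(3) by (simp add: dist_pt)
    ultimately show False using \<epsilon>(2) e by blast
  qed
  have "e \<in> edges M" using e(1) Ee by auto
  then obtain h1 s1 a1 b1 where e1: "a1 < b1" "e = seg h1 s1 a1 b1" by (rule edgeE)
  have "e \<subseteq> seg h s a b" using e(1) E(2) by auto
  then have hs: "h1 = h" "s1 = s" using seg_subset_seg(1,2)[OF e1(1)] e1(2) by auto
  have "a1 \<le> t" "t \<le> b1" "a1 \<le> t'" "t' \<le> b1" using te e(2) unfolding e1(2) hs by (simp_all add: seg_def)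
  moreover have "seg h s a1 b1 \<in> interior_edges M" using e(1) E(1) unfolding e1(2) hs by auto
  ultimately show thesis using that[of a1 b1] e1(1) t'(4,5) by linarith
qed

text \<open>Every quadrant at the point is served by a cell along the edge leaving in the matching
  direction, taken on the matching side.\<close>

lemma run_interior:
  assumes "run h s a b" "a < t" "t < b"
  shows "pt h t s \<in> interior \<Omega>"
proof (rule interior_of_quads)
  fix q
  define u where "u = (if q h then b else a)"
  have u: "a \<le> t" "t \<le> b" "a \<le> u" "u \<le> b" "u \<noteq> t" using assms(2,3) by (auto simp: u_def)
  obtain a1 b1 where e: "a1 < b1" "seg h s a1 b1 \<in> interior_edges M" "a1 \<le> t" "t \<le> b1"
    "u < t \<Longrightarrow> a1 < t" "t < u \<Longrightarrow> t < b1"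
    using run_edge[OF assms(1) u] by auto
  obtain K where K: "K \<in> M" "lob K h \<le> a1" "b1 \<le> hib K h" "lob K (\<not> h) \<le> s" "s \<le> hib K (\<not> h)"
    "if q (\<not> h) then s < hib K (\<not> h) else lob K (\<not> h) < s"
    using interior_edge_cell[OF e(2,1), of "q (\<not> h)"] by auto
  have "quad q K (pt h t s)"
    unfolding quad_def all_bool_iff[of _ h]
    using e(3-6) K(2-6) assms(2,3) by (auto simp: u_def split: if_splits)
  then show "\<exists>K\<in>M. quad q K (pt h t s)" using K(1) by blast
qed

lemma run_append:
  assumes "run h s a b" "run h s b c"
  shows "run h s a c"
proof -
  obtain E F where "E \<subseteq> interior_edges M" "seg h s a b = \<Union>E" "F \<subseteq> interior_edges M" "seg h s b c = \<Union>F"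
    and lt: "a < b" "b < c"
    using assms by (auto simp: run_def)
  moreover have "seg h s a c = seg h s a b \<union> seg h s b c" using lt by (auto simp: seg_def)
  ultimately have "E \<union> F \<subseteq> interior_edges M \<and> seg h s a c = \<Union>(E \<union> F)" by auto
  then show ?thesis unfolding run_def using lt by (intro conjI exI[of _ "E \<union> F"]) auto
qed

lemma run_single: "a < b \<Longrightarrow> seg h s a b \<in> interior_edges M \<Longrightarrow> run h s a b"
  unfolding run_def by (intro conjI exI[of _ "{seg h s a b}"]) auto

section \<open>Edges at a vertex and T-junctions\<close>

definition has_edge :: "bool \<Rightarrow> bool \<Rightarrow> real \<times> real \<Rightarrow> bool" where
  "has_edge h \<sigma> w \<longleftrightarrow> (\<exists>t>0. closed_segment w (dirpt h \<sigma> w t) \<in> edges M)"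

text \<open>The side of \<open>K\<close> leaving \<open>w\<close> in the given direction ends at a
  corner, at distance \<open>T\<close>. The nearest vertex on the way, at distance \<open>t\<close>,
  is the other end of the edge.\<close>

lemma has_edgeI:
  assumes "K \<in> M" "w \<in> K" "w \<in> vertices M"
    and side: "crd (\<not> h) w = lob K (\<not> h) \<or> crd (\<not> h) w = hib K (\<not> h)"
    and dir: "if \<sigma> then crd h w < hib K h else lob K h < crd h w"
  shows "has_edge h \<sigma> w"
proof -
  define X where "X = {t. t > 0 \<and> dirpt h \<sigma> w t \<in> vertices M}"
  define T where "T = (if \<sigma> then hib K h - crd h w else crd h w - lob K h)"
  have crd_T: "crd h (dirpt h \<sigma> w T) = (if \<sigma> then hib K h else lob K h)" by (simp add: T_def)
  have "dirpt h \<sigma> w T \<in> vertices M"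
    unfolding mem_vertices all_bool_iff[of _ h] crd_T crd_dirpt(2) using side assms(1) by auto
  then have T: "T \<in> X" using dir by (auto simp: X_def T_def split: if_splits)
  have "inj_on (dirpt h \<sigma> w) X" using dirpt_inject(3) by (auto simp: inj_on_def X_def)
  moreover have "finite (dirpt h \<sigma> w ` X)"
    by (rule finite_subset[OF _ finite_vertices]) (auto simp: X_def)
  ultimately have fin: "finite X" by (rule finite_imageD[rotated])
  define t where "t = Min X"
  have "t \<in> X" unfolding t_def using fin T by (intro Min_in) auto
  then have t: "t > 0" "dirpt h \<sigma> w t \<in> vertices M" by (auto simp: X_def)
  have min: "t \<le> u" if "u > 0" "dirpt h \<sigma> w u \<in> vertices M" for u
    unfolding t_def using that fin by (intro Min_le) (auto simp: X_def)
  have "t \<le> T" unfolding t_def using T fin by (intro Min_le)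
  have wK: "lob K h \<le> crd h w" "crd h w \<le> hib K h" "lob K (\<not> h) \<le> crd (\<not> h) w" "crd (\<not> h) w \<le> hib K (\<not> h)"
    using assms(2) mem_cell[OF assms(1)] by auto
  have sub: "closed_segment w (dirpt h \<sigma> w t) \<subseteq> (\<Union>K\<in>M. frontier K)"
  proof
    fix z assume "z \<in> closed_segment w (dirpt h \<sigma> w t)"
    then obtain u where u: "0 \<le> u" "u \<le> t" "z = dirpt h \<sigma> w u"
      using mem_closed_segment_dirpt[OF t(1)] by metis
    have zc: "crd h z = crd h w + (if \<sigma> then u else - u)" "crd (\<not> h) z = crd (\<not> h) w"
      unfolding u(3) by (rule crd_dirpt)+
    have "z \<in> K"
      unfolding mem_cell[OF assms(1)] all_bool_iff[of _ h] zc
      using wK u \<open>t \<le> T\<close> by (auto simp: T_def split: if_splits)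
    moreover have "z \<notin> interior K"
      unfolding mem_interior_cell[OF assms(1)] all_bool_iff[of _ h] zc using side by auto
    ultimately show "z \<in> (\<Union>K\<in>M. frontier K)" using frontier_cell[OF assms(1)] assms(1) by auto
  qed
  have "vertices M \<inter> closed_segment w (dirpt h \<sigma> w t) = {w, dirpt h \<sigma> w t}"
  proof (intro equalityI subsetI)
    fix z assume z: "z \<in> vertices M \<inter> closed_segment w (dirpt h \<sigma> w t)"
    then obtain u where u: "0 \<le> u" "u \<le> t" "z = dirpt h \<sigma> w u"
      using mem_closed_segment_dirpt[OF t(1)] by (metis IntD2)
    show "z \<in> {w, dirpt h \<sigma> w t}"
    proof (cases "u = 0")
      case True
      then have "z = w" unfolding u(3) dirpt_def by simp
      then show ?thesis by simp
    next
      case False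
      then have "t \<le> u" using u z by (intro min) auto
      then show ?thesis using u by auto
    qed
  qed (use assms(3) t(2) in auto)
  moreover have "w \<noteq> dirpt h \<sigma> w t" by (rule dirpt_neq[OF t(1), symmetric])
  ultimately have "closed_segment w (dirpt h \<sigma> w t) \<in> edges M"
    unfolding edges_def using sub axis_aligned_dirpt[of w h \<sigma> t]
    by blast
  then show ?thesis unfolding has_edge_def using t(1) by blast
qed

lemma edge_endpointsE:
  assumes "e \<in> edges M"
  obtains v w where "e = closed_segment v w" "v \<noteq> w" "axis_aligned v w" "vertices M \<inter> e = {v, w}"
  using assms unfolding edges_def by blast

lemma edge_end:
  assumes "closed_segment w u \<in> edges M"
  shows "vertices M \<inter> closed_segment w u = {w, u}"
proof -
  obtain v v' where v: "closed_segment w u = closed_segment v v'" "vertices M \<inter> closed_segment w u = {v, v'}"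
    using edge_endpointsE[OF assms] by metis
  then have "{w, u} = {v, v'}" by (simp only: closed_segment_eq)
  then show ?thesis using v(2) by simp
qed

lemma edge_dir_unique:
  assumes "t > 0" "t' > 0" "closed_segment w (dirpt h \<sigma> w t) \<in> edges M"
    "closed_segment w (dirpt h \<sigma> w t') \<in> edges M"
  shows "t \<le> t'"
proof (rule ccontr)
  assume "\<not> t \<le> t'"
  then have less: "t' < t" by simp
  have "dirpt h \<sigma> w t' \<in> vertices M" using edge_end[OF assms(4)] by auto
  moreover have "dirpt h \<sigma> w t' \<in> closed_segment w (dirpt h \<sigma> w t)"
    unfolding closed_segment_dirpt[OF assms(1)] using less assms(2)
    by (auto simp: seg_def)
  ultimately have "dirpt h \<sigma> w t' \<in> {w, dirpt h \<sigma> w t}" using edge_end[OF assms(3)] by blast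
  moreover have "dirpt h \<sigma> w t' \<noteq> w" by (rule dirpt_neq[OF assms(2)])
  ultimately have "dirpt h \<sigma> w t' = dirpt h \<sigma> w t" by simp
  from dirpt_inject(3)[OF assms(2,1) this] less show False by simp
qed

text \<open>An edge at \<open>w\<close> is determined by its direction, so the valence counts which
  of the four directions are occupied.\<close>

lemma valence_eq_card:
  assumes "w \<in> vertices M"
  shows "valence M w = card {(h, \<sigma>). has_edge h \<sigma> w}"
proof -
  define T where "T h \<sigma> = (SOME t. t > 0 \<and> closed_segment w (dirpt h \<sigma> w t) \<in> edges M)" for h \<sigma>
  have T: "T h \<sigma> > 0" "closed_segment w (dirpt h \<sigma> w (T h \<sigma>)) \<in> edges M" if "has_edge h \<sigma> w" for h \<sigma>
    using someI_ex[of "\<lambda>t. t > 0 \<and> closed_segment w (dirpt h \<sigma> w t) \<in> edges M"] that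
    unfolding has_edge_def T_def by auto
  let ?f = "\<lambda>(h, \<sigma>). closed_segment w (dirpt h \<sigma> w (T h \<sigma>))"
  have "{e \<in> edges M. w \<in> e} = ?f ` {(h, \<sigma>). has_edge h \<sigma> w}"
  proof (intro equalityI subsetI)
    fix e assume "e \<in> {e \<in> edges M. w \<in> e}"
    then have e: "e \<in> edges M" "w \<in> e" by auto
    from e(1) obtain v v' where v: "e = closed_segment v v'" "v \<noteq> v'" "axis_aligned v v'" "vertices M \<inter> e = {v, v'}"
      by (rule edge_endpointsE)
    have "w = v \<or> w = v'" using v(4) e(2) assms by blast
    then obtain u where u: "e = closed_segment w u" "u \<noteq> w" "axis_aligned w u"
    proof
      assume "w = v" then show thesis using that[of v'] v by simp
    next
      assume "w = v'" then show thesis 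
        using that[of v] v(1-3) axis_aligned_commute[of v v'] closed_segment_commute[of v v'] by simp
    qed
    obtain h \<sigma> t where t: "t > 0" "u = dirpt h \<sigma> w t" using dirpt_exists[OF u(2,3)] by metis
    then have he: "has_edge h \<sigma> w" unfolding has_edge_def using e(1) u(1) by blast
    have "t = T h \<sigma>"
      using edge_dir_unique[OF t(1) T(1)[OF he] _ T(2)[OF he]] edge_dir_unique[OF T(1)[OF he] t(1) T(2)[OF he]]
        e(1) u(1) t(2) by auto
    then show "e \<in> ?f ` {(h, \<sigma>). has_edge h \<sigma> w}"
      using he u(1) t(2) by (intro image_eqI[of _ _ "(h, \<sigma>)"]) auto
  next
    fix e assume "e \<in> ?f ` {(h, \<sigma>). has_edge h \<sigma> w}"
    then show "e \<in> {e \<in> edges M. w \<in> e}" using T(2) by auto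
  qed
  moreover have "inj_on ?f {(h, \<sigma>). has_edge h \<sigma> w}"
  proof (rule inj_onI, clarify)
    fix h \<sigma> h' \<sigma>'
    assume he: "has_edge h \<sigma> w" "has_edge h' \<sigma>' w"
      and "closed_segment w (dirpt h \<sigma> w (T h \<sigma>)) = closed_segment w (dirpt h' \<sigma>' w (T h' \<sigma>'))"
    then have "{w, dirpt h \<sigma> w (T h \<sigma>)} = {w, dirpt h' \<sigma>' w (T h' \<sigma>')}"
      by (simp only: closed_segment_eq)
    then have "dirpt h \<sigma> w (T h \<sigma>) = dirpt h' \<sigma>' w (T h' \<sigma>')" by (auto simp: doubleton_eq_iff)
    then show "h = h' \<and> \<sigma> = \<sigma>'" using dirpt_inject(1,2)[OF T(1)[OF he(1)] T(1)[OF he(2)]] by simp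
  qed
  ultimately show ?thesis unfolding valence_def by (simp add: card_image)
qed

text \<open>By \<open>has_edgeI\<close> a cell adjoining the missing direction cannot have a side
  along it, so it extends to both sides of it. The vertex \<open>w\<close> is not interior to the
  cell, hence lies on its perpendicular side, and the cell fills both quadrants adjoining the
  missing direction.\<close>

lemma missing_edge_cell:
  assumes "w \<in> interior_vertices M" "\<not> has_edge h \<sigma> w"
  obtains K where "K \<in> M" "w \<in> K" "lob K (\<not> h) < crd (\<not> h) w" "crd (\<not> h) w < hib K (\<not> h)"
    "if \<sigma> then crd h w = lob K h else crd h w = hib K h"
    "\<And>q. q h = \<sigma> \<Longrightarrow> quad q K w"
proof -
  have w: "w \<in> vertices M" "w \<in> interior \<Omega>" using assms(1) by (auto simp: interior_vertices_def)
  obtain K where K: "K \<in> M" "quad (\<lambda>_. \<sigma>) K w" using quad_exists[OF w(2)] by metis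
  have wK: "w \<in> K" using quad_mem K by blast
  have b: "lob K (\<not> h) \<le> crd (\<not> h) w" "crd (\<not> h) w \<le> hib K (\<not> h)" "lob K h \<le> crd h w" "crd h w \<le> hib K h"
    "if \<sigma> then crd h w < hib K h else lob K h < crd h w"
    using quad_bounds[OF K(2), of h] quad_bounds[OF K(2), of "\<not> h"] by auto
  have "crd (\<not> h) w \<noteq> lob K (\<not> h)" "crd (\<not> h) w \<noteq> hib K (\<not> h)"
    using has_edgeI[OF K(1) wK w(1) _ b(5)] assms(2) by auto
  then have s: "lob K (\<not> h) < crd (\<not> h) w" "crd (\<not> h) w < hib K (\<not> h)" using b by auto
  have "if \<sigma> then crd h w = lob K h else crd h w = hib K h"
    using vertex_notin_interior[OF w(1) K(1)] b s
    unfolding mem_interior_cell[OF K(1)] all_bool_iff[of _ h] by (auto split: if_splits)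
  moreover have "quad q K w" if "q h = \<sigma>" for q
    unfolding quad_def all_bool_iff[of _ h] using b s that by (auto split: if_splits)
  ultimately show thesis using that[OF K(1) wK s] by blast
qed

text \<open>The perpendicular side of the cell found by \<open>missing_edge_cell\<close> provides
  the two perpendicular edges. Were the opposite edge missing as well, two cells would fill all four
  quadrants, and \<open>w\<close> would be a corner of neither, although a vertex is a corner of
  some cell.\<close>

lemma other_edges:
  assumes "w \<in> interior_vertices M" "\<not> has_edge h \<sigma> w"
  shows "has_edge (\<not> h) \<tau> w" "has_edge h (\<not> \<sigma>) w"
proof -
  have w: "w \<in> vertices M" using assms(1) by (auto simp: interior_vertices_def)
  obtain K where K: "K \<in> M" "w \<in> K" "lob K (\<not> h) < crd (\<not> h) w" "crd (\<not> h) w < hib K (\<not> h)"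
    "if \<sigma> then crd h w = lob K h else crd h w = hib K h" "\<And>q. q h = \<sigma> \<Longrightarrow> quad q K w"
    using missing_edge_cell[OF assms] by metis
  show "has_edge (\<not> h) \<tau> w"
    using K(3-5) by (intro has_edgeI[OF K(1,2) w]) (auto split: if_splits)
  show "has_edge h (\<not> \<sigma>) w"
  proof (rule ccontr)
    assume "\<not> has_edge h (\<not> \<sigma>) w"
    then obtain K' where K': "K' \<in> M" "w \<in> K'" "lob K' (\<not> h) < crd (\<not> h) w" "crd (\<not> h) w < hib K' (\<not> h)"
      "\<And>q. q h = (\<not> \<sigma>) \<Longrightarrow> quad q K' w"
      using missing_edge_cell[OF assms(1)] by metis
    obtain K0 where K0: "K0 \<in> M" "\<And>h. crd h w = lob K0 h \<or> crd h w = hib K0 h"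
      using w unfolding mem_vertices by auto
    \<comment> \<open>The quadrant at \<open>w\<close> that is occupied by \<open>K0\<close>, the
      cell with corner \<open>w\<close>.\<close>
    define q where "q h \<longleftrightarrow> crd h w = lob K0 h" for h
    have "if q h then lob K0 h \<le> crd h w \<and> crd h w < hib K0 h
                          else lob K0 h < crd h w \<and> crd h w \<le> hib K0 h" for h
      using K0(2)[of h] lob_less_hib[OF K0(1), of h] by (auto simp: q_def)
    then have "quad q K0 w" unfolding quad_def by blast
    then have "K0 = K \<or> K0 = K'"
      using quad_unique[OF K0(1) K(1)] quad_unique[OF K0(1) K'(1)] K(6) K'(5) by (cases "q h = \<sigma>") auto
    then show False using K0(2)[of "\<not> h"] K(3,4) K'(3,4) by auto
  qed
qed

lemma T_junctionI:
  assumes "w \<in> interior_vertices M" "\<not> has_edge h \<sigma> w"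
  shows "w \<in> T_junctions M"
proof -
  have "has_edge h' \<sigma>' w \<longleftrightarrow> (h', \<sigma>') \<noteq> (h, \<sigma>)" for h' \<sigma>'
    using assms(2) other_edges[OF assms] by (cases "h' = h"; cases "\<sigma>' = \<sigma>") auto
  then have "{(h, \<sigma>). has_edge h \<sigma> w} = UNIV - {(h, \<sigma>)}" by auto
  then have "card {(h, \<sigma>). has_edge h \<sigma> w} = 3"
    by (simp add: card_Diff_singleton flip: UNIV_Times_UNIV)
  moreover have "w \<in> vertices M" using assms(1) by (auto simp: interior_vertices_def)
  ultimately show ?thesis unfolding T_junctions_def using assms(1) valence_eq_card by simp
qed

lemma edge_at_interior_vertex:
  assumes "w \<in> interior_vertices M" "e \<in> edges M" "w \<in> e"
  shows "e \<in> interior_edges M"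
  using assms frontier_domain by (auto simp: interior_edges_def interior_vertices_def)

lemma has_edge_run:
  assumes "w \<in> interior_vertices M" "has_edge h \<sigma> w"
  obtains t where "t > 0" "dirpt h \<sigma> w t \<in> vertices M"
    "if \<sigma> then run h (crd (\<not> h) w) (crd h w) (crd h w + t) else run h (crd (\<not> h) w) (crd h w - t) (crd h w)"
proof -
  obtain t where t: "t > 0" "closed_segment w (dirpt h \<sigma> w t) \<in> edges M"
    using assms(2) unfolding has_edge_def by blast
  have "closed_segment w (dirpt h \<sigma> w t) \<in> interior_edges M"
    using edge_at_interior_vertex[OF assms(1) t(2)] by simp
  then have "if \<sigma> then run h (crd (\<not> h) w) (crd h w) (crd h w + t) else run h (crd (\<not> h) w) (crd h w - t) (crd h w)"
    unfolding closed_segment_dirpt[OF t(1)] using t(1) by (auto intro: run_single)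
  moreover have "dirpt h \<sigma> w t \<in> vertices M" using edge_end[OF t(2)] by auto
  ultimately show thesis using that t(1) by blast
qed

section \<open>Existence and uniqueness of \<open>l\<close>-edges\<close>

lemma vertices_cases: "v \<in> vertices M \<Longrightarrow> v \<in> interior_vertices M \<or> v \<in> boundary_vertices M"
  using vertices_subset_domain frontier_domain by (auto simp: interior_vertices_def boundary_vertices_def)

text \<open>A longest run through \<open>w\<close> between vertices cannot be prolonged. At an
  interior end the next edge is therefore missing, which makes that end a T-junction.\<close>

lemma maximal_run_exists:
  assumes "w \<in> interior_vertices M"
  obtains a b where "run h (crd (\<not> h) w) a b" "a \<le> crd h w" "crd h w \<le> b"
    "pt h a (crd (\<not> h) w) \<in> T_junctions M \<union> boundary_vertices M"
    "pt h b (crd (\<not> h) w) \<in> T_junctions M \<union> boundary_vertices M"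
proof -
  define s where "s = crd (\<not> h) w"
  define X where "X = {(a, b). run h s a b \<and> a \<le> crd h w \<and> crd h w \<le> b \<and> pt h a s \<in> vertices M \<and> pt h b s \<in> vertices M}"
  have wv: "w \<in> vertices M" using assms by (auto simp: interior_vertices_def)
  have wpt: "pt h (crd h w) s = w" by (simp add: s_def)
  have "X \<subseteq> (\<lambda>v. crd h v) ` vertices M \<times> (\<lambda>v. crd h v) ` vertices M"
    unfolding X_def by (force simp: image_iff intro: crd_pt(1)[symmetric])
  then have fin: "finite X" by (rule finite_subset) (use finite_vertices in auto)
  have "X \<noteq> {}"
  proof -
    obtain \<sigma> where "has_edge h \<sigma> w" using other_edges(2)[OF assms] by blast
    then obtain t where t: "t > 0" "dirpt h \<sigma> w t \<in> vertices M"
      "if \<sigma> then run h s (crd h w) (crd h w + t) else run h s (crd h w - t) (crd h w)"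
      using has_edge_run[OF assms] unfolding s_def by metis
    have "(if \<sigma> then (crd h w, crd h w + t) else (crd h w - t, crd h w)) \<in> X"
      using t wv wpt unfolding X_def dirpt_def by (auto simp: s_def)
    then show ?thesis by auto
  qed
  define m where "m = Max ((\<lambda>(a, b). b - a) ` X)"
  have "m \<in> (\<lambda>(a, b). b - a) ` X" unfolding m_def using fin \<open>X \<noteq> {}\<close> by (intro Max_in) auto
  then obtain a b where ab: "(a, b) \<in> X" "m = b - a" by auto
  have max: "b' - a' \<le> b - a" if "(a', b') \<in> X" for a' b'
    unfolding ab(2)[symmetric] m_def using fin that by (intro Max_ge finite_imageI image_eqI[of _ _ "(a', b')"]) auto
  have r: "run h s a b" "a \<le> crd h w" "crd h w \<le> b" "pt h a s \<in> vertices M" "pt h b s \<in> vertices M"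
    using ab(1) by (auto simp: X_def)
  have "pt h a s \<in> T_junctions M \<union> boundary_vertices M"
  proof (cases "pt h a s \<in> interior_vertices M")
    case True
    have "\<not> has_edge h False (pt h a s)"
    proof
      assume "has_edge h False (pt h a s)"
      then obtain t where t: "t > 0" "dirpt h False (pt h a s) t \<in> vertices M" "run h s (a - t) a"
        using has_edge_run[OF True, of h False] by auto
      have "(a - t, b) \<in> X"
        unfolding X_def using r t run_append[OF t(3) r(1)] by (simp add: dirpt_def)
      then show False using max[of "a - t" b] t(1) by simp
    qed
    then show ?thesis using T_junctionI[OF True] by blast
  qed (use vertices_cases[OF r(4)] in auto)
  moreover have "pt h b s \<in> T_junctions M \<union> boundary_vertices M"
  proof (cases "pt h b s \<in> interior_vertices M")
    case True
    have "\<not> has_edge h True (pt h b s)"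
    proof
      assume "has_edge h True (pt h b s)"
      then obtain t where t: "t > 0" "dirpt h True (pt h b s) t \<in> vertices M" "run h s b (b + t)"
        using has_edge_run[OF True, of h True] by auto
      have "(a, b + t) \<in> X"
        unfolding X_def using r t run_append[OF r(1) t(3)] by (simp add: dirpt_def)
      then show False using max[of a "b + t"] t(1) by simp
    qed
    then show ?thesis using T_junctionI[OF True] by blast
  qed (use vertices_cases[OF r(5)] in auto)
  ultimately show thesis using that r(1-3) unfolding s_def by blast
qed

lemma edge_segmentI:
  assumes "run h s a b" "pt h a s \<in> T_junctions M \<union> boundary_vertices M" "pt h b s \<in> T_junctions M \<union> boundary_vertices M"
  shows "seg h s a b \<in> edge_segments M"
proof -
  have ab: "a < b" "\<exists>E \<subseteq> interior_edges M. seg h s a b = \<Union>E" using assms(1) by (auto simp: run_def)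
  have "has_endpoints (seg h s a b) (T_junctions M \<union> boundary_vertices M)"
    unfolding has_endpoints_def
    using ab(1) assms(2,3) closed_segment_pt[of a b h s] axis_aligned_pt[of h a s b]
    by (intro exI[of _ "pt h a s"] exI[of _ "pt h b s"]) simp
  then show ?thesis unfolding edge_segments_def using ab(2) by blast
qed

lemma edge_segmentE:
  assumes "l \<in> edge_segments M"
  obtains h s a b where "l = seg h s a b" "run h s a b" "pt h a s \<in> T_junctions M \<union> boundary_vertices M"
    "pt h b s \<in> T_junctions M \<union> boundary_vertices M"
proof -
  obtain v w where vw: "v \<noteq> w" "axis_aligned v w" "l = closed_segment v w"
      "v \<in> T_junctions M \<union> boundary_vertices M" "w \<in> T_junctions M \<union> boundary_vertices M"
    and E: "\<exists>E \<subseteq> interior_edges M. l = \<Union>E"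
    using assms unfolding edge_segments_def has_endpoints_def by blast
  obtain h s a b where ab: "a < b" "closed_segment v w = seg h s a b" "{v, w} = {pt h a s, pt h b s}"
    using axis_segment[OF vw(1,2)] by metis
  have "pt h a s \<in> {v, w}" "pt h b s \<in> {v, w}" unfolding ab(3) by auto
  then have "pt h a s \<in> T_junctions M \<union> boundary_vertices M" "pt h b s \<in> T_junctions M \<union> boundary_vertices M"
    using vw(4,5) by auto
  moreover have "run h s a b" unfolding run_def using ab(1,2) E vw(3) by simp
  ultimately show thesis using that[of h s a b] ab(2) vw(3) by simp
qed

lemma TB_subset_vertices: "T_junctions M \<union> boundary_vertices M \<subseteq> vertices M"
  by (auto simp: T_junctions_def interior_vertices_def boundary_vertices_def)

lemma finite_edge_segments: "finite (edge_segments M)"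
proof -
  have "edge_segments M \<subseteq> (\<lambda>(v, w). closed_segment v w) ` (vertices M \<times> vertices M)"
    unfolding edge_segments_def has_endpoints_def using TB_subset_vertices by blast
  then show ?thesis by (rule finite_subset) (use finite_vertices in auto)
qed

lemma finite_interior_l_edges: "finite (interior_l_edges M)"
  using finite_edge_segments by (auto simp: interior_l_edges_def)

lemma l_edge_exists:
  assumes "w \<in> interior_vertices M"
  obtains s a b where "seg h s a b \<in> interior_l_edges M" "w \<in> seg h s a b" "a < b"
proof -
  obtain a b where ab: "run h (crd (\<not> h) w) a b" "a \<le> crd h w" "crd h w \<le> b"
    "pt h a (crd (\<not> h) w) \<in> T_junctions M \<union> boundary_vertices M"
    "pt h b (crd (\<not> h) w) \<in> T_junctions M \<union> boundary_vertices M"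
    using maximal_run_exists[OF assms] by metis
  let ?l = "seg h (crd (\<not> h) w) a b"
  have "?l \<in> edge_segments M" using edge_segmentI ab by blast
  then obtain l where l: "l \<in> edge_segments M" "?l \<subseteq> l" "\<forall>l'\<in>edge_segments M. l \<subseteq> l' \<longrightarrow> l = l'"
    using finite_has_maximal2[OF finite_edge_segments] by metis
  have li: "l \<in> interior_l_edges M" unfolding interior_l_edges_def using l by auto
  obtain h' s' a' b' where l': "l = seg h' s' a' b'" "run h' s' a' b'" using edge_segmentE[OF l(1)] by metis
  have "a < b" using ab(1) by (simp add: run_def)
  then have hh: "h = h'" using seg_subset_seg(1)[of a b] l(2) l'(1) by blast
  have "w \<in> ?l" using ab by (simp add: seg_def)
  then have "w \<in> seg h s' a' b'" using l(2) l'(1) hh by auto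
  moreover have "a' < b'" using l'(2) by (simp add: run_def)
  ultimately show thesis using that[of s' a' b'] li l'(1) hh by simp
qed

lemma l_edge_run:
  assumes "seg h s a b \<in> interior_l_edges M" "a < b"
  shows "run h s a b" "pt h a s \<in> T_junctions M \<union> boundary_vertices M"
    "pt h b s \<in> T_junctions M \<union> boundary_vertices M"
proof -
  have "seg h s a b \<in> edge_segments M" using assms(1) by (simp add: interior_l_edges_def)
  then obtain h' s' a' b' where *: "seg h s a b = seg h' s' a' b'" "run h' s' a' b'"
    "pt h' a' s' \<in> T_junctions M \<union> boundary_vertices M" "pt h' b' s' \<in> T_junctions M \<union> boundary_vertices M"
    using edge_segmentE by metis
  have "a' < b'" using *(2) by (simp add: run_def)
  note eq = seg_eq_seg[OF assms(2) this *(1)]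
  show "run h s a b" "pt h a s \<in> T_junctions M \<union> boundary_vertices M"
    "pt h b s \<in> T_junctions M \<union> boundary_vertices M"
    using *(2-4) unfolding eq by auto
qed

lemma l_edge_seg:
  assumes "l \<in> interior_l_edges M"
  obtains h s a b where "l = seg h s a b" "a < b"
proof -
  have "l \<in> edge_segments M" using assms by (simp add: interior_l_edges_def)
  then obtain h s a b where "l = seg h s a b" "run h s a b" by (rule edge_segmentE)
  then show thesis using that by (simp add: run_def)
qed

text \<open>Collinear \<open>l\<close>-edges with a common point, possibly just an end, have a union
  that is again an admissible segment; by maximality both equal it.\<close>

lemma l_edges_disjoint:
  assumes "seg h s1 a1 b1 \<in> interior_l_edges M" "a1 < b1" "seg h s2 a2 b2 \<in> interior_l_edges M" "a2 < b2"
    and "z \<in> seg h s1 a1 b1" "z \<in> seg h s2 a2 b2"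
  shows "seg h s1 a1 b1 = seg h s2 a2 b2"
proof -
  have s: "s2 = s1" using assms(5,6) by (simp add: seg_def)
  note r1 = l_edge_run[OF assms(1,2)] and r2 = l_edge_run[OF assms(3,4), unfolded s]
  obtain E1 E2 where E: "E1 \<subseteq> interior_edges M" "seg h s1 a1 b1 = \<Union>E1" "E2 \<subseteq> interior_edges M" "seg h s1 a2 b2 = \<Union>E2"
    using r1(1) r2(1) unfolding run_def by blast
  let ?u = "seg h s1 (min a1 a2) (max b1 b2)"
  have un: "?u = seg h s1 a1 b1 \<union> seg h s1 a2 b2"
    using assms(5,6) unfolding s by (auto simp: seg_def min_def max_def split: if_splits)
  have "?u = \<Union>(E1 \<union> E2)" unfolding un E(2,4) by auto
  moreover have "min a1 a2 < max b1 b2" using assms(2) by auto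
  ultimately have "run h s1 (min a1 a2) (max b1 b2)"
    unfolding run_def using E(1,3) by (intro conjI exI[of _ "E1 \<union> E2"]) auto
  moreover have "pt h (min a1 a2) s1 \<in> T_junctions M \<union> boundary_vertices M"
    using r1(2) r2(2) unfolding min_def by (simp split: if_split)
  moreover have "pt h (max b1 b2) s1 \<in> T_junctions M \<union> boundary_vertices M"
    using r1(3) r2(3) unfolding max_def by (simp split: if_split)
  ultimately have "?u \<in> edge_segments M" by (rule edge_segmentI)
  moreover have "seg h s1 a1 b1 \<subseteq> ?u" "seg h s1 a2 b2 \<subseteq> ?u" unfolding un by auto
  moreover have "\<forall>l'\<in>edge_segments M. seg h s1 a1 b1 \<subseteq> l' \<longrightarrow> l' = seg h s1 a1 b1"
    "\<forall>l'\<in>edge_segments M. seg h s1 a2 b2 \<subseteq> l' \<longrightarrow> l' = seg h s1 a2 b2"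
    using assms(1,3) unfolding s interior_l_edges_def by auto
  ultimately show ?thesis unfolding s by blast
qed

text \<open>Any point \<open>w\<close> outside the domain within the grid margin of \<open>e\<close>
  will do: a cell containing a point of the segment other than \<open>e\<close> reaches at least
  \<open>\<delta>\<close> beyond \<open>e\<close> in each coordinate in which the segment moves, and
  so contains \<open>w\<close>.\<close>

lemma frontier_accessible:
  assumes "e \<in> frontier \<Omega>"
  obtains w where "w \<notin> \<Omega>" "closed_segment e w \<inter> \<Omega> \<subseteq> {e}"
proof -
  obtain \<delta> where \<delta>: "\<delta> > 0" "\<And>K h. K \<in> M \<Longrightarrow> lob K h \<noteq> crd h e \<Longrightarrow> \<delta> \<le> \<bar>lob K h - crd h e\<bar>"
    "\<And>K h. K \<in> M \<Longrightarrow> hib K h \<noteq> crd h e \<Longrightarrow> \<delta> \<le> \<bar>hib K h - crd h e\<bar>"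
    using grid_margin by metis
  have "\<not> ball e \<delta> \<subseteq> \<Omega>" using assms frontier_domain \<delta>(1) mem_interior by blast
  then obtain w where w: "w \<in> ball e \<delta>" "w \<notin> \<Omega>" by blast
  have "z = e" if z: "z \<in> closed_segment e w" "z \<in> \<Omega>" for z
  proof (rule ccontr)
    assume "z \<noteq> e"
    obtain c where c: "0 \<le> c" "c \<le> 1" "z = (1 - c) *\<^sub>R e + c *\<^sub>R w"
      using z(1) unfolding closed_segment_def by auto
    have "c \<noteq> 0" using c(3) \<open>z \<noteq> e\<close> by auto
    then have pos: "c > 0" using c(1) by simp
    obtain K where K: "K \<in> M" "z \<in> K" using z(2) mem_domain by blast
    have "lob K h \<le> crd h w \<and> crd h w \<le> hib K h" for h
    proof -
      define D where "D = crd h w - crd h e"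
      have zc: "crd h z = crd h e + c * D"
        unfolding c(3) D_def by (cases h) (auto simp: algebra_simps)
      have D: "\<bar>D\<bar> < \<delta>" using abs_crd_le_dist[of h w e] w(1) unfolding D_def by (simp add: dist_commute)
      have zK: "lob K h \<le> crd h z" "crd h z \<le> hib K h" using mem_cell[OF K(1)] K(2) by auto
      have lD: "D \<ge> 0 \<Longrightarrow> 0 \<le> c * D \<and> c * D \<le> D" "D \<le> 0 \<Longrightarrow> D \<le> c * D \<and> c * D \<le> 0"
        "D > 0 \<Longrightarrow> c * D > 0" "D < 0 \<Longrightarrow> c * D < 0"
        using c(1,2) pos mult_left_le_one_le[of D c] mult_left_le_one_le[of "- D" c]
        by (auto simp: mult_nonneg_nonpos mult_pos_neg)
      have w_eq: "crd h w = crd h e + D" by (simp add: D_def)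
      consider "D = 0" | "D > 0" | "D < 0" by linarith
      then show ?thesis
      proof cases
        case 1
        then show ?thesis using zK unfolding zc w_eq by simp
      next
        case 2
        then have "crd h e < hib K h" using zK(2) lD(3) unfolding zc by linarith
        then have "\<delta> \<le> hib K h - crd h e" using \<delta>(3)[OF K(1), of h] by auto
        moreover have "c * D \<le> D" using lD(1) 2 by simp
        ultimately show ?thesis using zK 2 D unfolding zc w_eq by linarith
      next
        case 3
        then have "lob K h < crd h e" using zK(1) lD(4) unfolding zc by linarith
        then have "\<delta> \<le> crd h e - lob K h" using \<delta>(2)[OF K(1), of h] by auto
        moreover have "D \<le> c * D" using lD(2) 3 by simp
        ultimately show ?thesis using zK 3 D unfolding zc w_eq by linarith
      qed
    qed
    then have "w \<in> K" using mem_cell[OF K(1)] by blast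
    then show False using w(2) K(1) mem_domain by blast
  qed
  then show thesis using that[OF w(2)] by blast
qed

section \<open>Rays from a point to the boundary\<close>

definition starts :: "bool \<Rightarrow> real \<times> real \<Rightarrow> bool" where
  "starts h p \<longleftrightarrow> (\<exists>u>crd h p. \<forall>t. crd h p < t \<and> t < u \<longrightarrow> pt h t (crd (\<not> h) p) \<in> interior \<Omega>)"

definition sees :: "bool \<Rightarrow> real \<times> real \<Rightarrow> real \<times> real \<Rightarrow> bool" where
  "sees h p z \<longleftrightarrow> crd (\<not> h) z = crd (\<not> h) p \<and> crd h p < crd h z \<and>
     (\<forall>t. crd h p < t \<and> t \<le> crd h z \<longrightarrow> pt h t (crd (\<not> h) p) \<in> interior \<Omega>)"

lemma hit_exists:
  assumes "starts h p"
  obtains e where "crd h p < e" "pt h e (crd (\<not> h) p) \<in> frontier \<Omega>"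
    "\<And>t. crd h p < t \<Longrightarrow> t < e \<Longrightarrow> pt h t (crd (\<not> h) p) \<in> interior \<Omega>"
proof -
  define s where "s = crd (\<not> h) p"
  obtain u where u: "crd h p < u" "\<And>t. crd h p < t \<Longrightarrow> t < u \<Longrightarrow> pt h t s \<in> interior \<Omega>"
    using assms unfolding starts_def s_def by blast
  \<comment> \<open>The search for the first exit begins at \<open>u\<close>, beyond
    \<open>p\<close>: since \<open>p\<close> may lie on the frontier, the infimum could otherwise be
    \<open>p\<close> itself.\<close>
  define U where "U = {u..} \<inter> (\<lambda>t. pt h t s) -` (- interior \<Omega>)"
  have cont: "continuous_on UNIV (\<lambda>t. pt h t s)" by (intro continuous_intros)
  have "closed U" unfolding U_def
    by (intro closed_Int closed_atLeast closed_vimage closed_Compl open_interior cont)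
  moreover have "U \<noteq> {}"
  proof
    assume "U = {}"
    obtain B where B: "\<And>z. z \<in> \<Omega> \<Longrightarrow> norm z \<le> B"
      using compact_domain compact_imp_bounded bounded_iff by metis
    define t where "t = max u (B + 1)"
    have "t \<notin> U" using \<open>U = {}\<close> by simp
    then have "pt h t s \<in> interior \<Omega>" by (auto simp: U_def t_def)
    then have "norm (pt h t s) \<le> B" using B interior_subset by blast
    moreover have "\<bar>crd h (pt h t s) - crd h 0\<bar> \<le> dist (pt h t s) 0" by (rule abs_crd_le_dist)
    moreover have "crd h 0 = 0" by (cases h) auto
    ultimately have "\<bar>t\<bar> \<le> B" by (simp add: dist_norm)
    then show False by (simp add: t_def)
  qed
  moreover have bdd: "bdd_below U" unfolding U_def by (intro bdd_belowI[of _ u]) auto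
  ultimately have Inf: "Inf U \<in> U" using closed_contains_Inf by blast
  define e where "e = Inf U"
  have e: "u \<le> e" "pt h e s \<notin> interior \<Omega>" using Inf by (auto simp: U_def e_def)
  have int: "pt h t s \<in> interior \<Omega>" if "crd h p < t" "t < e" for t
  proof (cases "t < u")
    case True then show ?thesis using u(2) that by blast
  next
    case False
    have "t \<notin> U" using that(2) cInf_lower[OF _ bdd, of t] unfolding e_def by auto
    then show ?thesis using False by (auto simp: U_def)
  qed
  have "crd h p < e" using e(1) u(1) by simp
  have "pt h e s \<in> closure \<Omega>"
  proof (rule ccontr)
    assume "pt h e s \<notin> closure \<Omega>"
    then obtain \<epsilon> where \<epsilon>: "\<epsilon> > 0" "ball (pt h e s) \<epsilon> \<subseteq> - closure \<Omega>"
      using open_contains_ball[of "- closure \<Omega>"] by auto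
    define t where "t = max ((crd h p + e) / 2) (e - \<epsilon> / 2)"
    have "pt h t s \<in> interior \<Omega>" using \<open>crd h p < e\<close> \<epsilon>(1) by (intro int) (auto simp: t_def less_max_iff_disj field_simps)
    moreover have "pt h t s \<in> ball (pt h e s) \<epsilon>"
      using \<open>crd h p < e\<close> \<epsilon>(1) by (auto simp: dist_pt t_def)
    ultimately show False using \<epsilon>(2) interior_subset closure_subset by blast
  qed
  then have "pt h e s \<in> frontier \<Omega>" unfolding frontier_def using e(2) by blast
  then show thesis using that[of e] \<open>crd h p < e\<close> int unfolding s_def by blast
qed

text \<open>If a leg is missing, the path from the outside to \<open>p\<close> is closed up by leaving the domain at \<open>p\<close> itself.\<close>

lemma domain_cut:
  assumes legs: "legs \<noteq> {}" "\<And>h. h \<in> legs \<Longrightarrow> starts h p" "\<And>h. h \<notin> legs \<Longrightarrow> p \<in> frontier \<Omega>"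
  obtains \<kappa> :: "real \<times> real \<Rightarrow> real" and L
  where "\<exists>B. \<forall>z\<in>\<Omega>. \<bar>\<kappa> z\<bar> \<le> B"
    and "\<And>z. z \<in> \<Omega> \<Longrightarrow> z \<notin> L \<Longrightarrow> \<exists>r>0. \<exists>c. \<forall>z'\<in>\<Omega> \<inter> ball z r. \<kappa> z' = c"
    and "\<And>z. z \<in> L \<Longrightarrow> \<exists>h\<in>legs. crd (\<not> h) z = crd (\<not> h) p"
    and "\<And>z. z \<in> interior \<Omega> \<Longrightarrow> z \<noteq> p \<Longrightarrow> (\<And>h. h \<in> legs \<Longrightarrow> \<not> sees h p z) \<Longrightarrow> z \<notin> L"
    and "\<And>h z. h \<in> legs \<Longrightarrow> sees h p z \<Longrightarrow>
           \<exists>r>0. \<exists>c. \<forall>z'\<in>\<Omega> \<inter> ball z r.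
             (crd (\<not> h) z' > crd (\<not> h) z \<longrightarrow> \<kappa> z' = c + 1) \<and> (crd (\<not> h) z' < crd (\<not> h) z \<longrightarrow> \<kappa> z' = c)"
proof -
  have "\<exists>e. crd h p \<le> e \<and> pt h e (crd (\<not> h) p) \<in> frontier \<Omega> \<and>
      (\<forall>t. crd h p < t \<and> t < e \<longrightarrow> pt h t (crd (\<not> h) p) \<in> interior \<Omega>) \<and> (h \<notin> legs \<longrightarrow> e = crd h p) \<and> (h \<in> legs \<longrightarrow> crd h p < e)" for h
  proof (cases "h \<in> legs")
    case True
    then show ?thesis using hit_exists[OF legs(2)[OF True]] by (metis less_imp_le)
  next
    case False
    then show ?thesis using legs(3)[OF False] by (intro exI[of _ "crd h p"]) auto
  qed
  then obtain e where e: "\<And>h. crd h p \<le> e h" "\<And>h. pt h (e h) (crd (\<not> h) p) \<in> frontier \<Omega>"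
    "\<And>h t. crd h p < t \<Longrightarrow> t < e h \<Longrightarrow> pt h t (crd (\<not> h) p) \<in> interior \<Omega>"
    "\<And>h. h \<notin> legs \<Longrightarrow> e h = crd h p" "\<And>h. h \<in> legs \<Longrightarrow> crd h p < e h" by metis
  have "\<exists>w. w \<notin> \<Omega> \<and> closed_segment (pt h (e h) (crd (\<not> h) p)) w \<inter> \<Omega> \<subseteq> {pt h (e h) (crd (\<not> h) p)}" for h
    using frontier_accessible[OF e(2)[of h]] by metis
  then obtain w where w: "\<And>h. w h \<notin> \<Omega>"
    "\<And>h. closed_segment (pt h (e h) (crd (\<not> h) p)) (w h) \<inter> \<Omega> \<subseteq> {pt h (e h) (crd (\<not> h) p)}" by metis
  show thesis
  proof (rule cut_function[OF compact_domain simply_connected_domain locally_path_connected_domain e(1) w])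
    fix \<kappa> :: "real \<times> real \<Rightarrow> real"
    assume \<kappa>: "\<exists>B. \<forall>z\<in>\<Omega>. \<bar>\<kappa> z\<bar> \<le> B"
      "\<And>z. z \<in> \<Omega> \<Longrightarrow> (\<And>h. z \<notin> leg h p (e h)) \<Longrightarrow> \<exists>r>0. \<exists>c. \<forall>z'\<in>\<Omega> \<inter> ball z r. \<kappa> z' = c"
      "\<And>h z. z \<in> \<Omega> \<Longrightarrow> crd (\<not> h) z = crd (\<not> h) p \<Longrightarrow> crd h p < crd h z \<Longrightarrow> crd h z < e h \<Longrightarrow>
             \<exists>r>0. \<exists>c. \<forall>z'\<in>\<Omega> \<inter> ball z r.
               (crd (\<not> h) z' > crd (\<not> h) z \<longrightarrow> \<kappa> z' = c + 1) \<and> (crd (\<not> h) z' < crd (\<not> h) z \<longrightarrow> \<kappa> z' = c)"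
    define L where "L = (\<Union>h. leg h p (e h))"
    have p_leg: "z = p" if "h \<notin> legs" "z \<in> leg h p (e h)" for h z
      using that(2) e(4)[OF that(1)] unfolding leg_def seg_def point_eq_iff[of z p h] by auto
    show thesis
    proof (rule that[of \<kappa> L])
      show "\<exists>B. \<forall>z\<in>\<Omega>. \<bar>\<kappa> z\<bar> \<le> B" by (rule \<kappa>(1))
      show "\<exists>r>0. \<exists>c. \<forall>z'\<in>\<Omega> \<inter> ball z r. \<kappa> z' = c" if "z \<in> \<Omega>" "z \<notin> L" for z
        using that by (intro \<kappa>(2)) (auto simp: L_def)
      show "\<exists>h\<in>legs. crd (\<not> h) z = crd (\<not> h) p" if "z \<in> L" for z
      proof -
        obtain h where h: "z \<in> leg h p (e h)" using \<open>z \<in> L\<close> unfolding L_def by blast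
        show ?thesis
        proof (cases "h \<in> legs")
          case True
          then show ?thesis using h by (auto simp: leg_def seg_def)
        next
          case False
          then have "z = p" using p_leg h by blast
          then show ?thesis using legs(1) by auto
        qed
      qed
      \<comment> \<open>A point of a leg is the start, the far end on the frontier, or seen from
        \<open>p\<close>; all three are excluded for \<open>z\<close>.\<close>
      show "z \<notin> L" if z: "z \<in> interior \<Omega>" "z \<noteq> p" "\<And>h. h \<in> legs \<Longrightarrow> \<not> sees h p z" for z
      proof
        assume "z \<in> L"
        then obtain h where h: "z \<in> leg h p (e h)" unfolding L_def by blast
        then have "h \<in> legs" using p_leg z(2) by blast
        have zc: "crd (\<not> h) z = crd (\<not> h) p" "crd h p \<le> crd h z" "crd h z \<le> e h"
          using h by (auto simp: leg_def seg_def)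
        have "crd h z \<noteq> crd h p" using zc(1) z(2) point_eq_iff by metis
        moreover have "crd h z \<noteq> e h"
        proof
          assume "crd h z = e h"
          then have "z = pt h (e h) (crd (\<not> h) p)" using zc(1) pt_crd by metis
          then show False using z(1) e(2)[of h] frontier_domain by blast
        qed
        ultimately have "sees h p z" unfolding sees_def using zc e(3) by auto
        then show False using z(3) \<open>h \<in> legs\<close> by blast
      qed
      show "\<exists>r>0. \<exists>c. \<forall>z'\<in>\<Omega> \<inter> ball z r.
          (crd (\<not> h) z' > crd (\<not> h) z \<longrightarrow> \<kappa> z' = c + 1) \<and> (crd (\<not> h) z' < crd (\<not> h) z \<longrightarrow> \<kappa> z' = c)"
        if "h \<in> legs" "sees h p z" for h z
      proof -
        have zc: "crd (\<not> h) z = crd (\<not> h) p" "crd h p < crd h z"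
          and int: "\<And>t. crd h p < t \<Longrightarrow> t \<le> crd h z \<Longrightarrow> pt h t (crd (\<not> h) p) \<in> interior \<Omega>"
          using that(2) unfolding sees_def by auto
        have "pt h (crd h z) (crd (\<not> h) p) = z" using zc(1) pt_crd by metis
        then have "z \<in> \<Omega>" using int[of "crd h z"] zc(2) interior_subset by auto
        moreover have "crd h z < e h"
        proof (rule ccontr)
          assume "\<not> crd h z < e h"
          moreover have "crd h p < e h" using e(5)[OF that(1)] .
          ultimately have "pt h (e h) (crd (\<not> h) p) \<in> interior \<Omega>" using int by simp
          then show False using e(2)[of h] frontier_domain by blast
        qed
        ultimately show ?thesis using \<kappa>(3) zc by blast
      qed
    qed
  qed
qed

end

section \<open>Truncated powers on the domain\<close>

text \<open>An \<open>l\<close>-edge is a bare point set; its direction and its ends are recovered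
  by choice and are unique for a non-degenerate segment.\<close>

definition ori :: "(real \<times> real) set \<Rightarrow> bool" where
  "ori l = (SOME h. \<exists>s a b. a < b \<and> l = seg h s a b)"

definition low :: "(real \<times> real) set \<Rightarrow> real \<times> real" where
  "low l = (SOME p. \<exists>h s a b. a < b \<and> l = seg h s a b \<and> p = pt h a s)"

definition high :: "(real \<times> real) set \<Rightarrow> real \<times> real" where
  "high l = (SOME p. \<exists>h s a b. a < b \<and> l = seg h s a b \<and> p = pt h b s)"

lemma ori_low_high:
  assumes "a < b"
  shows "ori (seg h s a b) = h" "low (seg h s a b) = pt h a s" "high (seg h s a b) = pt h b s"
proof -
  show "ori (seg h s a b) = h"
    unfolding ori_def
    by (rule some_equality) (use assms in \<open>auto dest: seg_eq_seg(1)[OF assms]\<close>)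
  show "low (seg h s a b) = pt h a s"
    unfolding low_def
  proof (rule some_equality)
    fix p assume "\<exists>h' s' a' b'. a' < b' \<and> seg h s a b = seg h' s' a' b' \<and> p = pt h' a' s'"
    then obtain h' s' a' b' where *: "a' < b'" "seg h s a b = seg h' s' a' b'" "p = pt h' a' s'" by blast
    show "p = pt h a s" using seg_eq_seg[OF assms *(1,2)] *(3) by simp
  qed (use assms in blast)
  show "high (seg h s a b) = pt h b s"
    unfolding high_def
  proof (rule some_equality)
    fix p assume "\<exists>h' s' a' b'. a' < b' \<and> seg h s a b = seg h' s' a' b' \<and> p = pt h' b' s'"
    then obtain h' s' a' b' where *: "a' < b'" "seg h s a b = seg h' s' a' b'" "p = pt h' b' s'" by blast
    show "p = pt h b s" using seg_eq_seg[OF assms *(1,2)] *(3) by simp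
  qed (use assms in blast)
qed

text \<open>Names of the functions rather than the functions, so that coefficients can be assigned
  before linear independence is known.\<close>

datatype generator = Mono nat nat | Vert "real \<times> real" | Edge "(real \<times> real) set" nat

fun start :: "generator \<Rightarrow> real \<times> real" where
  "start (Mono i j) = 0" | "start (Vert v) = v" | "start (Edge l j) = low l"

fun legs :: "generator \<Rightarrow> bool set" where
  "legs (Mono i j) = {}" | "legs (Vert v) = UNIV" | "legs (Edge l j) = {ori l}"

fun factor :: "nat \<Rightarrow> generator \<Rightarrow> bool \<Rightarrow> real poly" where
  "factor d (Mono i j) h = monom 1 (if h then i else j)"
| "factor d (Vert v) h = [:- crd h v, 1:] ^ d"
| "factor d (Edge l j) h = (if h = ori l then monom 1 j else [:- crd h (low l), 1:] ^ d)"

definition gpoly :: "nat \<Rightarrow> generator \<Rightarrow> real \<times> real \<Rightarrow> real" where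
  "gpoly d g z = poly (factor d g True) (fst z) * poly (factor d g False) (snd z)"

lemma gpoly_crd: "gpoly d g z = poly (factor d g h) (crd h z) * poly (factor d g (\<not> h)) (crd (\<not> h) z)"
  by (cases h) (auto simp: gpoly_def)

lemma factor_leg: "h \<in> legs g \<Longrightarrow> factor d g (\<not> h) = [:- crd (\<not> h) (start g), 1:] ^ d"
  by (cases g) auto

locale spline = mesh +
  fixes d :: nat
  assumes d: "d \<ge> 1"
begin

definition low_edges where "low_edges = {l \<in> interior_l_edges M. low l \<in> frontier \<Omega>}"

definition high_edges where "high_edges = {l \<in> interior_l_edges M. high l \<notin> frontier \<Omega>}"

definition generators where
  "generators = (\<lambda>(i, j). Mono i j) ` ({..d} \<times> {..d}) \<union> Vert ` interior_vertices M \<union>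
     (\<lambda>(l, j). Edge l j) ` (low_edges \<times> {..d})"

section \<open>Ends of \<open>l\<close>-edges and starts of the functions\<close>

lemma l_edge_decompose:
  assumes "l \<in> interior_l_edges M"
  shows "l = seg (ori l) (crd (\<not> ori l) (low l)) (crd (ori l) (low l)) (crd (ori l) (high l))"
    "crd (ori l) (low l) < crd (ori l) (high l)" "crd (\<not> ori l) (high l) = crd (\<not> ori l) (low l)"
proof -
  obtain h s a b where l: "l = seg h s a b" "a < b" using l_edge_seg[OF assms] .
  have eqs: "ori l = h" "low l = pt h a s" "high l = pt h b s"
    unfolding l(1) by (rule ori_low_high[OF l(2)])+
  show "l = seg (ori l) (crd (\<not> ori l) (low l)) (crd (ori l) (low l)) (crd (ori l) (high l))"
    unfolding eqs crd_pt by (rule l(1))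
  show "crd (ori l) (low l) < crd (ori l) (high l)" unfolding eqs crd_pt by (rule l(2))
  show "crd (\<not> ori l) (high l) = crd (\<not> ori l) (low l)" unfolding eqs crd_pt ..
qed

lemma mem_l_edge:
  assumes "l \<in> interior_l_edges M"
  shows "z \<in> l \<longleftrightarrow> crd (\<not> ori l) z = crd (\<not> ori l) (low l) \<and> crd (ori l) (low l) \<le> crd (ori l) z \<and>
    crd (ori l) z \<le> crd (ori l) (high l)"
  by (subst l_edge_decompose(1)[OF assms]) (simp add: seg_def)

lemma low_high_in_l_edge:
  assumes "l \<in> interior_l_edges M"
  shows "low l \<in> l" "high l \<in> l"
  unfolding mem_l_edge[OF assms] using l_edge_decompose(2,3)[OF assms] by auto

lemma l_edge_ends:
  assumes "l \<in> interior_l_edges M"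
  shows "low l \<in> T_junctions M \<union> boundary_vertices M" "high l \<in> T_junctions M \<union> boundary_vertices M"
    "crd (ori l) (low l) < t \<Longrightarrow> t < crd (ori l) (high l) \<Longrightarrow> pt (ori l) t (crd (\<not> ori l) (low l)) \<in> interior \<Omega>"
proof -
  note l = l_edge_decompose[OF assms]
  have "seg (ori l) (crd (\<not> ori l) (low l)) (crd (ori l) (low l)) (crd (ori l) (high l)) \<in> interior_l_edges M"
    using assms l(1) by simp
  note r = l_edge_run[OF this l(2)]
  show "low l \<in> T_junctions M \<union> boundary_vertices M" using r(2) by simp
  show "high l \<in> T_junctions M \<union> boundary_vertices M" using r(3) unfolding l(3)[symmetric] by simp
  show "pt (ori l) t (crd (\<not> ori l) (low l)) \<in> interior \<Omega>"
    if "crd (ori l) (low l) < t" "t < crd (ori l) (high l)"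
    using run_interior[OF r(1) that] .
qed

lemma l_edge_unique:
  assumes "l \<in> interior_l_edges M" "l' \<in> interior_l_edges M" "ori l = ori l'" "z \<in> l" "z \<in> l'"
  shows "l = l'"
proof -
  define h where "h = ori l"
  obtain s a b where l: "l = seg h s a b" "a < b"
    using l_edge_decompose(1,2)[OF assms(1)] unfolding h_def by blast
  obtain s' a' b' where l': "l' = seg h s' a' b'" "a' < b'"
    using l_edge_decompose(1,2)[OF assms(2)] unfolding h_def assms(3) by blast
  show ?thesis
    using l_edges_disjoint[of h s a b s' a' b' z] assms(1,2,4,5) l(2) l'(2) unfolding l(1) l'(1) by blast
qed

lemma in_TB: "z \<in> T_junctions M \<union> boundary_vertices M \<Longrightarrow> z \<in> vertices M \<and> z \<in> \<Omega>"
  using TB_subset_vertices vertices_subset_domain by blast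

lemma finite_low_edges: "finite low_edges" and finite_high_edges: "finite high_edges"
  using finite_interior_l_edges by (auto simp: low_edges_def high_edges_def)

lemma finite_generators: "finite generators"
  unfolding generators_def
  using finite_low_edges finite_vertices by (auto simp: interior_vertices_def)

lemma generatorE:
  assumes "g \<in> generators"
  obtains (Mono) i j where "g = Mono i j" "i \<le> d" "j \<le> d"
    | (Vert) v where "g = Vert v" "v \<in> interior_vertices M"
    | (Edge) l j where "g = Edge l j" "l \<in> low_edges" "j \<le> d"
  using assms unfolding generators_def by auto

lemma start_vertex: "g \<in> generators \<Longrightarrow> legs g \<noteq> {} \<Longrightarrow> start g \<in> vertices M"
proof (erule generatorE)
  fix l j assume "g = Edge l j" "l \<in> low_edges"
  then show ?thesis using l_edge_ends(1) in_TB unfolding low_edges_def by auto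
qed (auto simp: interior_vertices_def)

lemma generator_starts:
  assumes "g \<in> generators" "h \<in> legs g"
  shows "starts h (start g)"
  using assms(1)
proof (cases rule: generatorE)
  case (Mono i j)
  then show ?thesis using assms(2) by simp
next
  case (Vert v)
  then have "v \<in> interior \<Omega>" by (simp add: interior_vertices_def)
  then obtain \<epsilon> where \<epsilon>: "\<epsilon> > 0" "ball v \<epsilon> \<subseteq> interior \<Omega>" using open_contains_ball open_interior by metis
  have "pt h t (crd (\<not> h) v) \<in> interior \<Omega>" if "crd h v < t" "t < crd h v + \<epsilon>" for t
  proof -
    have "dist v (pt h t (crd (\<not> h) v)) < \<epsilon>"
      using dist_pt[of h "crd h v" "crd (\<not> h) v" t] that by simp
    then show ?thesis using \<epsilon>(2) by auto
  qed
  then show ?thesis unfolding starts_def Vert(1) start.simps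
    using \<epsilon>(1) by (intro exI[of _ "crd h v + \<epsilon>"]) auto
next
  case (Edge l j)
  then have l: "l \<in> interior_l_edges M" by (simp add: low_edges_def)
  have "h = ori l" using assms(2) Edge(1) by simp
  then show ?thesis unfolding starts_def Edge(1) start.simps
    using l_edge_ends(3)[OF l] l_edge_decompose(2)[OF l] by (intro exI[of _ "crd h (high l)"]) auto
qed

lemma generator_frontier:
  assumes "g \<in> generators" "legs g \<noteq> {}" "h \<notin> legs g"
  shows "start g \<in> frontier \<Omega>"
  using assms(1)
proof (cases rule: generatorE)
  case (Edge l j)
  then show ?thesis by (simp add: low_edges_def)
qed (use assms in auto)

lemma degree_factor: "g \<in> generators \<Longrightarrow> degree (factor d g h) \<le> d"
  by (erule generatorE) (auto simp: degree_linear_power degree_monom_le intro: order.trans[OF degree_monom_le])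

lemma bipoly_gpoly: "g \<in> generators \<Longrightarrow> bipoly d (gpoly d g)"
  unfolding gpoly_def[abs_def] by (intro bipoly_mult degree_factor)

text \<open>The values of a cut function on the legs themselves are irrelevant, since \<open>gpoly\<close> vanishes there.\<close>

definition cut_of :: "generator \<Rightarrow> (real \<times> real \<Rightarrow> real) \<Rightarrow> (real \<times> real) set \<Rightarrow> bool" where
  "cut_of g \<kappa> L \<longleftrightarrow> (\<exists>B. \<forall>z\<in>\<Omega>. \<bar>\<kappa> z\<bar> \<le> B) \<and>
     (\<forall>z\<in>\<Omega>. z \<notin> L \<longrightarrow> (\<exists>r>0. \<exists>c. \<forall>z'\<in>\<Omega> \<inter> ball z r. \<kappa> z' = c)) \<and>
     (\<forall>z\<in>L. \<exists>h\<in>legs g. crd (\<not> h) z = crd (\<not> h) (start g)) \<and>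
     (\<forall>z\<in>interior \<Omega>. (legs g = {} \<or> z \<noteq> start g) \<longrightarrow> (\<forall>h\<in>legs g. \<not> sees h (start g) z) \<longrightarrow> z \<notin> L) \<and>
     (\<forall>h\<in>legs g. \<forall>z. sees h (start g) z \<longrightarrow> (\<exists>r>0. \<exists>c. \<forall>z'\<in>\<Omega> \<inter> ball z r.
             (crd (\<not> h) z' > crd (\<not> h) z \<longrightarrow> \<kappa> z' = c + 1) \<and> (crd (\<not> h) z' < crd (\<not> h) z \<longrightarrow> \<kappa> z' = c))) \<and>
     (legs g = {} \<longrightarrow> \<kappa> = (\<lambda>_. 1))"

lemma cut_of_exists:
  assumes "g \<in> generators"
  shows "\<exists>\<kappa> L. cut_of g \<kappa> L"
proof (cases "legs g = {}")
  case True
  have "cut_of g (\<lambda>_. 1) {}"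
    unfolding cut_of_def True
    by (intro conjI exI[of _ 1] ballI impI) (auto intro: exI[of _ 1])
  then show ?thesis by blast
next
  case False
  show ?thesis
  proof (rule domain_cut[of "legs g" "start g"])
    show "legs g \<noteq> {}" by fact
    show "starts h (start g)" if "h \<in> legs g" for h using generator_starts assms that .
    show "start g \<in> frontier \<Omega>" if "h \<notin> legs g" for h using generator_frontier assms False that .
  next
    fix \<kappa> :: "real \<times> real \<Rightarrow> real" and L
    assume *: "\<exists>B. \<forall>z\<in>\<Omega>. \<bar>\<kappa> z\<bar> \<le> B"
      "\<And>z. z \<in> \<Omega> \<Longrightarrow> z \<notin> L \<Longrightarrow> \<exists>r>0. \<exists>c. \<forall>z'\<in>\<Omega> \<inter> ball z r. \<kappa> z' = c"
      "\<And>z. z \<in> L \<Longrightarrow> \<exists>h\<in>legs g. crd (\<not> h) z = crd (\<not> h) (start g)"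
      "\<And>z. z \<in> interior \<Omega> \<Longrightarrow> z \<noteq> start g \<Longrightarrow> (\<And>h. h \<in> legs g \<Longrightarrow> \<not> sees h (start g) z) \<Longrightarrow> z \<notin> L"
      "\<And>h z. h \<in> legs g \<Longrightarrow> sees h (start g) z \<Longrightarrow>
           \<exists>r>0. \<exists>c. \<forall>z'\<in>\<Omega> \<inter> ball z r.
             (crd (\<not> h) z' > crd (\<not> h) z \<longrightarrow> \<kappa> z' = c + 1) \<and> (crd (\<not> h) z' < crd (\<not> h) z \<longrightarrow> \<kappa> z' = c)"
    have "cut_of g \<kappa> L"
      unfolding cut_of_def
    proof (intro conjI ballI allI impI)
      show "\<exists>B. \<forall>z\<in>\<Omega>. \<bar>\<kappa> z\<bar> \<le> B" by (rule *(1))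
      show "\<exists>r>0. \<exists>c. \<forall>z'\<in>\<Omega> \<inter> ball z r. \<kappa> z' = c" if "z \<in> \<Omega>" "z \<notin> L" for z by (rule *(2)[OF that])
      show "\<exists>h\<in>legs g. crd (\<not> h) z = crd (\<not> h) (start g)" if "z \<in> L" for z by (rule *(3)[OF that])
      show "z \<notin> L" if "z \<in> interior \<Omega>" "legs g = {} \<or> z \<noteq> start g" "\<forall>h\<in>legs g. \<not> sees h (start g) z" for z
        using *(4)[of z] that False by auto
      show "\<exists>r>0. \<exists>c. \<forall>z'\<in>\<Omega> \<inter> ball z r.
             (crd (\<not> h) z' > crd (\<not> h) z \<longrightarrow> \<kappa> z' = c + 1) \<and> (crd (\<not> h) z' < crd (\<not> h) z \<longrightarrow> \<kappa> z' = c)"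
        if "h \<in> legs g" "sees h (start g) z" for h z by (rule *(5)[OF that])
      show "\<kappa> = (\<lambda>_. 1)" if "legs g = {}" using that False by simp
    qed
    then show ?thesis by blast
  qed
qed

definition cut :: "generator \<Rightarrow> real \<times> real \<Rightarrow> real" where
  "cut g = (SOME \<kappa>. \<exists>L. cut_of g \<kappa> L)"

lemma cut_of_cut: "g \<in> generators \<Longrightarrow> \<exists>L. cut_of g (cut g) L"
  unfolding cut_def by (rule someI_ex[OF cut_of_exists])

lemma cut_Mono: "Mono i j \<in> generators \<Longrightarrow> cut (Mono i j) = (\<lambda>_. 1)"
  using cut_of_cut[of "Mono i j"] unfolding cut_of_def by auto

definition basis :: "generator \<Rightarrow> real \<times> real \<Rightarrow> real" where
  "basis g z = (if z \<in> \<Omega> then cut g z * gpoly d g z else 0)"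

text \<open>On the line of a leg, the factor across it vanishes together with its derivatives of
  order below \<open>d\<close>. For derivatives along the leg this factor is not differentiated, and
  \<open>d \<ge> 1\<close> makes it 0; for derivatives across the leg fewer than \<open>d\<close> of
  them are taken.\<close>

lemma C_diff_basis:
  assumes "g \<in> generators"
  shows "C_diff h (d - 1) \<Omega> (basis g)"
proof -
  obtain L where cut: "cut_of g (cut g) L" using cut_of_cut[OF assms] by blast
  obtain B where B: "\<forall>z\<in>\<Omega>. \<bar>cut g z\<bar> \<le> B" using cut unfolding cut_of_def by blast
  have loc: "\<forall>z\<in>\<Omega>. z \<notin> L \<longrightarrow> (\<exists>r>0. \<exists>c. \<forall>z'\<in>\<Omega> \<inter> ball z r. cut g z' = c)"
    and L: "\<forall>z\<in>L. \<exists>h\<in>legs g. crd (\<not> h) z = crd (\<not> h) (start g)"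
    using cut unfolding cut_of_def by simp_all
  have "C_diff h (d - 1) \<Omega> (\<lambda>z. if z \<in> \<Omega> then cut g z *
      (poly (factor d g True) (fst z) * poly (factor d g False) (snd z)) else 0)"
  proof (rule C_diff_cut[where B = B and L = L])
    show "\<bar>cut g z\<bar> \<le> B" if "z \<in> \<Omega>" for z using B that by simp
    show "\<exists>r>0. \<exists>c. \<forall>w\<in>\<Omega> \<inter> ball z r. cut g w = c" if "z \<in> \<Omega>" "z \<notin> L" for z
      using loc that by simp
    show "poly ((pderiv ^^ i) (factor d g h)) (crd h z) * poly (factor d g (\<not> h)) (crd (\<not> h) z) = 0"
      if "z \<in> L" "i \<le> d - 1" for z i
    proof -
      obtain h' where h': "h' \<in> legs g" "crd (\<not> h') z = crd (\<not> h') (start g)" using L \<open>z \<in> L\<close> by blast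
      note f = factor_leg[OF h'(1), of d]
      show ?thesis
      proof (cases "h' = h")
        case True
        have "poly (factor d g (\<not> h)) (crd (\<not> h) z) = 0"
          using f h'(2) d unfolding True by simp
        then show ?thesis by simp
      next
        case False
        then have neg: "(\<not> h') = h" by auto
        have "i < d" using \<open>i \<le> d - 1\<close> d by simp
        then have "poly ((pderiv ^^ i) (factor d g h)) (crd h z) = 0"
          using f h'(2) poly_higher_pderiv_linear_power unfolding neg by simp
        then show ?thesis by simp
      qed
    qed
  qed
  moreover have "basis g = (\<lambda>z. if z \<in> \<Omega> then cut g z *
      (poly (factor d g True) (fst z) * poly (factor d g False) (snd z)) else 0)"
    by (simp add: basis_def gpoly_def fun_eq_iff)
  ultimately show ?thesis by simp
qed

text \<open>The local shape of \<open>cut g\<close> at \<open>z\<close> as a function of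
  \<open>w\<close>, normalised to 0 on the lower side of the leg.\<close>

definition jump :: "bool \<Rightarrow> generator \<Rightarrow> real \<times> real \<Rightarrow> real \<times> real \<Rightarrow> real" where
  "jump h g z w = (if h \<in> legs g \<and> sees h (start g) z \<and> crd (\<not> h) z < crd (\<not> h) w then 1 else 0)"

lemma sees_one:
  assumes "sees h p z" "sees h' p z"
  shows "h = h'"
proof (rule ccontr)
  assume "h \<noteq> h'"
  then have "h' = (\<not> h)" by auto
  then show False using assms unfolding sees_def by simp
qed

lemma ball_nhds: "r > 0 \<Longrightarrow> (\<And>w. w \<in> ball z r \<Longrightarrow> P w) \<Longrightarrow> \<forall>\<^sub>F w in nhds z. P w"
  unfolding eventually_nhds_metric by (auto simp: dist_commute)

lemma eventually_in_interior: "z \<in> interior \<Omega> \<Longrightarrow> \<forall>\<^sub>F w in nhds z. w \<in> \<Omega>"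
  using eventually_nhds_in_open[OF open_interior, of z \<Omega>] interior_subset
  by (auto elim!: eventually_mono)

lemma basis_local:
  assumes "g \<in> generators" "z \<in> interior \<Omega>" "legs g = {} \<or> z \<noteq> start g"
  shows "\<exists>c. \<forall>\<^sub>F w in nhds z. basis g w = (c + (\<Sum>h\<in>UNIV. jump h g z w)) * gpoly d g w"
proof -
  obtain L where cut: "cut_of g (cut g) L" using cut_of_cut[OF assms(1)] by blast
  have loc: "\<forall>z\<in>\<Omega>. z \<notin> L \<longrightarrow> (\<exists>r>0. \<exists>c. \<forall>z'\<in>\<Omega> \<inter> ball z r. cut g z' = c)"
    and unseen: "\<forall>z\<in>interior \<Omega>. (legs g = {} \<or> z \<noteq> start g) \<longrightarrow> (\<forall>h\<in>legs g. \<not> sees h (start g) z) \<longrightarrow> z \<notin> L"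
    and seen: "\<forall>h\<in>legs g. \<forall>z. sees h (start g) z \<longrightarrow> (\<exists>r>0. \<exists>c. \<forall>z'\<in>\<Omega> \<inter> ball z r.
             (crd (\<not> h) z' > crd (\<not> h) z \<longrightarrow> cut g z' = c + 1) \<and> (crd (\<not> h) z' < crd (\<not> h) z \<longrightarrow> cut g z' = c))"
    using cut unfolding cut_of_def by simp_all
  have z\<Omega>: "z \<in> \<Omega>" using assms(2) interior_subset by blast
  show ?thesis
  proof (cases "\<exists>h\<in>legs g. sees h (start g) z")
    case True
    then obtain h where h: "h \<in> legs g" "sees h (start g) z" by blast
    obtain r c where r: "r > 0" "\<forall>z'\<in>\<Omega> \<inter> ball z r.
             (crd (\<not> h) z' > crd (\<not> h) z \<longrightarrow> cut g z' = c + 1) \<and> (crd (\<not> h) z' < crd (\<not> h) z \<longrightarrow> cut g z' = c)"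
      using seen h by meson
    have "\<forall>\<^sub>F w in nhds z. w \<in> ball z r" using r(1) by (rule ball_nhds)
    then have "\<forall>\<^sub>F w in nhds z. basis g w = (c + (\<Sum>h\<in>UNIV. jump h g z w)) * gpoly d g w"
      using eventually_in_interior[OF assms(2)]
    proof eventually_elim
      case (elim w)
      have "jump (\<not> h) g z w = 0" using sees_one[OF h(2), of "\<not> h"] unfolding jump_def by auto
      then have sum: "(\<Sum>h\<in>UNIV. jump h g z w) = jump h g z w"
        by (cases h) (simp_all add: UNIV_bool)
      show ?case
      proof (cases "crd (\<not> h) w = crd (\<not> h) z")
        case True
        \<comment> \<open>On the leg the value of the cut function is unknown, but the polynomial is
          0 there.\<close>
        have "crd (\<not> h) w = crd (\<not> h) (start g)" using True h(2) unfolding sees_def by simp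
        then have "gpoly d g w = 0"
          unfolding gpoly_crd[of d g w h] factor_leg[OF h(1)] using d by simp
        then show ?thesis by (simp add: basis_def)
      next
        case False
        then have "cut g w = c + jump h g z w"
          using r(2) elim h unfolding jump_def by (cases "crd (\<not> h) z < crd (\<not> h) w") auto
        then show ?thesis using elim(2) unfolding sum by (simp add: basis_def)
      qed
    qed
    then show ?thesis by blast
  next
    case False
    then have "z \<notin> L" using unseen assms(2,3) by blast
    then obtain r c where r: "r > 0" "\<forall>z'\<in>\<Omega> \<inter> ball z r. cut g z' = c" using loc z\<Omega> by blast
    have "\<forall>\<^sub>F w in nhds z. w \<in> ball z r" using r(1) by (rule ball_nhds)
    then have "\<forall>\<^sub>F w in nhds z. basis g w = (c + (\<Sum>h\<in>UNIV. jump h g z w)) * gpoly d g w"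
      using eventually_in_interior[OF assms(2)]
    proof eventually_elim
      case (elim w)
      have "(\<Sum>h\<in>UNIV. jump h g z w) = 0" using False unfolding jump_def by (intro sum.neutral) auto
      then show ?case using elim r(2) by (simp add: basis_def)
    qed
    then show ?thesis by blast
  qed
qed

section \<open>Local form of a linear combination\<close>

definition comb :: "(generator \<Rightarrow> real) \<Rightarrow> real \<times> real \<Rightarrow> real" where
  "comb c z = (\<Sum>g\<in>generators. c g * basis g z)"

definition seen_by :: "bool \<Rightarrow> real \<times> real \<Rightarrow> generator set" where
  "seen_by h z = {g \<in> generators. h \<in> legs g \<and> sees h (start g) z}"

text \<open>All functions whose leg in direction \<open>h\<close> passes \<open>z\<close> share the
  \<open>d\<close>-th power across the line. Their total jump is this power times
  \<open>jump_poly\<close>, a polynomial in the coordinate along the line.\<close>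

definition jump_poly :: "(generator \<Rightarrow> real) \<Rightarrow> bool \<Rightarrow> real \<times> real \<Rightarrow> real poly" where
  "jump_poly c h z = (\<Sum>g\<in>seen_by h z. smult (c g) (factor d g h))"

lemma comb_local:
  assumes "z \<in> interior \<Omega>" "\<And>g. g \<in> generators \<Longrightarrow> legs g \<noteq> {} \<Longrightarrow> z \<noteq> start g"
  obtains p where "bipoly d p"
    "\<forall>\<^sub>F w in nhds z. comb c w = p w + (\<Sum>h\<in>UNIV. (if crd (\<not> h) z < crd (\<not> h) w
       then (crd (\<not> h) w - crd (\<not> h) z) ^ d * poly (jump_poly c h z) (crd h w) else 0))"
proof -
  have "\<forall>g\<in>generators. \<exists>c. \<forall>\<^sub>F w in nhds z. basis g w = (c + (\<Sum>h\<in>UNIV. jump h g z w)) * gpoly d g w"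
    using basis_local assms by blast
  from bchoice[OF this] obtain b where
    b: "\<forall>g\<in>generators. \<forall>\<^sub>F w in nhds z. basis g w = (b g + (\<Sum>h\<in>UNIV. jump h g z w)) * gpoly d g w" ..
  define p where "p w = (\<Sum>g\<in>generators. (c g * b g) * gpoly d g w)" for w
  have "bipoly d p" unfolding p_def[abs_def] by (intro bipoly_sum bipoly_scale bipoly_gpoly)
  moreover have "\<forall>\<^sub>F w in nhds z. \<forall>g\<in>generators. basis g w = (b g + (\<Sum>h\<in>UNIV. jump h g z w)) * gpoly d g w"
    using eventually_ball_finite[OF finite_generators b] .
  then have "\<forall>\<^sub>F w in nhds z. comb c w = p w + (\<Sum>h\<in>UNIV. (if crd (\<not> h) z < crd (\<not> h) w
       then (crd (\<not> h) w - crd (\<not> h) z) ^ d * poly (jump_poly c h z) (crd h w) else 0))"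
  proof eventually_elim
    case (elim w)
    have jp: "(\<Sum>g\<in>generators. c g * (jump h g z w * gpoly d g w)) = (if crd (\<not> h) z < crd (\<not> h) w
       then (crd (\<not> h) w - crd (\<not> h) z) ^ d * poly (jump_poly c h z) (crd h w) else 0)" for h
    proof (cases "crd (\<not> h) z < crd (\<not> h) w")
      case True
      have "(\<Sum>g\<in>generators. c g * (jump h g z w * gpoly d g w)) = (\<Sum>g\<in>seen_by h z. c g * gpoly d g w)"
        unfolding seen_by_def using finite_generators True
        by (intro sum.mono_neutral_cong_right) (auto simp: jump_def)
      also have "\<dots> = (\<Sum>g\<in>seen_by h z. (crd (\<not> h) w - crd (\<not> h) z) ^ d * (c g * poly (factor d g h) (crd h w)))"
      proof (rule sum.cong[OF refl])
        fix g assume "g \<in> seen_by h z"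
        then have g: "h \<in> legs g" "crd (\<not> h) z = crd (\<not> h) (start g)"
          unfolding seen_by_def sees_def by auto
        show "c g * gpoly d g w = (crd (\<not> h) w - crd (\<not> h) z) ^ d * (c g * poly (factor d g h) (crd h w))"
          unfolding gpoly_crd[of d g w h] factor_leg[OF g(1)] g(2) by simp
      qed
      also have "\<dots> = (crd (\<not> h) w - crd (\<not> h) z) ^ d * poly (jump_poly c h z) (crd h w)"
        unfolding jump_poly_def poly_sum poly_smult sum_distrib_left ..
      finally show ?thesis using True by simp
    next
      case False
      then show ?thesis by (simp add: jump_def)
    qed
    have "comb c w = (\<Sum>g\<in>generators. c g * ((b g + (\<Sum>h\<in>UNIV. jump h g z w)) * gpoly d g w))"
      unfolding comb_def using elim by (intro sum.cong) auto
    also have "\<dots> = p w + (\<Sum>g\<in>generators. \<Sum>h\<in>UNIV. c g * (jump h g z w * gpoly d g w))"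
      unfolding p_def sum.distrib[symmetric]
      by (intro sum.cong refl) (simp add: algebra_simps sum_distrib_left sum_distrib_right)
    also have "(\<Sum>g\<in>generators. \<Sum>h\<in>UNIV. c g * (jump h g z w * gpoly d g w)) =
        (\<Sum>h\<in>UNIV. \<Sum>g\<in>generators. c g * (jump h g z w * gpoly d g w))"
      by (rule sum.swap)
    finally show ?case unfolding jp .
  qed
  ultimately show thesis using that by blast
qed

lemma interior_cell_subset: "K \<in> M \<Longrightarrow> interior K \<subseteq> interior \<Omega>"
  by (intro interior_mono) (auto simp: mesh_domain_def)

text \<open>Without jumps the combination is locally polynomial. Polynomials found at nearby points
  agree by the identity theorem, hence are constant over the connected interior of the cell;
  continuity carries the formula to its boundary.\<close>

lemma bipoly_on_cell:
  assumes K: "K \<in> M" and "\<And>h z. z \<in> interior K \<Longrightarrow> jump_poly c h z = 0"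
    and cont: "continuous_on \<Omega> (comb c)"
  shows "bipoly_on d K (comb c)"
proof -
  have "\<exists>p. bipoly d p \<and> (\<forall>\<^sub>F w in nhds z. comb c w = p w)" if z: "z \<in> interior K" for z
  proof -
    have zs: "z \<noteq> start g" if "g \<in> generators" "legs g \<noteq> {}" for g
      using start_vertex[OF that] vertex_notin_interior[OF _ K] z by blast
    have "z \<in> interior \<Omega>" using z interior_cell_subset[OF K] by blast
    then obtain p where p: "bipoly d p"
      "\<forall>\<^sub>F w in nhds z. comb c w = p w + (\<Sum>h\<in>UNIV. (if crd (\<not> h) z < crd (\<not> h) w
       then (crd (\<not> h) w - crd (\<not> h) z) ^ d * poly (jump_poly c h z) (crd h w) else 0))"
      by (rule comb_local[OF _ zs])
    have zero: "jump_poly c h z = 0" for h using assms(2) z .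
    from p(2) have "\<forall>\<^sub>F w in nhds z. comb c w = p w"
      unfolding zero poly_0 mult_zero_right if_cancel sum.neutral_const add_0_right .
    then show ?thesis using p(1) by blast
  qed
  then have "\<forall>z\<in>interior K. \<exists>p. bipoly d p \<and> (\<forall>\<^sub>F w in nhds z. comb c w = p w)" by blast
  from bchoice[OF this] obtain p where
    "\<forall>z\<in>interior K. bipoly d (p z) \<and> (\<forall>\<^sub>F w in nhds z. comb c w = p z w)" ..
  then have p: "bipoly d (p z)" "\<forall>\<^sub>F w in nhds z. comb c w = p z w" if "z \<in> interior K" for z
    using that by simp_all
  obtain a b where ab: "K = cbox a b" "box a b \<noteq> {}" using cell_cbox[OF K] .
  have intK: "interior K = box a b" unfolding ab(1) by (rule interior_cbox)
  obtain z0 where z0: "z0 \<in> interior K" using ab(2) intK by blast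
  have near: "\<forall>\<^sub>F w in at z within interior K. p z = p w" if z: "z \<in> interior K" for z
  proof -
    have "\<forall>\<^sub>F w in nhds z. \<forall>\<^sub>F u in nhds w. comb c u = p z u"
      using p(2)[OF z] by (simp add: eventually_eventually)
    moreover have "\<forall>\<^sub>F w in nhds z. w \<in> interior K" using z by (intro eventually_nhds_in_open) auto
    ultimately have "\<forall>\<^sub>F w in nhds z. p z = p w"
    proof eventually_elim
      case (elim w)
      have "\<forall>\<^sub>F u in nhds w. p z u = p w u"
        using elim(1) p(2)[OF elim(2)] by eventually_elim simp
      then obtain U where "open U" "w \<in> U" "\<forall>u\<in>U. p z u = p w u" unfolding eventually_nhds by blast
      then show ?case using bipoly_eq[OF p(1)[OF z] p(1)[OF elim(2)], of U] by blast
    qed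
    then show ?thesis unfolding eventually_at_filter by eventually_elim simp
  qed
  have const: "p z0 = p z" if "z \<in> interior K" for z
  proof (rule connected_local_const[where A = "interior K"])
    show "connected (interior K)" unfolding intK by (intro convex_connected convex_box)
  qed (use z0 that near in auto)
  have eq: "comb c z = p z0 z" if "z \<in> interior K" for z
    using eventually_nhds_x_imp_x[OF p(2)[OF that]] const[OF that] by simp
  obtain C where C: "\<forall>z. p z0 z = (\<Sum>i\<le>d. \<Sum>j\<le>d. C i j * fst z ^ i * snd z ^ j)"
    using p(1)[OF z0] unfolding bipoly_def by blast
  have cl: "closure (interior K) = K"
    unfolding intK unfolding ab(1) using ab(2) by (rule closure_box)
  have "K \<subseteq> \<Omega>" using K by (auto simp: mesh_domain_def)
  then have "continuous_on K (\<lambda>z. comb c z - p z0 z)"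
    unfolding C[rule_format] by (intro continuous_intros continuous_on_subset[OF cont])
  then have "comb c z - p z0 z = 0" if "z \<in> K" for z
    using continuous_constant_on_closure[of "interior K" "\<lambda>z. comb c z - p z0 z" 0 z] that eq
    unfolding cl by simp
  then have "comb c z = (\<Sum>i\<le>d. \<Sum>j\<le>d. C i j * fst z ^ i * snd z ^ j)" if "z \<in> K" for z
    using that C by simp
  then show ?thesis unfolding bipoly_on_def by (intro exI[of _ C]) auto
qed

text \<open>Every combination has the required smoothness already, so only polynomiality on the
  cells remains.\<close>

lemma comb_in_spline_space:
  assumes "\<And>K h z. K \<in> M \<Longrightarrow> z \<in> interior K \<Longrightarrow> jump_poly c h z = 0"
  shows "comb c \<in> spline_space d M"
proof -
  have C: "C_diff h (d - 1) \<Omega> (comb c)" for h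
    unfolding comb_def[abs_def] by (intro C_diff_sum C_diff_scale C_diff_basis)
  have "comb c z = 0" if "z \<notin> \<Omega>" for z using that by (simp add: comb_def basis_def)
  moreover have "bipoly_on d K (comb c)" if "K \<in> M" for K
    using bipoly_on_cell[OF that assms[OF that] C_diff_imp_continuous_on[OF C]] by blast
  ultimately show ?thesis
    unfolding spline_space_def mem_Collect_eq C_diff_x_iff C_diff_y_iff using C by blast
qed

text \<open>At points below \<open>z\<close> in both coordinates no jump is active, so the
  polynomial part \<open>p\<close> vanishes on an open set and hence everywhere. Where just one jump
  is active, it must then vanish as well.\<close>

lemma jump_poly_zero:
  assumes "\<And>w. comb c w = 0" "z \<in> interior \<Omega>"
    and "\<And>g. g \<in> generators \<Longrightarrow> legs g \<noteq> {} \<Longrightarrow> z \<noteq> start g"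
  shows "jump_poly c h z = 0"
proof -
  obtain p where p: "bipoly d p"
    "\<forall>\<^sub>F w in nhds z. comb c w = p w + (\<Sum>h\<in>UNIV. (if crd (\<not> h) z < crd (\<not> h) w
       then (crd (\<not> h) w - crd (\<not> h) z) ^ d * poly (jump_poly c h z) (crd h w) else 0))"
    by (rule comb_local[OF assms(2,3)])
  then obtain r where r: "r > 0" "\<And>w. dist w z < r \<Longrightarrow> comb c w = p w + (\<Sum>h\<in>UNIV. (if crd (\<not> h) z < crd (\<not> h) w
       then (crd (\<not> h) w - crd (\<not> h) z) ^ d * poly (jump_poly c h z) (crd h w) else 0))"
    unfolding eventually_nhds_metric by blast
  define e where "e = r / 3"
  have e: "e > 0" "2 * e < r" using r(1) by (auto simp: e_def)
  have near: "dist w z < r" if "\<bar>crd h w - crd h z\<bar> \<le> e" "\<bar>crd (\<not> h) w - crd (\<not> h) z\<bar> \<le> e" for w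
    using dist_le_crd[of w z h] that e by linarith
  have sum2: "(\<Sum>k\<in>UNIV. f k) = f h + f (\<not> h)" for f :: "bool \<Rightarrow> real"
    by (cases h) (auto simp: UNIV_bool)
  define U where "U = box (z - (e, e)) z"
  have U: "crd k z - e < crd k w" "crd k w < crd k z" if "w \<in> U" for w k
    using that[unfolded U_def mem_box_crd, THEN spec, of k] by (cases k; simp)+
  have p0: "p w = 0" if "w \<in> U" for w
  proof -
    have "dist w z < r" using U[OF that, of h] U[OF that, of "\<not> h"] by (intro near) auto
    from r(2)[OF this] have "0 = p w + (\<Sum>h\<in>UNIV. (if crd (\<not> h) z < crd (\<not> h) w
       then (crd (\<not> h) w - crd (\<not> h) z) ^ d * poly (jump_poly c h z) (crd h w) else 0))"
      unfolding assms(1) .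
    moreover have "\<not> crd k z < crd k w" for k using U(2)[OF that, of k] by simp
    ultimately show "p w = 0" by simp
  qed
  have "z - (e / 2, e / 2) \<in> U" unfolding U_def using e(1) by (auto simp: mem_box_crd all_bool_eq)
  then have ne: "U \<noteq> {}" by blast
  have op: "open U" unfolding U_def by (rule open_box)
  have p_zero: "p w = 0" for w by (rule bipoly_eq_zero[OF p(1) op ne p0])
  have "poly (jump_poly c h z) t = 0" if t: "t \<in> {crd h z - e<..<crd h z}" for t
  proof -
    \<comment> \<open>\<open>w\<close> lies above \<open>z\<close> across \<open>h\<close> but
      before \<open>z\<close> along \<open>h\<close>, so the jump of the other direction is
      inactive.\<close>
    define w where "w = pt h t (crd (\<not> h) z + e)"
    have wc: "crd h w = t" "crd (\<not> h) w = crd (\<not> h) z + e" by (simp_all add: w_def)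
    have "dist w z < r" using t e(1) by (intro near) (auto simp: wc)
    from r(2)[OF this] have "0 = e ^ d * poly (jump_poly c h z) t"
      unfolding assms(1) p_zero sum2 not_not wc using t e(1) by simp
    then show ?thesis using e(1) by simp
  qed
  then have "{crd h z - e<..<crd h z} \<subseteq> {t. poly (jump_poly c h z) t = 0}" by auto
  moreover have "infinite {crd h z - e<..<crd h z}" using e(1) by (simp add: infinite_Ioo)
  ultimately show ?thesis using poly_roots_finite finite_subset by blast
qed

section \<open>Linear independence\<close>

lemma starts_margin:
  obtains \<epsilon> where "\<epsilon> > 0" "\<And>g. g \<in> generators \<Longrightarrow> start g \<in> ball v \<epsilon> \<Longrightarrow> start g = v"
proof -
  have "open (- (start ` generators - {v}))"
    using finite_generators by (intro open_Compl finite_imp_closed) auto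
  then obtain \<epsilon> where \<epsilon>: "\<epsilon> > 0" "ball v \<epsilon> \<subseteq> - (start ` generators - {v})"
    using open_contains_ball[of "- (start ` generators - {v})"] by auto
  show thesis using that[OF \<epsilon>(1)] \<epsilon>(2) by blast
qed

text \<open>The jump polynomials on the horizontal line just left and just right of \<open>v\<close> differ by
  the contribution of \<open>v\<close> alone.\<close>

lemma vertex_coeff_zero:
  assumes zero: "\<And>w. comb c w = 0" and v: "v \<in> interior_vertices M"
  shows "c (Vert v) = 0"
proof -
  have vi: "v \<in> interior \<Omega>" using v by (simp add: interior_vertices_def)
  then obtain \<epsilon>1 where \<epsilon>1: "\<epsilon>1 > 0" "ball v \<epsilon>1 \<subseteq> interior \<Omega>" using open_contains_ball open_interior by metis
  obtain \<epsilon>2 where \<epsilon>2: "\<epsilon>2 > 0" "\<And>g. g \<in> generators \<Longrightarrow> start g \<in> ball v \<epsilon>2 \<Longrightarrow> start g = v"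
    using starts_margin by metis
  define t where "t = min \<epsilon>1 \<epsilon>2 / 2"
  have t: "t > 0" "t < \<epsilon>1" "t < \<epsilon>2" using \<epsilon>1(1) \<epsilon>2(1) by (auto simp: t_def)
  define s where "s = crd False v"
  define x where "x = crd True v"
  have vpt: "pt True x s = v" using pt_crd[of True v] by (simp add: x_def s_def)
  have on: "pt True u s \<in> ball v \<epsilon>1" "pt True u s \<in> ball v \<epsilon>2" if "\<bar>u - x\<bar> \<le> t" for u
    using dist_pt[of True x s u] that t unfolding vpt by (auto simp: abs_minus_commute)
  define zl where "zl = pt True (x - t) s"
  define zr where "zr = pt True (x + t) s"
  have nostart: "pt True u s \<noteq> start g" if "\<bar>u - x\<bar> \<le> t" "u \<noteq> x" "g \<in> generators" for u g
    using \<epsilon>2(2)[OF that(3)] on(2)[OF that(1)] that(2) vpt by (metis pt_inject)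
  have int: "pt True u s \<in> interior \<Omega>" if "\<bar>u - x\<bar> \<le> t" for u using on(1)[OF that] \<epsilon>1(2) by blast
  have zl: "jump_poly c True zl = 0"
    using t(1) int[of "x - t"] nostart[of "x - t"] unfolding zl_def by (intro jump_poly_zero[OF zero]) auto
  have zr: "jump_poly c True zr = 0"
    using t(1) int[of "x + t"] nostart[of "x + t"] unfolding zr_def by (intro jump_poly_zero[OF zero]) auto
  have cz: "crd True zl = x - t" "crd (\<not> True) zl = s" "crd True zr = x + t" "crd (\<not> True) zr = s"
    by (simp_all add: zl_def zr_def pt_def)
  have vg: "Vert v \<in> generators" using v by (auto simp: generators_def)
  \<comment> \<open>No other function starts on the line between \<open>zl\<close> and
    \<open>zr\<close>, and the line is interior in between, so any other function passes both points
    or neither.\<close>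
  have sees_eq: "sees True (start g) zr \<longleftrightarrow> sees True (start g) zl" if g: "g \<in> generators" "start g \<noteq> v" for g
  proof -
    have far: "\<bar>crd True (start g) - x\<bar> > t" if "crd (\<not> True) (start g) = s"
    proof (rule ccontr)
      assume "\<not> ?thesis"
      then have "pt True (crd True (start g)) s \<in> ball v \<epsilon>2" by (intro on) auto
      moreover have "pt True (crd True (start g)) s = start g" using that pt_crd[of True "start g"] by simp
      ultimately show False using \<epsilon>2(2)[OF g(1)] g(2) by simp
    qed
    show ?thesis
    proof
      assume sr: "sees True (start g) zr"
      then have eq: "crd (\<not> True) (start g) = s" using cz by (simp add: sees_def)
      have "crd True (start g) < x - t" using far[OF eq] sr cz unfolding sees_def by auto
      then show "sees True (start g) zl" using sr t(1) unfolding sees_def cz by auto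
    next
      assume sl: "sees True (start g) zl"
      then have eq: "crd (\<not> True) (start g) = s" using cz by (simp add: sees_def)
      have lt: "crd True (start g) < x - t"
        and i: "\<And>u. crd True (start g) < u \<Longrightarrow> u \<le> x - t \<Longrightarrow> pt True u s \<in> interior \<Omega>"
        using sl eq unfolding sees_def cz by auto
      have "pt True u s \<in> interior \<Omega>" if "crd True (start g) < u" "u \<le> x + t" for u
        using i[of u] int[of u] that by (cases "u \<le> x - t") auto
      then show "sees True (start g) zr" unfolding sees_def cz eq using lt t(1) by auto
    qed
  qed
  have v_only: "g = Vert v" if "g \<in> generators" "True \<in> legs g" "start g = v" for g
    using that(1)
  proof (cases rule: generatorE)
    case (Edge l j)
    then have "v \<in> frontier \<Omega>" using that(3) by (auto simp: low_edges_def)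
    then show ?thesis using vi frontier_domain by blast
  qed (use that in auto)
  have sees_r: "sees True v zr"
    unfolding sees_def cz using t(1) int by (auto simp: s_def x_def)
  have sees_l: "\<not> sees True v zl"
    unfolding sees_def cz using t(1) by (auto simp: x_def)
  have set_eq: "seen_by True zr = insert (Vert v) (seen_by True zl)"
  proof (intro equalityI subsetI)
    fix g assume g: "g \<in> seen_by True zr"
    show "g \<in> insert (Vert v) (seen_by True zl)"
      using g v_only[of g] sees_eq[of g] by (cases "start g = v") (auto simp: seen_by_def)
  next
    fix g assume "g \<in> insert (Vert v) (seen_by True zl)"
    then show "g \<in> seen_by True zr"
    proof
      assume "g = Vert v" then show ?thesis using vg sees_r by (simp add: seen_by_def)
    next
      assume "g \<in> seen_by True zl"
      then show ?thesis using sees_eq[of g] sees_l by (cases "start g = v") (auto simp: seen_by_def)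
    qed
  qed
  have "Vert v \<notin> seen_by True zl" using sees_l by (simp add: seen_by_def)
  moreover have "finite (seen_by True zl)" using finite_generators by (simp add: seen_by_def)
  ultimately have "jump_poly c True zr = smult (c (Vert v)) (factor d (Vert v) True) + jump_poly c True zl"
    unfolding jump_poly_def set_eq by simp
  then have "smult (c (Vert v)) (factor d (Vert v) True) = 0" using zl zr by simp
  moreover have "factor d (Vert v) True \<noteq> 0" by simp
  ultimately show ?thesis by (simp only: smult_eq_0_iff simp_thms)
qed

text \<open>Just beyond the lower end \<open>p\<close> of \<open>l\<close> only the functions of
  \<open>l\<close> itself jump: those starting earlier on the line are stopped at the boundary point
  \<open>p\<close>, vertex functions start at interior points, and another \<open>l\<close>-edge of
  this direction through \<open>p\<close> would coincide with \<open>l\<close>. The jump polynomial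
  thus has the unknown coefficients as its own.\<close>

lemma edge_coeff_zero:
  assumes zero: "\<And>w. comb c w = 0" and l: "l \<in> low_edges" and j: "j \<le> d"
  shows "c (Edge l j) = 0"
proof -
  define p where "p = low l"
  define h where "h = ori l"
  define s where "s = crd (\<not> h) p"
  have li: "l \<in> interior_l_edges M" and pf: "p \<in> frontier \<Omega>" using l by (auto simp: low_edges_def p_def)
  obtain \<epsilon> where \<epsilon>: "\<epsilon> > 0" "\<And>g. g \<in> generators \<Longrightarrow> start g \<in> ball p \<epsilon> \<Longrightarrow> start g = p"
    using starts_margin by metis
  have len: "crd h p < crd h (high l)" using l_edge_decompose(2)[OF li] by (simp add: h_def p_def)
  define t where "t = min \<epsilon> (crd h (high l) - crd h p) / 2"
  have t: "t > 0" "t < \<epsilon>" "crd h p + t < crd h (high l)" using \<epsilon>(1) len by (auto simp: t_def min_def field_simps)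
  have int: "pt h u s \<in> interior \<Omega>" if "crd h p < u" "u \<le> crd h p + t" for u
    using l_edge_ends(3)[OF li, of u] that t(3) by (simp add: h_def p_def s_def)
  define z where "z = pt h (crd h p + t) s"
  have ppt: "pt h (crd h p) s = p" by (simp add: s_def)
  have near: "pt h u s \<in> ball p \<epsilon>" if "\<bar>u - crd h p\<bar> \<le> t" for u
    using dist_pt[of h "crd h p" s u] that t unfolding ppt by (auto simp: abs_minus_commute)
  have nostart: "z \<noteq> start g" if "g \<in> generators" for g
  proof
    assume "z = start g"
    moreover have "z \<in> ball p \<epsilon>" unfolding z_def using t(1) by (intro near) auto
    ultimately have "z = p" using \<epsilon>(2)[OF that] by simp
    then have "crd h p + t = crd h p" unfolding z_def by (metis crd_pt(1))
    then show False using t(1) by simp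
  qed
  have jz: "jump_poly c h z = 0"
    using int[of "crd h p + t"] t(1) nostart unfolding z_def[symmetric] by (intro jump_poly_zero[OF zero]) auto
  have cz: "crd h z = crd h p + t" "crd (\<not> h) z = s" by (simp_all add: z_def)
  have pl: "p \<in> l" using low_high_in_l_edge[OF li] by (simp add: p_def)
  have "seen_by h z = (\<lambda>j. Edge l j) ` {..d}"
  proof (intro equalityI subsetI)
    fix g assume "g \<in> seen_by h z"
    then have g: "g \<in> generators" "h \<in> legs g" "sees h (start g) z" by (auto simp: seen_by_def)
    have sg: "crd (\<not> h) (start g) = s" "crd h (start g) < crd h p + t"
      and i: "\<And>u. crd h (start g) < u \<Longrightarrow> u \<le> crd h p + t \<Longrightarrow> pt h u s \<in> interior \<Omega>"
      using g(3) unfolding sees_def cz by auto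
    have gpt: "pt h (crd h (start g)) s = start g" using pt_crd[of h "start g"] unfolding sg(1) .
    have "start g = p"
    proof (cases "crd h (start g) < crd h p")
      case True
      then have "p \<in> interior \<Omega>" using i[of "crd h p"] t(1) ppt by simp
      then show ?thesis using pf frontier_domain by blast
    next
      case False
      then have "start g \<in> ball p \<epsilon>" using near[of "crd h (start g)"] sg(2) gpt by auto
      then show ?thesis using \<epsilon>(2)[OF g(1)] by simp
    qed
    note sp = this
    show "g \<in> (\<lambda>j. Edge l j) ` {..d}"
      using g(1)
    proof (cases rule: generatorE)
      case (Mono i j) then show ?thesis using g(2) by simp
    next
      case (Vert v)
      then have "p \<in> interior \<Omega>" using sp by (simp add: interior_vertices_def)
      then show ?thesis using pf frontier_domain by blast
    next
      case (Edge l' j)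
      then have l': "l' \<in> interior_l_edges M" by (simp add: low_edges_def)
      have "p \<in> l'" using low_high_in_l_edge(1)[OF l'] sp Edge(1) by simp
      moreover have "ori l' = ori l" using g(2) Edge(1) by (simp add: h_def)
      ultimately have "l' = l" using l_edge_unique[OF l' li _ _ pl] by blast
      then show ?thesis using Edge by simp
    qed
  next
    fix g assume "g \<in> (\<lambda>j. Edge l j) ` {..d}"
    then obtain k where k: "g = Edge l k" "k \<le> d" by auto
    have "g \<in> generators" using k l by (auto simp: generators_def)
    moreover have "sees h p z" unfolding sees_def cz using t(1) int by (auto simp: s_def)
    ultimately show "g \<in> seen_by h z" unfolding seen_by_def k(1) by (simp add: h_def p_def)
  qed
  then have "jump_poly c h z = (\<Sum>k\<le>d. smult (c (Edge l k)) (monom 1 k))"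
    unfolding jump_poly_def by (simp add: sum.reindex inj_on_def h_def)
  then have "coeff (\<Sum>k\<le>d. smult (c (Edge l k)) (monom 1 k)) j = 0" using jz by simp
  then have "(\<Sum>k\<le>d. if k = j then c (Edge l k) else 0) = 0"
    unfolding coeff_sum coeff_smult coeff_monom by (simp add: if_distrib cong: if_cong)
  then show ?thesis using j by simp
qed

lemma sum_generators:
  "(\<Sum>g\<in>generators. f g) = (\<Sum>i\<le>d. \<Sum>j\<le>d. f (Mono i j)) + (\<Sum>v\<in>interior_vertices M. f (Vert v)) +
     (\<Sum>l\<in>low_edges. \<Sum>j\<le>d. f (Edge l j))"
proof -
  let ?A = "(\<lambda>(i, j). Mono i j) ` ({..d} \<times> {..d})" and ?B = "Vert ` interior_vertices M"
    and ?C = "(\<lambda>(l, j). Edge l j) ` (low_edges \<times> {..d})"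
  have fin: "finite ?A" "finite ?B" "finite ?C"
    using finite_low_edges finite_vertices by (auto simp: interior_vertices_def)
  have "(\<Sum>g\<in>generators. f g) = (\<Sum>g\<in>?A. f g) + (\<Sum>g\<in>?B. f g) + (\<Sum>g\<in>?C. f g)"
    unfolding generators_def using fin by (subst sum.union_disjoint; auto)+
  also have "(\<Sum>g\<in>?A. f g) = (\<Sum>i\<le>d. \<Sum>j\<le>d. f (Mono i j))"
    by (subst sum.reindex) (auto simp: inj_on_def sum.cartesian_product intro!: sum.cong)
  also have "(\<Sum>g\<in>?B. f g) = (\<Sum>v\<in>interior_vertices M. f (Vert v))"
    by (subst sum.reindex) (auto simp: inj_on_def)
  also have "(\<Sum>g\<in>?C. f g) = (\<Sum>l\<in>low_edges. \<Sum>j\<le>d. f (Edge l j))"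
    by (subst sum.reindex) (auto simp: inj_on_def sum.cartesian_product intro!: sum.cong)
  finally show ?thesis .
qed

lemma card_generators:
  "card generators = (d + 1)\<^sup>2 + card (interior_vertices M) + card low_edges * (d + 1)"
  using sum_generators[of "\<lambda>_. 1::nat"] by (simp add: power2_eq_square)

lemma interior_domain_nonempty: "interior \<Omega> \<noteq> {}"
proof -
  have "\<Omega> \<noteq> {}" using t_mesh unfolding t_mesh_def by blast
  then obtain K where K: "K \<in> M" by (auto simp: mesh_domain_def)
  moreover have "interior K \<noteq> {}" using t_mesh K unfolding t_mesh_def by blast
  ultimately show ?thesis using interior_cell_subset by blast
qed

lemma comb_inj:
  assumes zero: "\<And>w. comb c w = 0" and "g \<in> generators"
  shows "c g = 0"
proof -
  have "(\<Sum>i\<le>d. \<Sum>j\<le>d. c (Mono i j) * fst w ^ i * snd w ^ j) = 0" if w: "w \<in> interior \<Omega>" for w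
  proof -
    have "w \<in> \<Omega>" using w interior_subset by blast
    then have mono: "basis (Mono i j) w = fst w ^ i * snd w ^ j" if "i \<le> d" "j \<le> d" for i j
    proof -
      have "Mono i j \<in> generators"
        unfolding generators_def using that by (intro UnI1 image_eqI[of _ _ "(i, j)"]) auto
      then show ?thesis using cut_Mono[of i j] \<open>w \<in> \<Omega>\<close> by (simp add: basis_def gpoly_def poly_monom)
    qed
    have "0 = comb c w" using zero by simp
    also have "\<dots> = (\<Sum>i\<le>d. \<Sum>j\<le>d. c (Mono i j) * basis (Mono i j) w)"
      unfolding comb_def sum_generators using vertex_coeff_zero[OF zero] edge_coeff_zero[OF zero] by simp
    also have "\<dots> = (\<Sum>i\<le>d. \<Sum>j\<le>d. c (Mono i j) * fst w ^ i * snd w ^ j)"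
      using mono by (intro sum.cong refl) (simp add: mult.assoc)
    finally show ?thesis by simp
  qed
  then have mono: "c (Mono i j) = 0" if "i \<le> d" "j \<le> d" for i j
    using bipoly_coeffs_zero[OF open_interior interior_domain_nonempty, where c = "\<lambda>i j. c (Mono i j)" and d = d] that by blast
  show ?thesis
    using assms(2)
    by (cases rule: generatorE) (simp_all add: vertex_coeff_zero[OF zero] edge_coeff_zero[OF zero] mono)
qed

section \<open>Counting functions and conditions\<close>

text \<open>The jump that remains on the prolongation of \<open>l\<close> beyond its upper end.\<close>

definition residue_poly :: "(generator \<Rightarrow> real) \<Rightarrow> (real \<times> real) set \<Rightarrow> real poly" where
  "residue_poly c l = (\<Sum>g\<in>{g \<in> generators. ori l \<in> legs g \<and> start g \<in> l}. smult (c g) (factor d g (ori l)))"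

section \<open>Jumps inside cells and at the ends of \<open>l\<close>-edges\<close>

lemma l_edge_subset_skeleton:
  assumes "l \<in> interior_l_edges M"
  shows "l \<subseteq> (\<Union>K\<in>M. frontier K)"
proof -
  obtain E where E: "E \<subseteq> interior_edges M" "l = \<Union>E"
    using assms unfolding interior_l_edges_def edge_segments_def by blast
  have "e \<subseteq> (\<Union>K\<in>M. frontier K)" if "e \<in> E" for e
    using that E(1) unfolding interior_edges_def edges_def by blast
  then show ?thesis unfolding E(2) by blast
qed

text \<open>The last alternative ensures that a start on the boundary is never the upper end of its
  \<open>l\<close>-edge.\<close>

lemma start_on_l_edge:
  assumes "g \<in> generators" "h \<in> legs g"
  obtains l where "l \<in> interior_l_edges M" "ori l = h" "start g \<in> l"
    "start g \<in> interior \<Omega> \<or> start g = low l"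
  using assms(1)
proof (cases rule: generatorE)
  case (Mono i j)
  then show ?thesis using assms(2) by simp
next
  case (Vert v)
  obtain s a b where l: "seg h s a b \<in> interior_l_edges M" "v \<in> seg h s a b" "a < b"
    using l_edge_exists[OF Vert(2)] .
  have "v \<in> interior \<Omega>" using Vert(2) by (simp add: interior_vertices_def)
  then show ?thesis using that[OF l(1)] ori_low_high(1)[OF l(3)] l(2) Vert(1) by simp
next
  case (Edge l j)
  then have l: "l \<in> interior_l_edges M" by (simp add: low_edges_def)
  show ?thesis using that[OF l] Edge(1) assms(2) low_high_in_l_edge(1)[OF l] by simp
qed

text \<open>A point inside a cell lies on no \<open>l\<close>-edge, so a leg reaching it has left
  its \<open>l\<close>-edge at the upper end, still within the interior. Conversely, points of an
  \<open>l\<close>-edge strictly between its ends are interior, so a point seen from its upper end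
  is seen from every start on it.\<close>

lemma seen_by_cell_point:
  assumes K: "K \<in> M" and z: "z \<in> interior K"
  shows "seen_by h z = (\<Union>l\<in>{l \<in> high_edges. ori l = h \<and> sees h (high l) z}.
      {g \<in> generators. ori l \<in> legs g \<and> start g \<in> l})"
proof (intro equalityI subsetI)
  fix g assume "g \<in> seen_by h z"
  then have g: "g \<in> generators" "h \<in> legs g" "sees h (start g) z" by (auto simp: seen_by_def)
  obtain l where l: "l \<in> interior_l_edges M" "ori l = h" "start g \<in> l"
    "start g \<in> interior \<Omega> \<or> start g = low l"
    by (rule start_on_l_edge[OF g(1,2)])
  define p where "p = start g"
  define q where "q = high l"
  define s where "s = crd (\<not> h) z"
  have pl: "crd (\<not> h) p = crd (\<not> h) (low l)" "crd h (low l) \<le> crd h p" "crd h p \<le> crd h q"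
    using l(3) unfolding mem_l_edge[OF l(1)] l(2) by (simp_all add: p_def q_def)
  have sg: "crd (\<not> h) p = s" "crd h p < crd h z"
    and i: "\<And>u. crd h p < u \<Longrightarrow> u \<le> crd h z \<Longrightarrow> pt h u s \<in> interior \<Omega>"
    using g(3) unfolding sees_def p_def s_def by auto
  have qs: "crd (\<not> h) q = s" using l_edge_decompose(3)[OF l(1)] pl(1) sg(1) unfolding l(2) q_def by simp
  have "z \<notin> l" using l_edge_subset_skeleton[OF l(1)] skeleton_notin_interior[OF _ K] z by blast
  then have qz: "crd h q < crd h z"
    unfolding mem_l_edge[OF l(1)] l(2) using pl sg by (auto simp: s_def q_def)
  have qpt: "pt h (crd h q) s = q" using pt_crd[of h q] unfolding qs .
  \<comment> \<open>Either the leg passes through \<open>q\<close>, or it starts there; a start at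
    the upper end is interior.\<close>
  have qi: "q \<in> interior \<Omega>"
  proof (cases "crd h p < crd h q")
    case True
    then show ?thesis using i[of "crd h q"] qz qpt by simp
  next
    case False
    then have eq: "crd h p = crd h q" using pl(3) by simp
    then have "p = q" using point_eq_iff[of p q h] sg(1) qs by simp
    moreover have "p \<noteq> low l" using l_edge_decompose(2)[OF l(1)] eq unfolding l(2) q_def by auto
    ultimately show ?thesis using l(4) unfolding p_def by auto
  qed
  have "l \<in> high_edges" using l(1) qi frontier_domain unfolding high_edges_def q_def by blast
  moreover have "sees h q z" unfolding sees_def qs using qz i pl(3) by (auto simp: s_def)
  ultimately show "g \<in> (\<Union>l\<in>{l \<in> high_edges. ori l = h \<and> sees h (high l) z}.
      {g \<in> generators. ori l \<in> legs g \<and> start g \<in> l})"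
    using l(2,3) g(1,2) unfolding q_def by blast
next
  fix g assume "g \<in> (\<Union>l\<in>{l \<in> high_edges. ori l = h \<and> sees h (high l) z}.
      {g \<in> generators. ori l \<in> legs g \<and> start g \<in> l})"
  then obtain l where l: "l \<in> high_edges" "ori l = h" "sees h (high l) z"
    and g: "g \<in> generators" "h \<in> legs g" "start g \<in> l" by auto
  have li: "l \<in> interior_l_edges M" using l(1) by (simp add: high_edges_def)
  define p where "p = start g"
  define q where "q = high l"
  define s where "s = crd (\<not> h) z"
  have pl: "crd (\<not> h) p = crd (\<not> h) (low l)" "crd h (low l) \<le> crd h p" "crd h p \<le> crd h q"
    using g(3) unfolding mem_l_edge[OF li] l(2) by (simp_all add: p_def q_def)
  have sq: "crd (\<not> h) q = s" "crd h q < crd h z"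
    and i: "\<And>u. crd h q < u \<Longrightarrow> u \<le> crd h z \<Longrightarrow> pt h u s \<in> interior \<Omega>"
    using l(3) unfolding sees_def q_def s_def by auto
  have ls: "crd (\<not> h) (low l) = s" using l_edge_decompose(3)[OF li] sq(1) unfolding l(2) q_def by simp
  have "q \<in> \<Omega>" using l_edge_ends(2)[OF li] in_TB by (simp add: q_def)
  then have qi: "q \<in> interior \<Omega>" using l(1) frontier_domain unfolding high_edges_def q_def by blast
  have qpt: "pt h (crd h q) s = q" using pt_crd[of h q] unfolding sq(1) .
  have "pt h u s \<in> interior \<Omega>" if "crd h p < u" "u \<le> crd h z" for u
  proof -
    consider "u < crd h q" | "u = crd h q" | "crd h q < u" by linarith
    then show ?thesis
    proof cases
      case 1
      then show ?thesis using l_edge_ends(3)[OF li, of u] that(1) pl(2) unfolding l(2) ls q_def by simp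
    next
      case 2
      then show ?thesis using qi qpt by simp
    next
      case 3
      then show ?thesis using i that(2) by simp
    qed
  qed
  then have "sees h p z" unfolding sees_def pl(1) ls using pl(3) sq(2) by (simp add: s_def)
  then show "g \<in> seen_by h z" using g(1,2) unfolding seen_by_def p_def by simp
qed

text \<open>Several \<open>l\<close>-edges on the same line may end before \<open>z\<close>. They
  are disjoint, so the functions split according to the one they start on, and the jump is the sum
  of the residues.\<close>

lemma jump_poly_cell_point:
  assumes "K \<in> M" "z \<in> interior K" "\<And>l. l \<in> high_edges \<Longrightarrow> residue_poly c l = 0"
  shows "jump_poly c h z = 0"
proof -
  let ?R = "{l \<in> high_edges. ori l = h \<and> sees h (high l) z}"
  have "jump_poly c h z = (\<Sum>l\<in>?R. \<Sum>g\<in>{g \<in> generators. ori l \<in> legs g \<and> start g \<in> l}. smult (c g) (factor d g h))"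
    unfolding jump_poly_def seen_by_cell_point[OF assms(1,2)]
  proof (rule sum.UNION_disjoint)
    show "finite ?R" using finite_high_edges by simp
    show "\<forall>l\<in>?R. finite {g \<in> generators. ori l \<in> legs g \<and> start g \<in> l}" using finite_generators by simp
    show "\<forall>l\<in>?R. \<forall>l'\<in>?R. l \<noteq> l' \<longrightarrow> {g \<in> generators. ori l \<in> legs g \<and> start g \<in> l} \<inter>
        {g \<in> generators. ori l' \<in> legs g \<and> start g \<in> l'} = {}"
      using l_edge_unique by (fastforce simp: high_edges_def)
  qed
  also have "\<dots> = (\<Sum>l\<in>?R. residue_poly c l)"
    unfolding residue_poly_def by (intro sum.cong refl) auto
  also have "\<dots> = 0" using assms(3) by (intro sum.neutral) auto
  finally show ?thesis .
qed

lemma degree_residue_poly: "degree (residue_poly c l) \<le> d"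
  unfolding residue_poly_def
  by (intro degree_sum_le) (auto intro!: order.trans[OF degree_smult_le] degree_factor finite_generators)

lemma residue_poly_eqI:
  assumes "\<And>k. k \<le> d \<Longrightarrow> coeff (residue_poly c l) k = 0"
  shows "residue_poly c l = 0"
proof (rule poly_eqI)
  fix k
  show "coeff (residue_poly c l) k = coeff 0 k"
    using assms[of k] degree_residue_poly[of c l] coeff_eq_0[of "residue_poly c l" k] by (cases "k \<le> d") auto
qed

lemma coeff_residue_poly:
  "coeff (residue_poly c l) k =
    (\<Sum>g\<in>{g \<in> generators. ori l \<in> legs g \<and> start g \<in> l}. c g * coeff (factor d g (ori l)) k)"
  unfolding residue_poly_def coeff_sum coeff_smult ..

text \<open>An edge function that starts on \<open>l\<close> in its direction belongs to
  \<open>l\<close> itself, which is impossible when \<open>l\<close> does not begin on the boundary.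
  Only the vertex functions on \<open>l\<close> remain.\<close>

lemma residue_poly_zero_if:
  assumes "l \<in> interior_l_edges M" "l \<notin> low_edges" "\<And>v. v \<in> vertices_on M l \<Longrightarrow> c (Vert v) = 0"
  shows "residue_poly c l = 0"
  unfolding residue_poly_def
proof (rule sum.neutral, rule ballI)
  fix g assume "g \<in> {g \<in> generators. ori l \<in> legs g \<and> start g \<in> l}"
  then have g: "g \<in> generators" "ori l \<in> legs g" "start g \<in> l" by auto
  show "smult (c g) (factor d g (ori l)) = 0"
    using g(1)
  proof (cases rule: generatorE)
    case (Mono i j)
    then show ?thesis using g(2) by simp
  next
    case (Vert v)
    then have "v \<in> vertices_on M l" using g(3) by (auto simp: vertices_on_def interior_vertices_def)
    then show ?thesis using assms(3) Vert(1) by simp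
  next
    case (Edge l' j)
    then have l': "l' \<in> interior_l_edges M" by (simp add: low_edges_def)
    have "l' = l"
      using l_edge_unique[OF l' assms(1), of "low l'"] g(2,3) Edge(1) low_high_in_l_edge(1)[OF l'] by simp
    then show ?thesis using assms(2) Edge(2) by simp
  qed
qed

text \<open>Two kinds of conditions are allowed: \<open>Inl\<close> is one coefficient of a residue,
  \<open>Inr\<close> the coefficient of one vertex function. Any finite set of them that forces all
  residues to vanish gives a bound.\<close>

lemma generators_le_dim:
  fixes \<Lambda> :: "((real \<times> real) set \<times> nat + real \<times> real) set"
  defines "\<phi> \<equiv> \<lambda>k c. case k of Inl (l, j) \<Rightarrow> coeff (residue_poly c l) j | Inr v \<Rightarrow> c (Vert v)"
  assumes "finite \<Lambda>"
    and "\<And>c l. (\<And>k. k \<in> \<Lambda> \<Longrightarrow> \<phi> k c = 0) \<Longrightarrow> l \<in> high_edges \<Longrightarrow> residue_poly c l = 0"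
  shows "card generators \<le> spline_dim d M + card \<Lambda>"
proof -
  obtain W where W: "finite W" "spline_space d M \<subseteq> module.span fun_scale W"
    by (rule spline_space_finite_dim[OF finite_cells])
  show ?thesis
    unfolding spline_dim_def
  proof (rule card_le_dim_fun_space[where \<Phi> = basis and \<phi> = \<phi>, OF finite_generators assms(2) _ _ _ _ W])
    show "c g = 0" if "\<And>z. (\<Sum>g\<in>generators. c g * basis g z) = 0" "g \<in> generators" for c g
      using comb_inj[of c g] that by (simp add: comb_def)
    show "\<phi> k (\<lambda>i. x i + y i) = \<phi> k x + \<phi> k y" for k x y
      unfolding \<phi>_def coeff_residue_poly
      by (auto simp: sum.distrib[symmetric] algebra_simps split: sum.split)
    show "\<phi> k (\<lambda>i. r * x i) = r * \<phi> k x" for k r x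
      unfolding \<phi>_def coeff_residue_poly
      by (auto simp: sum_distrib_left mult.assoc split: sum.split)
    show "(\<lambda>z. \<Sum>g\<in>generators. c g * basis g z) \<in> spline_space d M" if "\<And>k. k \<in> \<Lambda> \<Longrightarrow> \<phi> k c = 0" for c
    proof -
      have "comb c \<in> spline_space d M"
      proof (rule comb_in_spline_space)
        fix K h z assume K: "K \<in> M" "z \<in> interior K"
        show "jump_poly c h z = 0"
          by (rule jump_poly_cell_point[OF K]) (rule assms(3)[OF that])
      qed
      then show ?thesis unfolding comb_def[abs_def] .
    qed
  qed
qed

lemma has_endpoints_l_edge:
  assumes "l \<in> interior_l_edges M"
  shows "has_endpoints l S \<longleftrightarrow> low l \<in> S \<and> high l \<in> S"
proof -
  note l = l_edge_decompose[OF assms]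
  have hpt: "high l = pt (ori l) (crd (ori l) (high l)) (crd (\<not> ori l) (low l))"
    using pt_crd[of "ori l" "high l"] unfolding l(3) by simp
  have lseg: "l = closed_segment (low l) (high l)"
    using l(1) closed_segment_pt[of "crd (ori l) (low l)" "crd (ori l) (high l)" "ori l" "crd (\<not> ori l) (low l)"]
      l(2) hpt by simp
  show ?thesis
  proof
    assume "has_endpoints l S"
    then obtain a b where ab: "l = closed_segment a b" "a \<in> S" "b \<in> S" unfolding has_endpoints_def by blast
    have "closed_segment (low l) (high l) = closed_segment a b" using ab(1) lseg by simp
    then have "{low l, high l} = {a, b}" by (simp only: closed_segment_eq)
    then show "low l \<in> S \<and> high l \<in> S" using ab(2,3) by (auto simp: doubleton_eq_iff)
  next
    assume S: "low l \<in> S \<and> high l \<in> S"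
    have "low l \<noteq> high l" using l(2) by auto
    moreover have "axis_aligned (low l) (high l)"
      using axis_aligned_pt[of "ori l" "crd (ori l) (low l)" "crd (\<not> ori l) (low l)" "crd (ori l) (high l)"] hpt by simp
    ultimately show "has_endpoints l S" unfolding has_endpoints_def using lseg S by blast
  qed
qed

lemma T_junction_iff:
  assumes "z \<in> T_junctions M \<union> boundary_vertices M"
  shows "z \<in> T_junctions M \<longleftrightarrow> z \<notin> frontier \<Omega>" "z \<in> boundary_vertices M \<longleftrightarrow> z \<in> frontier \<Omega>"
  using assms frontier_domain by (auto simp: T_junctions_def interior_vertices_def boundary_vertices_def)

text \<open>A ray whose lower end is on the boundary lies in both \<open>low_edges\<close> and
  \<open>high_edges\<close>, any other ray in neither, so differences of the two sets isolate
  cross-cuts and T \<open>l\<close>-edges.\<close>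

lemma cross_cuts_eq: "cross_cuts M = low_edges - high_edges"
  unfolding cross_cuts_def low_edges_def high_edges_def
  using has_endpoints_l_edge T_junction_iff(2)[OF l_edge_ends(1)] T_junction_iff(2)[OF l_edge_ends(2)] by auto

lemma T_l_edges_eq: "T_l_edges M = high_edges - low_edges"
  unfolding T_l_edges_def low_edges_def high_edges_def
  using has_endpoints_l_edge T_junction_iff(1)[OF l_edge_ends(1)] T_junction_iff(1)[OF l_edge_ends(2)] by auto

lemma card_low_high:
  "int (card low_edges) - int (card high_edges) = int (card (cross_cuts M)) - int (card (T_l_edges M))"
proof -
  have "card low_edges = card (low_edges \<inter> high_edges) + card (low_edges - high_edges)"
    using sum.Int_Diff[OF finite_low_edges, of "\<lambda>_. 1::nat" high_edges] by simp
  moreover have "card high_edges = card (low_edges \<inter> high_edges) + card (high_edges - low_edges)"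
    using sum.Int_Diff[OF finite_high_edges, of "\<lambda>_. 1::nat" low_edges] by (simp add: Int_commute)
  ultimately show ?thesis unfolding cross_cuts_eq T_l_edges_eq by simp
qed

text \<open>The two arguments of \<open>max\<close> come from two systems of conditions:
  \<open>?\<Lambda>1\<close> demands all residue coefficients to vanish, \<open>?\<Lambda>2\<close>
  trades those of \<open>T1\<close> for the coefficients of the vertices on \<open>T1\<close>. The
  gain of the second is the difference of their cardinalities.\<close>

lemma L_K_le_spline_dim:
  assumes T1: "T1 \<subseteq> T_l_edges M"
  shows "L_K d M T1 \<le> int (spline_dim d M)"
proof -
  have T1h: "T1 \<subseteq> high_edges" using T1 by (auto simp: T_l_edges_eq)
  have finT1: "finite T1" using T1h finite_high_edges finite_subset by blast
  let ?\<Lambda>1 = "Inl ` (high_edges \<times> {..d}) :: ((real \<times> real) set \<times> nat + real \<times> real) set"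
  let ?\<Lambda>2 = "Inl ` ((high_edges - T1) \<times> {..d}) \<union> Inr ` vertices_on M (\<Union>T1) :: ((real \<times> real) set \<times> nat + real \<times> real) set"
  have fin: "finite ?\<Lambda>1" "finite (Inl ` ((high_edges - T1) \<times> {..d}) :: ((real \<times> real) set \<times> nat + real \<times> real) set)"
    "finite (vertices_on M (\<Union>T1))"
    using finite_high_edges finite_vertices by (auto simp: vertices_on_def)
  have 1: "card generators \<le> spline_dim d M + card ?\<Lambda>1"
  proof (rule generators_le_dim[OF fin(1)])
    fix c l
    assume *: "\<And>k. k \<in> ?\<Lambda>1 \<Longrightarrow> (case k of Inl (l, j) \<Rightarrow> coeff (residue_poly c l) j | Inr v \<Rightarrow> c (Vert v)) = 0"
      and l: "l \<in> high_edges"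
    show "residue_poly c l = 0"
    proof (rule residue_poly_eqI)
      fix k assume "k \<le> d"
      then show "coeff (residue_poly c l) k = 0" using *[of "Inl (l, k)"] l by auto
    qed
  qed
  have 2: "card generators \<le> spline_dim d M + card ?\<Lambda>2"
  proof (rule generators_le_dim)
    show "finite ?\<Lambda>2" using fin by auto
    fix c l
    assume *: "\<And>k. k \<in> ?\<Lambda>2 \<Longrightarrow> (case k of Inl (l, j) \<Rightarrow> coeff (residue_poly c l) j | Inr v \<Rightarrow> c (Vert v)) = 0"
      and l: "l \<in> high_edges"
    show "residue_poly c l = 0"
    proof (cases "l \<in> T1")
      case True
      have "c (Vert v) = 0" if "v \<in> vertices_on M l" for v
      proof -
        have "v \<in> vertices_on M (\<Union>T1)" using that True by (auto simp: vertices_on_def)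
        then show ?thesis using *[of "Inr v"] by auto
      qed
      moreover have "l \<in> interior_l_edges M" "l \<notin> low_edges"
        using True T1 l by (auto simp: T_l_edges_eq high_edges_def)
      ultimately show ?thesis by (intro residue_poly_zero_if)
    next
      case False
      show ?thesis
      proof (rule residue_poly_eqI)
        fix k assume "k \<le> d"
        then show "coeff (residue_poly c l) k = 0" using *[of "Inl (l, k)"] l False by auto
      qed
    qed
  qed
  have card1: "card ?\<Lambda>1 = card high_edges * (d + 1)"
    by (subst card_image) (auto simp: card_cartesian_product)
  have "card ?\<Lambda>2 = card (high_edges - T1) * (d + 1) + card (vertices_on M (\<Union>T1))"
    using fin by (subst card_Un_disjoint) (auto simp: card_image card_cartesian_product)
  also have "card (high_edges - T1) = card high_edges - card T1"
    using T1h finT1 by (intro card_Diff_subset)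
  finally have eq: "card ?\<Lambda>2 = (card high_edges - card T1) * (d + 1) + card (vertices_on M (\<Union>T1))" .
  have "int (card high_edges - card T1) = int (card high_edges) - int (card T1)"
    using card_mono[OF finite_high_edges T1h] by (rule of_nat_diff)
  then have card2: "int (card ?\<Lambda>2) = (int (card high_edges) - int (card T1)) * (int d + 1) + int (card (vertices_on M (\<Union>T1)))"
    unfolding eq of_nat_add of_nat_mult by simp
  have cg: "int (card generators) = (int d + 1)\<^sup>2 + int (card (interior_vertices M)) + int (card low_edges) * (int d + 1)"
    unfolding card_generators by (simp add: algebra_simps)
  have low: "int (card low_edges) = int (card high_edges) + int (card (cross_cuts M)) - int (card (T_l_edges M))"
    using card_low_high by simp
  have "(int d + 1)\<^sup>2 + (int (card (cross_cuts M)) - int (card (T_l_edges M))) * (int d + 1)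
      + int (card (interior_vertices M)) = int (card generators) - int (card ?\<Lambda>1)"
    unfolding cg card1 low by (simp add: algebra_simps)
  moreover have "int (card generators) - int (card ?\<Lambda>2) = int (card generators) - int (card ?\<Lambda>1) +
      (int (card T1) * (int d + 1) - int (card (vertices_on M (\<Union>T1))))"
    unfolding card1 card2 by (simp add: algebra_simps)
  ultimately show ?thesis using 1 2 unfolding L_K_def by (auto simp: max_def)
qed

end

theorem theorem4p1:
  fixes d :: nat and M :: mesh and T1 :: "(real \<times> real) set set"
  assumes "d \<ge> 1"
    and "t_mesh M"
    and "connected (\<Union>(T_l_edges M))"
    and "\<And>l. l \<in> T_l_edges M \<Longrightarrow> card (vertices_on M l) \<ge> d + 2"
    and "is_CNDC d M T1"
  shows "int (spline_dim d M) \<ge> L_K d M T1"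
proof -
  interpret spline M d using assms(1,2) by unfold_locales
  have "T1 \<subseteq> T_l_edges M"
    using assms(5) unfolding is_CNDC_def complete_partition_def regular_partition_def
    by (auto split: if_splits)
  then show ?thesis by (rule L_K_le_spline_dim)
qed

end
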